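(* Let $C$ be a compact and stable convex subset of a locally convex real Hausdorff vector space $X$. Let $d$ be a distance on $\mathrm{Ext}\,C$ that is continuous on $\mathrm{Ext}\,C\times \mathrm{Ext}\,C$ with respect to the natural topology (the one induced by $X$). Assume that the functions in $$A_{d\text{-Lip}}(C)=\{a:C\to\mathbb{R}\ \text{continuous and affine}:\ |a(z)-a(z_* )|\le d(z,z_* )\ \ \forall z,z_*\in \mathrm{Ext}\,C\}$$ separate the points of $C$. For $p\in[1,\infty)$ let $D_p$ be the $p$-metric convex roof sub-extension of $d$. Then: (1) $(D_p)_{p\ge 1}$ is a nondecreasing family (in $p$) of distances on $C$, whose induced topologies all coincide with the natural topology of $C$; in particular each $(C,D_p)$ is compact. (2) $(C,D_1)$ is geodesic, and if $(\mathrm{Ext}\,C,d)$ is geodesic, then $(C,D_p)$ is geodesic for all $p>1$. (3) For all $p\in[1,\infty)$, $D_p(z,z_* )\le d(z,z_* )$ for all $z,z_*\in \mathrm{Ext}\,C$. If moreover $X=(X,\|\cdot\|)$ is a Banach space endowed with its norm topology and $d(z,z_* )=\|z-z_*\|$ for all $z,z_*\in \mathrm{Ext}\,C$, then $D_p(z,z_* )=d(z,z_* )$ for all $z,z_*\in \mathrm{Ext}\,C$.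
   Context: $\mathrm{Ext}\,C$ is the set of extreme points of $C$. A convex set $C$ is stable when the midpoint map $C\times C\to C$, $(x,y)\mapsto (x+y)/2$, is open (relative topologies). Under these assumptions $\mathrm{Ext}\,C$ is compact. $X^*$ is the set of continuous real linear forms on $X$; $\mathcal{P}(E)$ is the set of Radon probability measures on $E$. For $x,y\in C$, $\mathcal{P}_{(x,y)}$ is the set of $\pi\in\mathcal{P}(\mathrm{Ext}\,C\times \mathrm{Ext}\,C)$ such that $\iint f(z)\,d\pi(z,z_* )=f(x)$ and $\iint f(z_* )\,d\pi(z,z_* )=f(y)$ for all $f\in X^*$. The $p$-convex roof extension of $d$ is $$d_{*p}(x,y)=\Big(\inf_{\pi\in\mathcal{P}_{(x,y)}}\iint d(z,z_* )^p\,d\pi(z,z_* )\Big)^{1/p},\quad x,y\in C,$$ and the $p$-metric convex roof sub-extension of $d$ is its metric envelope $$D_p(x,y)=\inf\Big\{\sum_{j=1}^N d_{*p}(z_j,z_{j+1}):\ N\ge 1,\ z_1=x,\ z_{N+1}=y,\ z_j\in C\Big\}.$$ A metric space is geodesic if any two of its points are joined by a constant-speed geodesic, i.e. a curve $(x_t)_{t\in[0,1]}$ with distance between $x_s$ and $x_t$ equal to $|t-s|$ times the distance between $x_0$ and $x_1$. *)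

theory Defs
  imports "HOL-Probability.Probability"
begin

section \<open>Locally convex Hausdorff real vector spaces\<close>

class locally_convex_space = real_vector + topological_ab_group_add + t2_space +
  assumes tendsto_scaleR_nhds:
    "((\<lambda>u. scaleR (fst u) (snd u)) \<longlongrightarrow> scaleR c x) (nhds c \<times>\<^sub>F nhds x)"
  and locally_convex_at_0:
    "open U \<Longrightarrow> 0 \<in> U \<Longrightarrow> \<exists>V. open V \<and> 0 \<in> V \<and> V \<subseteq> U \<and>
       (\<forall>x\<in>V. \<forall>y\<in>V. \<forall>t\<in>{0..1}. scaleR (1 - t) x + scaleR t y \<in> V)"

instance real_normed_vector < locally_convex_space
proof
  fix c :: real and x :: 'a
  show "((\<lambda>u. fst u *\<^sub>R snd u) \<longlongrightarrow> c *\<^sub>R x) (nhds c \<times>\<^sub>F nhds x)"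
    by (intro tendsto_scaleR filterlim_fst filterlim_snd)
next
  fix U :: "'a set"
  assume "open U" "0 \<in> U"
  then obtain e where e: "e > 0" "ball 0 e \<subseteq> U"
    by (auto simp: open_contains_ball)
  have "\<forall>x\<in>ball 0 e. \<forall>y\<in>ball 0 e. \<forall>t\<in>{0..1}. (1 - t) *\<^sub>R x + t *\<^sub>R y \<in> ball (0::'a) e"
    using convex_ball[of "0::'a" e] unfolding convex_alt by auto
  with e show "\<exists>V. open V \<and> 0 \<in> V \<and> V \<subseteq> U \<and>
       (\<forall>x\<in>V. \<forall>y\<in>V. \<forall>t\<in>{0..1}. (1 - t) *\<^sub>R x + t *\<^sub>R y \<in> V)"
    by (intro exI[of _ "ball 0 e"]) auto
qed

definition dual_space :: "('a::locally_convex_space \<Rightarrow> real) set" where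
  "dual_space = {f. linear f \<and> continuous_on UNIV f}"

text \<open>\<open>N\<close> is a complete norm whose topology is the given topology of the type \<open>'a\<close>.\<close>

definition banach_norm :: "('a::locally_convex_space \<Rightarrow> real) \<Rightarrow> bool" where
  "banach_norm N \<longleftrightarrow>
     (\<forall>x. 0 \<le> N x) \<and> (\<forall>x. N x = 0 \<longleftrightarrow> x = 0) \<and>
     (\<forall>c x. N (c *\<^sub>R x) = \<bar>c\<bar> * N x) \<and> (\<forall>x y. N (x + y) \<le> N x + N y) \<and>
     Metric_space.mtopology UNIV (\<lambda>x y. N (x - y)) = euclidean \<and>
     Metric_space.mcomplete UNIV (\<lambda>x y. N (x - y))"

section \<open>Convex sets\<close>

definition Ext :: "'a::real_vector set \<Rightarrow> 'a set" where
  "Ext C = {z. z extreme_point_of C}"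

definition stable_convex :: "'a::{real_vector,topological_space} set \<Rightarrow> bool" where
  "stable_convex C \<longleftrightarrow> convex C \<and>
     open_map (top_of_set (C \<times> C)) (top_of_set C) (\<lambda>(x, y). (1/2) *\<^sub>R (x + y))"

definition affine_on :: "'a::real_vector set \<Rightarrow> ('a \<Rightarrow> real) \<Rightarrow> bool" where
  "affine_on C a \<longleftrightarrow>
     (\<forall>x\<in>C. \<forall>y\<in>C. \<forall>t\<in>{0..1}. a ((1 - t) *\<^sub>R x + t *\<^sub>R y) = (1 - t) * a x + t * a y)"

definition A_Lip :: "('a \<Rightarrow> 'a \<Rightarrow> real) \<Rightarrow> 'a::{real_vector,topological_space} set \<Rightarrow> ('a \<Rightarrow> real) set"
  where
  "A_Lip d C = {a. continuous_on C a \<and> affine_on C a \<and>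
     (\<forall>z\<in>Ext C. \<forall>w\<in>Ext C. \<bar>a z - a w\<bar> \<le> d z w)}"

section \<open>Radon probability measures and convex roofs\<close>

text \<open>The sigma-algebra is the Borel sigma-algebra of the subspace topology on \<open>E\<close>. For
  \<open>E \<subseteq> 'a \<times> 'a\<close> it is taken from the product topology; when the topology is not second
  countable this may be strictly finer than the product of the Borel sigma-algebras.\<close>

definition radon_prob :: "'b::topological_space set \<Rightarrow> 'b measure set" where
  "radon_prob E = {M. prob_space M \<and> sets M = sets (restrict_space borel E) \<and>
     (\<forall>A\<in>sets M. emeasure M A = (SUP K\<in>{K. compact K \<and> K \<subseteq> A}. emeasure M K))}"

definition couplings :: "'a::locally_convex_space set \<Rightarrow> 'a \<Rightarrow> 'a \<Rightarrow> ('a \<times> 'a) measure set" where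
  "couplings C x y = {\<pi> \<in> radon_prob (Ext C \<times> Ext C).
     \<forall>f\<in>dual_space. (\<integral>u. f (fst u) \<partial>\<pi>) = f x \<and> (\<integral>u. f (snd u) \<partial>\<pi>) = f y}"

definition roof :: "real \<Rightarrow> 'a::locally_convex_space set \<Rightarrow> ('a \<Rightarrow> 'a \<Rightarrow> real) \<Rightarrow> 'a \<Rightarrow> 'a \<Rightarrow> real" where
  "roof p C d x y =
     (INF \<pi>\<in>couplings C x y. \<integral>u. d (fst u) (snd u) powr p \<partial>\<pi>) powr (1 / p)"

text \<open>The value 0 for arguments outside \<open>C\<close> is a convention: the library locale
  \<open>Metric_space C\<close> asks for nonnegativity and symmetry on the whole type.\<close>

definition sub_roof :: "real \<Rightarrow> 'a::locally_convex_space set \<Rightarrow> ('a \<Rightarrow> 'a \<Rightarrow> real) \<Rightarrow> 'a \<Rightarrow> 'a \<Rightarrow> real" where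
  "sub_roof p C d x y =
     (if x \<in> C \<and> y \<in> C
      then Inf {\<Sum>j=1..N. roof p C d (z j) (z (j + 1)) | (N::nat) (z::nat \<Rightarrow> 'a).
                  N \<ge> 1 \<and> z 1 = x \<and> z (N + 1) = y \<and> (\<forall>j\<in>{1..N + 1}. z j \<in> C)}
      else 0)"

definition geodesic_space :: "'a set \<Rightarrow> ('a \<Rightarrow> 'a \<Rightarrow> real) \<Rightarrow> bool" where
  "geodesic_space M d \<longleftrightarrow>
     (\<forall>x\<in>M. \<forall>y\<in>M. \<exists>\<gamma>::real \<Rightarrow> 'a. \<gamma> 0 = x \<and> \<gamma> 1 = y \<and> (\<forall>t\<in>{0..1}. \<gamma> t \<in> M) \<and>
        (\<forall>s\<in>{0..1}. \<forall>t\<in>{0..1}. d (\<gamma> s) (\<gamma> t) = \<bar>t - s\<bar> * d (\<gamma> 0) (\<gamma> 1)))"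

end

theory Submission
  imports Defs
begin

text \<open>Every point of \<open>C\<close> is the barycentre of the law of an \<open>Ext C\<close>-valued random variable on \<open>[0, 1)\<close>,
  built by splitting along a binary tree of closed covers, so couplings of two points exist and can be
  manipulated as pairs of random variables. Functions in \<open>A_Lip\<close> bound the roof from below, which separates
  points. For the upper bound, the roof tends to \<open>0\<close> at an extreme point by Milman's theorem; a general
  point is a finite convex combination of points near extreme points, and stability, which makes the
  decomposition depend openly on the point, transfers the estimate. Hence the identity from \<open>C\<close> to
  \<open>(C, D_p)\<close> is continuous, and a homeomorphism by compactness. Geodesics come from interpolating the
  links of almost optimal chains and from Tychonoff's theorem on \<open>C\<close>-valued curves.\<close>

section \<open>Locally convex spaces\<close>

text \<open>The topology of \<open>'a\<close> need not be second countable, so measurability and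
  regularity have to come from \<open>d\<close>: being continuous and separating points, it embeds
  \<open>Ext C\<close> in a sequence space through the distances to a countable dense set. Convexity
  of the roof itself is available for exponent 1, by mixing couplings; for \<open>p > 1\<close>
  mixing gives convexity only of its p-th power. Estimates are therefore moved between exponents, by
  \<open>d powr p \<le> \<Delta> powr (p - 1) * d\<close> in one direction and by the power mean
  inequality in the other. Couplings of \<open>x\<close>, \<open>y\<close> and of \<open>y\<close>,
  \<open>z\<close> may represent \<open>y\<close> by different measures and then cannot be glued, so
  no triangle inequality for the roof is at hand; this is why estimates near a point pass through an
  auxiliary point \<open>w\<close> and become usable only in the envelope. Geodesics show the same
  contrast: for exponent 1 the straight segment in \<open>C\<close> interpolates a link, while for
  \<open>p > 1\<close> it would give only the factor \<open>t powr (1 / p)\<close>, so the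
  interpolation takes place in \<open>Ext C\<close>, under the integral, along geodesics of
  \<open>d\<close>.\<close>

lemma continuous_on_scaleR_lcs [continuous_intros]:
  fixes g :: "'b::topological_space \<Rightarrow> 'a::locally_convex_space"
  assumes "continuous_on S c" "continuous_on S g"
  shows "continuous_on S (\<lambda>x. c x *\<^sub>R g x)"
  unfolding continuous_on_def
proof
  fix x assume "x \<in> S"
  then have "((\<lambda>y. (c y, g y)) \<longlongrightarrow> (c x, g x)) (at x within S)"
    using assms by (intro tendsto_Pair) (auto simp: continuous_on_def)
  then have "filterlim (\<lambda>y. (c y, g y)) (nhds (c x) \<times>\<^sub>F nhds (g x)) (at x within S)"
    by (simp add: nhds_prod)
  from filterlim_compose[OF tendsto_scaleR_nhds this]
  show "((\<lambda>y. c y *\<^sub>R g y) \<longlongrightarrow> c x *\<^sub>R g x) (at x within S)" by simp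
qed

lemma open_vimage_continuous:
  assumes "open V" "continuous_on UNIV g" shows "open {v. g v \<in> V}"
  using assms open_vimage[of V g] by (simp add: vimage_def)

lemma convex_closure_lcs:
  fixes S :: "'a::locally_convex_space set"
  assumes "convex S" shows "convex (closure S)"
  unfolding convex_alt
proof safe
  fix x y :: 'a and t :: real
  assume "x \<in> closure S" "y \<in> closure S" and t: "0 \<le> t" "t \<le> 1"
  then have xy: "(x, y) \<in> closure (S \<times> S)" by (simp add: closure_Times)
  let ?g = "\<lambda>u::'a\<times>'a. (1 - t) *\<^sub>R fst u + t *\<^sub>R snd u"
  have "?g ` closure (S \<times> S) \<subseteq> closure S"
  proof (rule image_closure_subset)
    show "continuous_on (closure (S \<times> S)) ?g" by (intro continuous_intros)
    have "?g ` (S \<times> S) \<subseteq> S" using assms t by (auto simp: convex_alt)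
    then show "?g ` (S \<times> S) \<subseteq> closure S" using closure_subset by blast
  qed auto
  with xy have "?g (x, y) \<in> closure S" by blast
  then show "(1 - t) *\<^sub>R x + t *\<^sub>R y \<in> closure S" by simp
qed

lemma convex_nhd_0_lcs:
  fixes U :: "'a::locally_convex_space set"
  assumes "open U" "0 \<in> U"
  obtains V where "open V" "0 \<in> V" "V \<subseteq> U" "convex V"
proof -
  from locally_convex_at_0[OF assms] obtain V where "open V" "0 \<in> V" "V \<subseteq> U"
    "\<forall>x\<in>V. \<forall>y\<in>V. \<forall>t\<in>{0..1}. (1 - t) *\<^sub>R x + t *\<^sub>R y \<in> V" by blast
  then show thesis by (intro that[of V]) (auto simp: convex_alt)
qed

text \<open>\<open>G\<close> is a half-size copy of \<open>V\<close> around \<open>x\<close>. A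
  point of its closure differs from some point of \<open>G\<close> by half an element of
  \<open>V\<close>, and two halves add up inside the convex set \<open>V\<close>. Closed convex
  neighbourhoods matter because they contain the closed convex hull of each of their
  subsets.\<close>

lemma closed_convex_nhd_lcs:
  fixes U :: "'a::locally_convex_space set"
  assumes "open U" "x \<in> U"
  obtains G K where "open G" "x \<in> G" "G \<subseteq> K" "K \<subseteq> U" "closed K" "convex K"
proof -
  have "open {v. x + v \<in> U}" using assms(1)
    by (rule open_vimage_continuous) (intro continuous_intros)
  then obtain V where V: "open V" "0 \<in> V" "V \<subseteq> {v. x + v \<in> U}" "convex V"
    using convex_nhd_0_lcs[of "{v. x + v \<in> U}"] assms by auto
  define G where "G = {y. 2 *\<^sub>R (y - x) \<in> V}"
  have oG: "open G" unfolding G_def using V(1)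
    by (rule open_vimage_continuous) (intro continuous_intros)
  have cG: "convex G"
  proof -
    have "2 *\<^sub>R ((1 - t) *\<^sub>R y + t *\<^sub>R z - x) = (1 - t) *\<^sub>R (2 *\<^sub>R (y - x)) + t *\<^sub>R (2 *\<^sub>R (z - x))"
      for y z :: 'a and t by (simp add: algebra_simps)
    then show ?thesis using convexD_alt[OF V(4)] unfolding convex_alt G_def by (simp del: scaleR_scaleR)
  qed
  have "closure G \<subseteq> U"
  proof
    fix y assume y: "y \<in> closure G"
    have "open {w. 2 *\<^sub>R (y - w) \<in> V}" using V(1)
      by (rule open_vimage_continuous) (intro continuous_intros)
    moreover have "y \<in> {w. 2 *\<^sub>R (y - w) \<in> V}" using V(2) by simp
    ultimately obtain w where w: "w \<in> G" "2 *\<^sub>R (y - w) \<in> V"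
      using y open_Int_closure_eq_empty[of "{w. 2 *\<^sub>R (y - w) \<in> V}" G] by blast
    have "y - x = (1 - 1/2) *\<^sub>R (2 *\<^sub>R (y - w)) + (1/2) *\<^sub>R (2 *\<^sub>R (w - x))"
      by (simp add: algebra_simps)
    also have "\<dots> \<in> V" using w by (intro convexD_alt[OF V(4)]) (auto simp: G_def)
    finally show "y \<in> U" using V(3) by auto
  qed
  then show thesis
    by (intro that[of G "closure G"]) (use oG cG V(2) convex_closure_lcs[OF cG] closure_subset[of G] in \<open>auto simp: G_def\<close>)
qed

section \<open>Hahn-Banach\<close>

text \<open>Homogeneity is demanded only as an inequality, which passes easily to infima; scaling
  back by the inverse recovers equality in \<open>sublinear_scaleR\<close>.\<close>

definition sublinear :: "('a::real_vector \<Rightarrow> real) \<Rightarrow> bool" where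
  "sublinear p \<longleftrightarrow> p 0 = 0 \<and> (\<forall>x y. p (x + y) \<le> p x + p y) \<and> (\<forall>r>0. \<forall>x. p (r *\<^sub>R x) \<le> r * p x)"

lemma sublinear_scaleR:
  assumes "sublinear p" "0 \<le> r" shows "p (r *\<^sub>R x) = r * p x"
proof (cases "r = 0")
  case False
  then have r: "r > 0" using assms by simp
  have "p (inverse r *\<^sub>R (r *\<^sub>R x)) \<le> inverse r * p (r *\<^sub>R x)"
    using assms r unfolding sublinear_def by (metis inverse_positive_iff_positive)
  then have "r * p x \<le> p (r *\<^sub>R x)" using r by (simp add: field_simps)
  moreover have "p (r *\<^sub>R x) \<le> r * p x" using assms r by (auto simp: sublinear_def)
  ultimately show ?thesis by simp
qed (use assms in \<open>simp add: sublinear_def\<close>)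

lemma sublinear_minus_le:
  assumes "sublinear p" shows "- p (- x) \<le> p x"
proof -
  have "p (x + (- x)) \<le> p x + p (- x)" using assms unfolding sublinear_def by blast
  then show ?thesis using assms by (simp add: sublinear_def)
qed

text \<open>Lowers \<open>p\<close> as far as the direction \<open>y\<close> allows; the infimum is
  finite because subadditivity bounds it below by \<open>- p (- x)\<close>. A minimal sublinear
  functional cannot be lowered, and the last inequality then says that it is odd at
  \<open>y\<close>.\<close>

lemma sublinear_directional_minorant:
  fixes p :: "'a::real_vector \<Rightarrow> real" and y :: 'a
  assumes p: "sublinear p"
  defines "q \<equiv> \<lambda>x. INF t\<in>{0..}. p (x + t *\<^sub>R y) - t * p y"
  shows "sublinear q" "q x \<le> p x" "q (- y) \<le> - p y"
proof -
  have bd: "- p (- x) \<le> p (x + t *\<^sub>R y) - t * p y" if "t \<ge> 0" for t x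
  proof -
    have "p (t *\<^sub>R y) \<le> p (x + t *\<^sub>R y) + p (- x)"
      using p unfolding sublinear_def by (metis add.commute add_minus_cancel minus_add_cancel)
    then show ?thesis using sublinear_scaleR[OF p that, of y] by simp
  qed
  have bdd: "bdd_below ((\<lambda>t. p (x + t *\<^sub>R y) - t * p y) ` {0..})" for x
    using bd[of _ x] by (intro bdd_belowI2) auto
  have le: "q x \<le> p (x + t *\<^sub>R y) - t * p y" if "t \<ge> 0" for t x
    unfolding q_def using bdd that by (intro cINF_lower) auto
  have ge: "c \<le> q x" if "\<And>t. t \<ge> 0 \<Longrightarrow> c \<le> p (x + t *\<^sub>R y) - t * p y" for c x
    unfolding q_def using that by (intro cINF_greatest) auto
  show "q x \<le> p x" using le[of 0 x] by simp
  have p0: "p 0 = 0" using p by (simp add: sublinear_def)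
  show "q (- y) \<le> - p y" using le[of 1 "- y"] p0 by simp
  show "sublinear q" unfolding sublinear_def
  proof (intro conjI allI impI)
    show "q 0 = 0"
    proof (rule antisym)
      show "q 0 \<le> 0" using le[of 0 0] p0 by simp
      show "0 \<le> q 0" using sublinear_scaleR[OF p] by (intro ge) simp
    qed
    fix x x'
    have "q (x + x') - (p (x + t *\<^sub>R y) - t * p y) \<le> q x'" if t: "t \<ge> 0" for t
    proof (rule ge)
      fix s :: real assume s: "s \<ge> 0"
      have "p ((x + t *\<^sub>R y) + (x' + s *\<^sub>R y)) \<le> p (x + t *\<^sub>R y) + p (x' + s *\<^sub>R y)"
        using p by (simp add: sublinear_def)
      moreover have "(x + t *\<^sub>R y) + (x' + s *\<^sub>R y) = x + x' + (t + s) *\<^sub>R y"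
        by (simp add: algebra_simps)
      ultimately show "q (x + x') - (p (x + t *\<^sub>R y) - t * p y) \<le> p (x' + s *\<^sub>R y) - s * p y"
        using le[of "t + s" "x + x'"] s t by (simp add: algebra_simps)
    qed
    then have "q (x + x') - q x' \<le> q x" by (intro ge) (simp add: algebra_simps)
    then show "q (x + x') \<le> q x + q x'" by simp
  next
    fix r :: real and x assume r: "r > 0"
    have "q (r *\<^sub>R x) / r \<le> q x"
    proof (rule ge)
      fix t :: real assume t: "t \<ge> 0"
      have "p (r *\<^sub>R x + (r * t) *\<^sub>R y) = r * p (x + t *\<^sub>R y)"
        using sublinear_scaleR[OF p, of r "x + t *\<^sub>R y"] r by (simp add: algebra_simps)
      then show "q (r *\<^sub>R x) / r \<le> p (x + t *\<^sub>R y) - t * p y"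
        using le[of "r * t" "r *\<^sub>R x"] r t by (simp add: field_simps)
    qed
    then show "q (r *\<^sub>R x) \<le> r * q x" using r by (simp add: field_simps)
  qed
qed

text \<open>Zorn's lemma for the reversed pointwise order. The infimum of a chain is finite since
  every member is at least \<open>- p (- x)\<close> at \<open>x\<close>, and it is subadditive
  because the smaller of two members of the chain estimates both summands.\<close>

lemma ex_minimal_sublinear:
  fixes p :: "'a::real_vector \<Rightarrow> real"
  assumes p: "sublinear p"
  shows "\<exists>m. sublinear m \<and> m \<le> p \<and> (\<forall>q. sublinear q \<longrightarrow> q \<le> m \<longrightarrow> q = m)"
proof -
  define A where "A = {q. sublinear q \<and> q \<le> p}"
  have "\<exists>m\<in>A. \<forall>a\<in>A. m \<ge> a \<longrightarrow> a = m"
  proof (rule predicate_Zorn)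
    show "partial_order_on A (relation_of (\<ge>) A)"
      by (rule partial_order_on_relation_ofI) auto
  next
    fix K assume K: "K \<in> Chains (relation_of (\<ge>) A)"
    have KA: "K \<subseteq> A" using K by (auto simp: Chains_def relation_of_def)
    have ch: "a \<ge> b \<or> b \<ge> a" if "a \<in> K" "b \<in> K" for a b
      using K that by (auto simp: Chains_def relation_of_def)
    show "\<exists>u\<in>A. \<forall>a\<in>K. a \<ge> u"
    proof (cases "K = {}")
      case True then show ?thesis using p by (auto simp: A_def)
    next
      case False
      define u where "u x = (INF q\<in>K. q x)" for x
      have "- p (- x) \<le> q x" if "q \<in> K" for q x
      proof -
        have "sublinear q" "q \<le> p" using that KA by (auto simp: A_def)
        then show ?thesis using sublinear_minus_le[of q x] le_funD[of q p "- x"] by linarith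
      qed
      then have bdd: "bdd_below ((\<lambda>q. q x) ` K)" for x by (intro bdd_belowI2)
      have le: "u x \<le> q x" if "q \<in> K" for q x
        unfolding u_def using bdd that by (intro cINF_lower) auto
      have ge: "c \<le> u x" if "\<And>q. q \<in> K \<Longrightarrow> c \<le> q x" for c x
        unfolding u_def using that False by (intro cINF_greatest) auto
      have "sublinear u" unfolding sublinear_def
      proof (intro conjI allI impI)
        have "q 0 = 0" if "q \<in> K" for q using that KA by (auto simp: A_def sublinear_def)
        then have "(\<lambda>q. q 0) ` K = (\<lambda>q. 0) ` K" by (intro image_cong) auto
        then show "u 0 = 0" using False by (simp add: u_def)
        fix x y
        have "u (x + y) - q y \<le> u x" if q: "q \<in> K" for q
        proof (rule ge)
          fix q' assume q': "q' \<in> K"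
          obtain r where r: "r \<in> K" "r \<le> q" "r \<le> q'"
            using ch[OF q q'] that[of q] that[of q'] q q' order_refl[of q] order_refl[of q'] by argo
          have "u (x + y) \<le> r (x + y)" using le r by blast
          also have "\<dots> \<le> r x + r y" using r KA by (auto simp: A_def sublinear_def)
          also have "\<dots> \<le> q' x + q y" using r by (auto simp: le_fun_def intro: add_mono)
          finally show "u (x + y) - q y \<le> q' x" by simp
        qed
        then have "u (x + y) - u x \<le> u y" by (intro ge) (simp add: algebra_simps)
        then show "u (x + y) \<le> u x + u y" by simp
      next
        fix r :: real and x assume r: "r > 0"
        have "u (r *\<^sub>R x) / r \<le> u x"
        proof (rule ge)
          fix q assume q: "q \<in> K"
          have "u (r *\<^sub>R x) \<le> q (r *\<^sub>R x)" using le q by blast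
          also have "\<dots> \<le> r * q x" using q KA r by (auto simp: A_def sublinear_def)
          finally show "u (r *\<^sub>R x) / r \<le> q x" using r by (simp add: field_simps)
        qed
        then show "u (r *\<^sub>R x) \<le> r * u x" using r by (simp add: field_simps)
      qed
      moreover have "u \<le> p"
      proof -
        obtain q where "q \<in> K" using False by auto
        moreover have "u \<le> q" using le[OF \<open>q \<in> K\<close>] by (simp add: le_fun_def)
        ultimately show ?thesis using KA by (auto simp: A_def)
      qed
      moreover have "u \<le> a" if "a \<in> K" for a using le[OF that] by (simp add: le_fun_def)
      ultimately show ?thesis unfolding A_def by blast
    qed
  qed
  then obtain m where m: "m \<in> A" "\<And>q. q \<in> A \<Longrightarrow> q \<le> m \<Longrightarrow> q = m" by blast
  have "q = m" if "sublinear q" "q \<le> m" for q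
  proof (rule m(2))
    show "q \<in> A" using m(1) that unfolding A_def by (blast intro: order_trans[of q m p])
  qed (rule that)
  then show ?thesis using m(1) unfolding A_def by blast
qed

lemma ex_directional_minorant:
  fixes p :: "'a::real_vector \<Rightarrow> real" and y :: 'a
  assumes "sublinear p"
  obtains q where "sublinear q" "q \<le> p" "q (- y) \<le> - p y"
  by (rule that[OF sublinear_directional_minorant(1)[OF assms] _ sublinear_directional_minorant(3)[OF assms]])
     (intro le_funI sublinear_directional_minorant(2)[OF assms])

text \<open>A minimal sublinear functional is odd in every direction, hence linear. Lowering
  \<open>p\<close> along \<open>y\<close> before minimising enforces
  \<open>m (- y) \<le> - p y\<close>, which is the equality at \<open>y\<close>.\<close>

lemma Hahn_Banach_sublinear:
  fixes p :: "'a::real_vector \<Rightarrow> real"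
  assumes p: "sublinear p"
  shows "\<exists>f. linear f \<and> (\<forall>x. f x \<le> p x) \<and> f y = p y"
proof -
  obtain q where q: "sublinear q" "q \<le> p" "q (- y) \<le> - p y"
    using ex_directional_minorant[OF p] .
  obtain m where m: "sublinear m" "m \<le> q" "\<And>q. sublinear q \<Longrightarrow> q \<le> m \<Longrightarrow> q = m"
    using ex_minimal_sublinear[OF q(1)] by blast
  have neg: "m (- z) = - m z" for z
  proof -
    obtain q' where q': "sublinear q'" "q' \<le> m" "q' (- z) \<le> - m z"
      using ex_directional_minorant[OF m(1)] .
    have "m (- z) \<le> - m z" using q'(3) m(3)[OF q'(1,2)] by simp
    then show ?thesis using sublinear_minus_le[OF m(1), of "- z"] by simp
  qed
  have sub: "m (x + z) \<le> m x + m z" for x z using m(1) by (simp add: sublinear_def)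
  have add: "m (x + z) = m x + m z" for x z
    using sub[of x z] sub[of "x + z" "- z"] neg[of z] by simp
  have "m (r *\<^sub>R x) = r * m x" for r x
  proof (cases "r \<ge> 0")
    case False
    then show ?thesis
      using sublinear_scaleR[OF m(1), of "- r" x] neg[of "r *\<^sub>R x"] by simp
  qed (rule sublinear_scaleR[OF m(1)])
  then have "linear m" using add by (intro linearI) auto
  moreover have le: "m x \<le> p x" for x
    using order_trans[OF m(2) q(2)] by (rule le_funD)
  moreover have "m y = p y"
    using le_funD[OF m(2), of "- y"] q(3) neg[of y] le[of y] by linarith
  ultimately show ?thesis by blast
qed

section \<open>Minkowski gauges and separation of points from closed convex sets\<close>

definition gauge_of :: "'a::real_vector set \<Rightarrow> 'a \<Rightarrow> real" where
  "gauge_of W v = Inf {r. 0 < r \<and> inverse r *\<^sub>R v \<in> W}"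

lemma open_scaleR_line_lcs:
  fixes W :: "'a::locally_convex_space set"
  assumes "open W" shows "open {c. c *\<^sub>R v \<in> W}"
  using assms by (rule open_vimage_continuous) (intro continuous_intros)

context
  fixes W :: "'a::locally_convex_space set"
  assumes W: "open W" "0 \<in> W" "convex W"
begin

lemma gauge_of_le: "0 < r \<Longrightarrow> inverse r *\<^sub>R v \<in> W \<Longrightarrow> gauge_of W v \<le> r"
  unfolding gauge_of_def by (intro cInf_lower bdd_belowI[of _ 0]) auto

lemma gauge_of_nonempty: "\<exists>r>0. inverse r *\<^sub>R v \<in> W"
proof -
  obtain e where e: "e > 0" "ball 0 e \<subseteq> {c. c *\<^sub>R v \<in> W}"
    using open_scaleR_line_lcs[OF W(1), of v, unfolded open_contains_ball, rule_format, of 0] W(2) by auto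
  then have "inverse (2 / e) *\<^sub>R v \<in> W" by (auto simp: subset_eq dist_real_def)
  then show ?thesis using e by (intro exI[of _ "2 / e"]) auto
qed

lemma gauge_of_lt:
  assumes "gauge_of W v < r" obtains s where "0 < s" "s < r" "inverse s *\<^sub>R v \<in> W"
  using assms gauge_of_nonempty[of v] unfolding gauge_of_def
  by (subst (asm) cInf_less_iff) (auto intro!: bdd_belowI[of _ 0])

lemma gauge_of_sublinear: "sublinear (gauge_of W)"
  unfolding sublinear_def
proof (intro conjI allI impI)
  have "{r. 0 < r \<and> inverse r *\<^sub>R (0::'a) \<in> W} = {0<..}" using W(2) by auto
  then show "gauge_of W 0 = 0" unfolding gauge_of_def by simp
next
  fix x y :: 'a
  show "gauge_of W (x + y) \<le> gauge_of W x + gauge_of W y"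
  proof (rule field_le_epsilon)
    fix e :: real assume e: "e > 0"
    obtain r where r: "0 < r" "r < gauge_of W x + e/2" "inverse r *\<^sub>R x \<in> W"
      using gauge_of_lt[of x "gauge_of W x + e/2"] e by auto
    obtain s where s: "0 < s" "s < gauge_of W y + e/2" "inverse s *\<^sub>R y \<in> W"
      using gauge_of_lt[of y "gauge_of W y + e/2"] e by auto
    have "inverse (r + s) *\<^sub>R (x + y) =
        (1 - s / (r + s)) *\<^sub>R (inverse r *\<^sub>R x) + (s / (r + s)) *\<^sub>R (inverse s *\<^sub>R y)"
      using r s by (simp add: field_simps scaleR_add_right) 
    also have "\<dots> \<in> W" using r s by (intro convexD_alt[OF W(3)]) auto
    finally have "gauge_of W (x + y) \<le> r + s" using r s by (intro gauge_of_le) auto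
    then show "gauge_of W (x + y) \<le> gauge_of W x + gauge_of W y + e" using r s by simp
  qed
next
  fix r :: real and x :: 'a assume r: "0 < r"
  have "gauge_of W (r *\<^sub>R x) / r \<le> gauge_of W x"
  proof (rule dense_ge)
    fix t assume "gauge_of W x < t"
    then obtain s where s: "0 < s" "s < t" "inverse s *\<^sub>R x \<in> W" by (rule gauge_of_lt)
    have "inverse (r * s) *\<^sub>R (r *\<^sub>R x) = inverse s *\<^sub>R x" using r s by simp
    then have "gauge_of W (r *\<^sub>R x) \<le> r * s"
      using gauge_of_le[of "r * s" "r *\<^sub>R x"] s r by (simp del: scaleR_scaleR)
    then have "gauge_of W (r *\<^sub>R x) / r \<le> s" using r by (simp add: field_simps)
    then show "gauge_of W (r *\<^sub>R x) / r \<le> t" using s by simp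
  qed
  then show "gauge_of W (r *\<^sub>R x) \<le> r * gauge_of W x" using r by (simp add: field_simps)
qed

text \<open>Strictness comes from openness: \<open>W\<close> also contains a slightly larger
  multiple of \<open>v\<close>.\<close>

lemma gauge_of_lt_1: assumes "v \<in> W" shows "gauge_of W v < 1"
proof -
  obtain e where e: "e > 0" "ball 1 e \<subseteq> {c. c *\<^sub>R v \<in> W}"
    using open_scaleR_line_lcs[OF W(1), of v, unfolded open_contains_ball, rule_format, of 1] assms by auto
  then have "inverse (inverse (1 + e/2)) *\<^sub>R v \<in> W" by (auto simp: subset_eq dist_real_def)
  then have "gauge_of W v \<le> inverse (1 + e/2)" using e(1)
    by (intro gauge_of_le) auto
  also have "\<dots> < 1" using e by (simp add: field_simps)
  finally show ?thesis .
qed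

lemma gauge_of_ge_1: assumes "v \<notin> W" shows "gauge_of W v \<ge> 1"
proof (rule ccontr)
  assume "\<not> 1 \<le> gauge_of W v"
  then obtain s where s: "0 < s" "s < 1" "inverse s *\<^sub>R v \<in> W" using gauge_of_lt[of v 1] by auto
  have "(1 - s) *\<^sub>R 0 + s *\<^sub>R (inverse s *\<^sub>R v) \<in> W" using W s by (intro convexD_alt) auto
  then show False using s assms by simp
qed

end

lemma real_continuous_onI_nhd:
  fixes f :: "'b::topological_space \<Rightarrow> real"
  assumes "\<And>x e. x \<in> S \<Longrightarrow> e > 0 \<Longrightarrow> \<exists>T. open T \<and> x \<in> T \<and> (\<forall>y\<in>S \<inter> T. \<bar>f y - f x\<bar> \<le> e)"
  shows "continuous_on S f"
  unfolding continuous_on_topological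
proof (intro ballI allI impI)
  fix x B assume x: "x \<in> S" and B: "open B" "f x \<in> B"
  then obtain e where e: "e > 0" "cball (f x) e \<subseteq> B" by (auto simp: open_contains_cball)
  from assms[OF x e(1)] obtain T where "open T" "x \<in> T" "\<forall>y\<in>S \<inter> T. \<bar>f y - f x\<bar> \<le> e" by blast
  then show "\<exists>A. open A \<and> x \<in> A \<and> (\<forall>y\<in>S. y \<in> A \<longrightarrow> f y \<in> B)"
    using e(2) by (intro exI[of _ T]) (auto simp: subset_eq dist_real_def abs_minus_commute)
qed

text \<open>The one-sided bound becomes two-sided by applying it to the rescaled difference of
  \<open>x\<close> and \<open>y\<close> in both orders.\<close>

lemma linear_bounded_nhd_in_dual_space:
  fixes f :: "'a::locally_convex_space \<Rightarrow> real"
  assumes f: "linear f" and W: "open W" "0 \<in> W" "\<And>w. w \<in> W \<Longrightarrow> f w \<le> 1"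
  shows "f \<in> dual_space"
proof -
  have "\<exists>T. open T \<and> x \<in> T \<and> (\<forall>y\<in>T. dist (f y) (f x) \<le> e)" if "e > 0" for x and e :: real
  proof -
    let ?T = "{y. inverse e *\<^sub>R (y - x) \<in> W} \<inter> {y. inverse e *\<^sub>R (x - y) \<in> W}"
    have "open ?T" by (intro open_Int open_vimage_continuous[OF W(1)] continuous_intros)
    moreover have "dist (f y) (f x) \<le> e" if "y \<in> ?T" for y
    proof -
      have "inverse e * (f y - f x) \<le> 1" "inverse e * (f x - f y) \<le> 1"
        using that W(3)[of "inverse e *\<^sub>R (y - x)"] W(3)[of "inverse e *\<^sub>R (x - y)"]
        by (auto simp: linear_cmul[OF f] linear_diff[OF f])
      then show ?thesis using \<open>e > 0\<close> by (auto simp: dist_real_def field_simps abs_le_iff)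
    qed
    ultimately show ?thesis using W(2) by (intro exI[of _ ?T]) auto
  qed
  then have "continuous_on UNIV f"
    by (intro real_continuous_onI_nhd) (auto simp: dist_real_def)
  then show ?thesis using f by (auto simp: dual_space_def)
qed

theorem separation_point_closed_convex:
  fixes K :: "'a::locally_convex_space set"
  assumes K: "closed K" "convex K" "x \<notin> K"
  shows "\<exists>f\<in>dual_space. \<forall>k\<in>K. f k < f x"
proof (cases "K = {}")
  case True
  have "(\<lambda>x. 0) \<in> (dual_space :: ('a \<Rightarrow> real) set)" by (auto simp: dual_space_def intro!: linearI)
  then show ?thesis using True by blast
next
  case False
  then obtain k0 where k0: "k0 \<in> K" by auto
  have "open {v. x - v \<in> - K}" using K(1)
    by (intro open_vimage_continuous continuous_intros) auto
  then obtain V where V: "open V" "0 \<in> V" "V \<subseteq> {v. x - v \<in> - K}" "convex V"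
    using convex_nhd_0_lcs[of "{v. x - v \<in> - K}"] K(3) by auto
  \<comment> \<open>This is \<open>V + K - k0\<close>, open as a union of translates of
    \<open>V\<close>. It misses \<open>x - k0\<close>, because \<open>x - k\<close> in
    \<open>V\<close> would put \<open>k\<close> outside \<open>K\<close>.\<close>
  define W where "W = (\<Union>k\<in>K. {w. w + k0 - k \<in> V})"
  have oW: "open W" unfolding W_def
    by (intro open_UN ballI open_vimage_continuous[OF V(1)] continuous_intros)
  have W0: "0 \<in> W" using k0 V(2) by (auto simp: W_def intro!: bexI[of _ k0])
  have cW: "convex W" unfolding convex_alt
  proof safe
    fix u v and t :: real assume uv: "u \<in> W" "v \<in> W" and t: "0 \<le> t" "t \<le> 1"
    then obtain k l where kl: "k \<in> K" "l \<in> K" "u + k0 - k \<in> V" "v + k0 - l \<in> V"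
      by (auto simp: W_def)
    have "(1 - t) *\<^sub>R (u + k0 - k) + t *\<^sub>R (v + k0 - l) \<in> V"
      using kl t V(4) by (auto simp: convex_alt)
    also have "(1 - t) *\<^sub>R (u + k0 - k) + t *\<^sub>R (v + k0 - l) =
        ((1 - t) *\<^sub>R u + t *\<^sub>R v) + k0 - ((1 - t) *\<^sub>R k + t *\<^sub>R l)"
      by (simp add: algebra_simps)
    finally show "(1 - t) *\<^sub>R u + t *\<^sub>R v \<in> W"
      using kl t K(2) unfolding W_def convex_alt by blast
  qed
  have xW: "x - k0 \<notin> W" using V(3) by (auto simp: W_def)
  obtain f where f: "linear f" "\<And>v. f v \<le> gauge_of W v" "f (x - k0) = gauge_of W (x - k0)"
    using Hahn_Banach_sublinear[OF gauge_of_sublinear[OF oW W0 cW], of "x - k0"] by blast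
  have fW: "f w < 1" if "w \<in> W" for w
    using f(2)[of w] gauge_of_lt_1[OF oW W0 cW that] by simp
  have "f \<in> dual_space"
    by (rule linear_bounded_nhd_in_dual_space[OF f(1) oW W0]) (use fW in force)
  moreover have "f k < f x" if "k \<in> K" for k
  proof -
    have "k - k0 \<in> W" using that V(2) by (auto simp: W_def intro!: bexI[of _ k])
    then have "f (k - k0) < f (x - k0)"
      using fW gauge_of_ge_1[OF oW W0 cW xW] f(3) by fastforce
    then show ?thesis by (simp add: linear_diff[OF f(1)])
  qed
  ultimately show ?thesis by blast
qed

lemma dual_space_separates_points:
  fixes x :: "'a::locally_convex_space"
  assumes "\<And>f. f \<in> dual_space \<Longrightarrow> f x = f y" shows "x = y"
proof (rule ccontr)
  assume "x \<noteq> y"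
  then obtain f where "f \<in> dual_space" "f y < f x"
    using separation_point_closed_convex[of "{y}" x] by auto
  then show False using assms[of f] by simp
qed

section \<open>Extreme points and closed convex hulls\<close>

lemma exposed_face_of:
  fixes f :: "'a::real_vector \<Rightarrow> real"
  assumes "convex F" "linear f"
  shows "{z \<in> F. \<forall>w\<in>F. f w \<le> f z} face_of F"
  unfolding face_of_def
proof (intro conjI ballI impI)
  show "convex {z \<in> F. \<forall>w\<in>F. f w \<le> f z}"
    unfolding convex_alt
  proof (intro ballI allI impI)
    fix x y and u :: real
    assume xy: "x \<in> {z \<in> F. \<forall>w\<in>F. f w \<le> f z}" "y \<in> {z \<in> F. \<forall>w\<in>F. f w \<le> f z}"
      and u: "0 \<le> u \<and> u \<le> 1"
    then have "f x \<le> f y" "f y \<le> f x" by blast+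
    then have "f x = f y" by simp
    then have "f ((1 - u) *\<^sub>R x + u *\<^sub>R y) = f x"
      by (simp add: linear_add[OF assms(2)] linear_cmul[OF assms(2)] left_diff_distrib)
    then show "(1 - u) *\<^sub>R x + u *\<^sub>R y \<in> {z \<in> F. \<forall>w\<in>F. f w \<le> f z}"
      using xy u convexD_alt[OF assms(1), of x y u] by simp
  qed
next
  fix a b x
  assume ab: "a \<in> F" "b \<in> F" and x: "x \<in> {z \<in> F. \<forall>w\<in>F. f w \<le> f z}" and "x \<in> open_segment a b"
  then obtain u where u: "0 < u" "u < 1" "x = (1 - u) *\<^sub>R a + u *\<^sub>R b" by (auto simp: in_segment)
  have fx: "f x = (1 - u) * f a + u * f b" using u by (simp add: linear_add[OF assms(2)] linear_cmul[OF assms(2)])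
  have le: "f a \<le> f x" "f b \<le> f x" using ab x by auto
  have "(1 - u) * (f x - f a) + u * (f x - f b) = 0" using fx by (simp add: algebra_simps)
  moreover have "(1 - u) * (f x - f a) \<ge> 0" "u * (f x - f b) \<ge> 0" using le u by auto
  ultimately have "(1 - u) * (f x - f a) = 0" "u * (f x - f b) = 0" by linarith+
  then have "f a = f x" "f b = f x" using u by auto
  then show "a \<in> {z \<in> F. \<forall>w\<in>F. f w \<le> f z}" "b \<in> {z \<in> F. \<forall>w\<in>F. f w \<le> f z}"
    using x ab by auto
qed auto

lemma dual_space_continuous_on: "f \<in> dual_space \<Longrightarrow> continuous_on S f"
  by (auto simp: dual_space_def intro: continuous_on_subset)

lemma dual_space_linear: "f \<in> dual_space \<Longrightarrow> linear f"
  by (auto simp: dual_space_def)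

text \<open>By compactness Zorn's lemma gives a minimal nonempty closed face inside
  \<open>G\<close>. The subface where a continuous functional is maximal must be all of it, so every
  functional is constant there; as functionals separate points, the minimal face is a single
  point.\<close>

lemma ex_extreme_point_in_face:
  fixes C :: "'a::locally_convex_space set"
  assumes C: "compact C" and G: "G face_of C" "closed G" "G \<noteq> {}"
  shows "\<exists>e\<in>G. e extreme_point_of C"
proof -
  define A where "A = {F. F face_of C \<and> closed F \<and> F \<noteq> {} \<and> F \<subseteq> G}"
  have "\<exists>M\<in>A. \<forall>F\<in>A. M \<supseteq> F \<longrightarrow> F = M"
  proof (rule predicate_Zorn)
    show "partial_order_on A (relation_of (\<supseteq>) A)"
      by (rule partial_order_on_relation_ofI) auto
  next
    fix K assume K: "K \<in> Chains (relation_of (\<supseteq>) A)"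
    have KA: "K \<subseteq> A" using K by (auto simp: Chains_def relation_of_def)
    have ch: "a \<supseteq> b \<or> b \<supseteq> a" if "a \<in> K" "b \<in> K" for a b
      using K that by (auto simp: Chains_def relation_of_def)
    show "\<exists>u\<in>A. \<forall>a\<in>K. a \<supseteq> u"
    proof (cases "K = {}")
      case True then show ?thesis using G by (auto simp: A_def)
    next
      case False
      have fin: "\<Inter>K' \<in> K" if "finite K'" "K' \<noteq> {}" "K' \<subseteq> K" for K'
        using that
      proof (induction K' rule: finite_ne_induct)
        case (insert a K')
        then have "\<Inter>K' \<in> K" "a \<in> K" by auto
        with ch[of a "\<Inter>K'"] show ?case by (auto simp: Int_absorb1 Int_absorb2)
      qed auto
      have "C \<inter> \<Inter>K \<noteq> {}"
      proof (rule compact_imp_fip[OF C])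
        show "closed T" if "T \<in> K" for T using that KA by (auto simp: A_def)
        show "C \<inter> \<Inter>K' \<noteq> {}" if "finite K'" "K' \<subseteq> K" for K'
        proof (cases "K' = {}")
          case True
          then show ?thesis using G face_of_imp_subset by fastforce
        next
          case False
          then have "\<Inter>K' \<in> A" using fin that KA by blast
          then show ?thesis using face_of_imp_subset by (fastforce simp: A_def)
        qed
      qed
      moreover have "\<Inter>K face_of C" using False KA by (intro face_of_Inter) (auto simp: A_def)
      moreover have "closed (\<Inter>K)" using KA by (intro closed_Inter) (auto simp: A_def)
      moreover have "\<Inter>K \<subseteq> G" using False KA by (auto simp: A_def)
      ultimately have "\<Inter>K \<in> A" by (auto simp: A_def)
      then show ?thesis by blast
    qed
  qed
  then obtain M where M: "M \<in> A" and min: "\<And>F. F \<in> A \<Longrightarrow> F \<subseteq> M \<Longrightarrow> F = M" by blast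
  have Mf: "M face_of C" "closed M" "M \<noteq> {}" "M \<subseteq> G" using M by (auto simp: A_def)
  have cM: "compact M" using C Mf face_of_imp_subset compact_Int_closed[of C M]
    by (metis inf.absorb_iff2)
  obtain e where e: "e \<in> M" using Mf by auto
  have "x = e" if x: "x \<in> M" for x
  proof (rule dual_space_separates_points)
    fix f :: "'a \<Rightarrow> real" assume f: "f \<in> dual_space"
    let ?F = "{z \<in> M. \<forall>w\<in>M. f w \<le> f z}"
    have cf: "continuous_on M f" using f by (rule dual_space_continuous_on)
    have ne: "?F \<noteq> {}" using continuous_attains_sup[OF cM Mf(3) cf] by auto
    then obtain z where z: "z \<in> M" "\<forall>w\<in>M. f w \<le> f z" by auto
    have "?F = M \<inter> {y. f z \<le> f y}" using z by (auto intro: order_trans)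
    moreover have "closed {y. f z \<le> f y}"
      by (intro closed_Collect_le continuous_intros dual_space_continuous_on[OF f])
    ultimately have "closed ?F" using Mf(2) by auto
    moreover have "?F face_of C"
      using exposed_face_of[OF face_of_imp_convex[OF Mf(1)] dual_space_linear[OF f]] Mf(1)
      by (rule face_of_trans)
    ultimately have "?F \<in> A" using ne Mf(4) by (auto simp: A_def)
    then have "?F = M" by (intro min) auto
    then show "f x = f e" using x e by (intro antisym) blast+
  qed
  then have "M = {e}" using e by blast
  then show ?thesis using Mf face_of_singleton[of e C] e by blast
qed

text \<open>The closed convex hull. The hull operator is preferred to the closure of a convex hull
  because minimality is the property that the arguments use.\<close>

definition cco :: "'a::{real_vector,topological_space} set \<Rightarrow> 'a set" where
  "cco F = (\<lambda>S. closed S \<and> convex S) hull F"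

lemma cco_superset: "F \<subseteq> cco F"
  unfolding cco_def by (rule hull_subset)

lemma cco_minimal: "F \<subseteq> K \<Longrightarrow> closed K \<Longrightarrow> convex K \<Longrightarrow> cco F \<subseteq> K"
  unfolding cco_def by (intro hull_minimal) auto

lemma cco_mono: "F \<subseteq> G \<Longrightarrow> cco F \<subseteq> cco G"
  unfolding cco_def by (rule hull_mono)

lemma closed_cco: "closed (cco F)" and convex_cco: "convex (cco F)"
  using hull_in[of "\<lambda>S. closed S \<and> convex S" F] unfolding cco_def
  by (auto intro: closed_Inter convex_Inter)

lemma cco_empty [simp]: "cco {} = {}"
  using cco_minimal[of "{}" "{}"] by auto

text \<open>If \<open>f\<close> separated \<open>x\<close> in \<open>C\<close> from the hull, the
  face where \<open>f\<close> is maximal on \<open>C\<close> would contain an extreme point, and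
  there \<open>f\<close> is at least \<open>f x\<close>.\<close>

theorem Krein_Milman:
  fixes C :: "'a::locally_convex_space set"
  assumes C: "compact C" "convex C"
  shows "C = cco (Ext C)"
proof (rule antisym)
  show "cco (Ext C) \<subseteq> C"
    using C by (intro cco_minimal) (auto simp: Ext_def extreme_point_of_def compact_imp_closed)
  show "C \<subseteq> cco (Ext C)"
  proof (rule ccontr)
    assume "\<not> C \<subseteq> cco (Ext C)"
    then obtain x where x: "x \<in> C" "x \<notin> cco (Ext C)" by auto
    obtain f where f: "f \<in> dual_space" "\<And>k. k \<in> cco (Ext C) \<Longrightarrow> f k < f x"
      using separation_point_closed_convex[OF closed_cco convex_cco x(2)] by blast
    let ?G = "{z \<in> C. \<forall>w\<in>C. f w \<le> f z}"
    obtain z where z: "z \<in> C" "\<forall>w\<in>C. f w \<le> f z"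
      using continuous_attains_sup[OF C(1) _ dual_space_continuous_on[OF f(1)]] x(1) by auto
    have "?G = C \<inter> {y. f z \<le> f y}" using z by (auto intro: order_trans)
    moreover have "closed {y. f z \<le> f y}"
      by (intro closed_Collect_le continuous_intros dual_space_continuous_on[OF f(1)])
    ultimately have "closed ?G" using compact_imp_closed[OF C(1)] by auto
    then obtain e where e: "e \<in> ?G" "e extreme_point_of C"
      using ex_extreme_point_in_face[OF C(1) exposed_face_of[OF C(2) dual_space_linear[OF f(1)]]] z
      by blast
    then have "f e < f x" using f(2) cco_superset[of "Ext C"] by (auto simp: Ext_def)
    then show False using e x(1) by fastforce
  qed
qed

text \<open>The weights are left unnormalised so that a total weight 0 is absorbed here and not in
  each use.\<close>

lemma convex_pair_merge:
  assumes "convex S" "x \<in> S" "y \<in> S" "0 \<le> a" "0 \<le> (b::real)"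
  obtains z where "z \<in> S" "a *\<^sub>R x + b *\<^sub>R y = (a + b) *\<^sub>R z"
proof (cases "a + b = 0")
  case True
  then have "a = 0" "b = 0" using assms by linarith+
  then show thesis using that[of x] assms by auto
next
  case False
  show thesis
  proof (rule that)
    have "a / (a + b) + b / (a + b) = 1" using False by (simp flip: add_divide_distrib)
    then show "(a / (a + b)) *\<^sub>R x + (b / (a + b)) *\<^sub>R y \<in> S"
      using assms by (intro convexD) auto
  qed (use False in \<open>simp add: scaleR_add_right\<close>)
qed

text \<open>A combination of two points of the join carries four weights; they regroup into a
  \<open>K\<close>-part of weight \<open>1 - T\<close> and an \<open>L\<close>-part of weight
  \<open>T\<close>.\<close>

lemma convex_join:
  fixes K L :: "'a::real_vector set"
  assumes K: "convex K" and L: "convex L"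
  shows "convex ((\<lambda>(u::real, a, b). (1 - u) *\<^sub>R a + u *\<^sub>R b) ` ({0..1} \<times> K \<times> L))" (is "convex (?g ` ?S)")
  unfolding convex_alt
proof safe
  fix s t t' :: real and a a' b b'
  assume s: "0 \<le> s" "s \<le> 1" and t: "t \<in> {0..1}" "t' \<in> {0..1}" and ab: "a \<in> K" "a' \<in> K" "b \<in> L" "b' \<in> L"
  define T where "T = (1 - s) * t + s * t'"
  have T: "0 \<le> T" "T \<le> 1"
    using s t convex_bound_le[of t 1 t' "1 - s" s] by (auto simp: T_def)
  obtain a'' where a'': "a'' \<in> K" "((1 - s) * (1 - t)) *\<^sub>R a + (s * (1 - t')) *\<^sub>R a' =
      ((1 - s) * (1 - t) + s * (1 - t')) *\<^sub>R a''"
    by (rule convex_pair_merge[OF K ab(1,2), of "(1 - s) * (1 - t)" "s * (1 - t')"]) (use s t in auto)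
  obtain b'' where b'': "b'' \<in> L" "((1 - s) * t) *\<^sub>R b + (s * t') *\<^sub>R b' = ((1 - s) * t + s * t') *\<^sub>R b''"
    by (rule convex_pair_merge[OF L ab(3,4), of "(1 - s) * t" "s * t'"]) (use s t in auto)
  have "(1 - s) *\<^sub>R ((1 - t) *\<^sub>R a + t *\<^sub>R b) + s *\<^sub>R ((1 - t') *\<^sub>R a' + t' *\<^sub>R b') =
      (((1 - s) * (1 - t)) *\<^sub>R a + (s * (1 - t')) *\<^sub>R a') + (((1 - s) * t) *\<^sub>R b + (s * t') *\<^sub>R b')"
    by (simp add: scaleR_add_right)
  also have "\<dots> = (1 - T) *\<^sub>R a'' + T *\<^sub>R b''"
    unfolding a'' b'' T_def by (simp add: algebra_simps)
  finally show "(1 - s) *\<^sub>R ((1 - t) *\<^sub>R a + t *\<^sub>R b) + s *\<^sub>R ((1 - t') *\<^sub>R a' + t' *\<^sub>R b') \<in> ?g ` ?S"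
    using T a''(1) b''(1) by (auto intro!: image_eqI[of _ _ "(T, a'', b'')"])
qed

text \<open>The join of \<open>cco (F \<inter> A)\<close> and \<open>cco (F \<inter> B)\<close> is a
  continuous image of a compact set, hence closed; it is convex and contains \<open>F\<close>, so it
  contains \<open>cco F\<close>. Either hull may be empty, so membership is claimed only for a point
  of positive weight and the other point is merely some point of \<open>C\<close>. Milman's theorem,
  the splitting tree and \<open>near_exists\<close> all run on this decomposition.\<close>

lemma cco_split:
  fixes C :: "'a::locally_convex_space set"
  assumes C: "compact C" "convex C" and F: "F \<subseteq> C" "F \<subseteq> A \<union> B" and k: "k \<in> cco F"
  shows "\<exists>l k0 k1. 0 \<le> l \<and> l \<le> 1 \<and> k0 \<in> C \<and> k1 \<in> C \<and> k = (1 - l) *\<^sub>R k0 + l *\<^sub>R k1 \<and>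
    (l < 1 \<longrightarrow> k0 \<in> cco (F \<inter> A)) \<and> (l > 0 \<longrightarrow> k1 \<in> cco (F \<inter> B))"
proof -
  have sub: "cco (F \<inter> S) \<subseteq> C" for S
    using C F by (intro cco_minimal) (auto simp: compact_imp_closed)
  have kC: "k \<in> C" using k sub[of UNIV] by auto
  consider "F \<inter> A = {}" | "F \<inter> B = {}" | "F \<inter> A \<noteq> {}" "F \<inter> B \<noteq> {}" by blast
  then show ?thesis
  proof cases
    case 1
    then have "F \<inter> B = F" using F by auto
    then show ?thesis using k kC by (intro exI[of _ 1] exI[of _ k]) auto
  next
    case 2
    then have "F \<inter> A = F" using F by auto
    then show ?thesis using k kC by (intro exI[of _ 0] exI[of _ k]) auto
  next
    case 3
    let ?K = "cco (F \<inter> A)" and ?L = "cco (F \<inter> B)"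
    have comp: "compact (cco (F \<inter> S))" for S
      using compact_Int_closed[OF C(1) closed_cco[of "F \<inter> S"]] sub[of S] by (simp add: inf.absorb2)
    let ?g = "\<lambda>(u::real, a, b). (1 - u) *\<^sub>R a + u *\<^sub>R (b::'a)"
    have ne: "?K \<noteq> {}" "?L \<noteq> {}" using 3 cco_superset[of "F \<inter> A"] cco_superset[of "F \<inter> B"] by auto
    let ?J = "?g ` ({0..1} \<times> ?K \<times> ?L)"
    have "compact ?J"
      by (intro compact_continuous_image compact_Times comp)
         (auto simp: split_def intro!: continuous_intros)
    moreover have "F \<subseteq> ?J"
    proof
      obtain a b where ab: "a \<in> ?K" "b \<in> ?L" using ne by auto
      fix z assume "z \<in> F"
      then consider "z \<in> ?K" | "z \<in> ?L" using F cco_superset[of "F \<inter> A"] cco_superset[of "F \<inter> B"] by blast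
      then show "z \<in> ?J"
        by cases (use ab in \<open>force intro: image_eqI[of _ _ "(0, z, b)"]\<close>,
          use ab in \<open>force intro: image_eqI[of _ _ "(1, a, z)"]\<close>)
    qed
    ultimately have "cco F \<subseteq> ?J"
      by (intro cco_minimal compact_imp_closed convex_join convex_cco)
    with k have "k \<in> ?J" by blast
    then obtain u a b where u: "0 \<le> u" "u \<le> 1" "a \<in> ?K" "b \<in> ?L" "k = (1 - u) *\<^sub>R a + u *\<^sub>R b"
      by auto
    moreover have "a \<in> C" "b \<in> C" using u sub by blast+
    ultimately show ?thesis by blast
  qed
qed

text \<open>The cover is split off one set at a time. An extreme point cannot lie strictly between
  the two pieces of a splitting, so it equals a piece of positive weight, and the piece cut out by
  \<open>K i\<close> has its hull inside \<open>K i\<close>.\<close>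

lemma extreme_in_finite_cover:
  fixes C :: "'a::locally_convex_space set"
  assumes C: "compact C" "convex C" and e: "e extreme_point_of C"
    and I: "finite I" and K: "\<And>i. i \<in> I \<Longrightarrow> closed (K i) \<and> convex (K i)"
    and F: "F \<subseteq> C" "F \<subseteq> (\<Union>i\<in>I. K i)" "e \<in> cco F"
  shows "\<exists>i\<in>I. e \<in> K i"
  using I K F
proof (induction I arbitrary: F)
  case (insert i I)
  obtain l k0 k1 where l: "0 \<le> l" "l \<le> 1" "k0 \<in> C" "k1 \<in> C" "e = (1 - l) *\<^sub>R k0 + l *\<^sub>R k1"
    "l < 1 \<Longrightarrow> k0 \<in> cco (F \<inter> K i)" "l > 0 \<Longrightarrow> k1 \<in> cco (F \<inter> (\<Union>i\<in>I. K i))"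
    using cco_split[OF C, of F "K i" "\<Union>i\<in>I. K i" e] insert by auto
  have "e = k0 \<and> l < 1 \<or> e = k1 \<and> l > 0"
  proof -
    have "e \<notin> open_segment k0 k1" using e l(3,4) by (auto simp: extreme_point_of_def)
    then have "\<not> (k0 \<noteq> k1 \<and> 0 < l \<and> l < 1)" using l(5) unfolding in_segment by blast
    then have "l = 0 \<or> l = 1 \<or> k0 = k1" using l(1,2) by linarith
    then show ?thesis using l(5) by (auto simp: algebra_simps)
  qed
  then show ?case
  proof
    assume "e = k0 \<and> l < 1"
    then have "e \<in> cco (F \<inter> K i)" using l(6) by simp
    moreover have "cco (F \<inter> K i) \<subseteq> K i" using insert.prems(1)[of i] by (intro cco_minimal) auto
    ultimately show ?thesis by auto
  next
    assume "e = k1 \<and> l > 0"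
    then have "e \<in> cco (F \<inter> (\<Union>i\<in>I. K i))" using l(7) by simp
    then have "\<exists>i\<in>I. e \<in> K i" using insert.prems
      by (intro insert.IH[of "F \<inter> (\<Union>i\<in>I. K i)"]) auto
    then show ?thesis by auto
  qed
qed auto

text \<open>If \<open>e\<close> were outside \<open>F\<close>, finitely many closed convex sets
  avoiding \<open>e\<close> would cover the compact set \<open>F\<close>, contradicting
  \<open>extreme_in_finite_cover\<close>.\<close>

lemma Milman_converse:
  fixes C :: "'a::locally_convex_space set"
  assumes C: "compact C" "convex C" and e: "e extreme_point_of C"
    and F: "closed F" "F \<subseteq> C" "e \<in> cco F"
  shows "e \<in> F"
proof (rule ccontr)
  assume eF: "e \<notin> F"
  have "\<exists>G K. open G \<and> z \<in> G \<and> G \<subseteq> K \<and> closed K \<and> convex K \<and> e \<notin> K" if "z \<in> F" for z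
  proof -
    have "open (- {e})" "z \<in> - {e}" using that eF by auto
    then obtain G K where "open G" "z \<in> G" "G \<subseteq> K" "K \<subseteq> - {e}" "closed K" "convex K"
      by (rule closed_convex_nhd_lcs)
    then show ?thesis by blast
  qed
  then obtain G K where GK: "\<And>z. z \<in> F \<Longrightarrow> open (G z) \<and> z \<in> G z \<and> G z \<subseteq> K z \<and> closed (K z) \<and> convex (K z) \<and> e \<notin> K z"
    by metis
  have "compact F" using compact_Int_closed[OF C(1) F(1)] F(2) by (simp add: inf.absorb2)
  then obtain I where I: "I \<subseteq> F" "finite I" "F \<subseteq> (\<Union>z\<in>I. G z)"
    using compactE_image[of F F G] GK by blast
  have "\<exists>i\<in>I. e \<in> K i"
  proof (rule extreme_in_finite_cover[OF C e I(2) _ F(2) _ F(3)])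
    show "closed (K i) \<and> convex (K i)" if "i \<in> I" for i using GK that I by blast
    show "F \<subseteq> (\<Union>i\<in>I. K i)" using I GK by blast
  qed
  then show False using GK I by blast
qed

section \<open>Openness of the midpoint map and closedness of the extreme boundary\<close>

lemma stable_convex_midpoint_open:
  fixes C :: "'a::{real_vector,topological_space} set"
  assumes "stable_convex C" "open U" "open V" "u \<in> U \<inter> C" "v \<in> V \<inter> C"
  obtains W where "open W" "(1/2) *\<^sub>R (u + v) \<in> W"
    "\<And>y. y \<in> W \<inter> C \<Longrightarrow> \<exists>u'\<in>U \<inter> C. \<exists>v'\<in>V \<inter> C. y = (1/2) *\<^sub>R (u' + v')"
proof -
  let ?m = "\<lambda>(x, y). (1/2) *\<^sub>R (x + y) :: 'a"
  have "openin (top_of_set (C \<times> C)) ((C \<times> C) \<inter> (U \<times> V))"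
    using assms by (intro openin_open_Int open_Times)
  then have "openin (top_of_set C) (?m ` ((C \<times> C) \<inter> (U \<times> V)))"
    using assms(1) unfolding stable_convex_def open_map_def by blast
  then obtain W where W: "open W" "?m ` ((C \<times> C) \<inter> (U \<times> V)) = C \<inter> W"
    by (auto simp: openin_open)
  show thesis
  proof (rule that[OF W(1)])
    have "?m (u, v) \<in> ?m ` ((C \<times> C) \<inter> (U \<times> V))" using assms by blast
    then show "(1/2) *\<^sub>R (u + v) \<in> W" using W(2) by auto
    fix y assume "y \<in> W \<inter> C"
    then have "y \<in> ?m ` ((C \<times> C) \<inter> (U \<times> V))" using W(2) by blast
    then show "\<exists>u'\<in>U \<inter> C. \<exists>v'\<in>V \<inter> C. y = (1/2) *\<^sub>R (u' + v')" by auto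
  qed
qed

lemma extreme_point_midpoint:
  assumes C: "convex C" and x: "x \<in> C" "\<not> x extreme_point_of C"
  obtains u v where "u \<in> C" "v \<in> C" "u \<noteq> v" "x = (1/2) *\<^sub>R (u + v)"
proof -
  from x obtain a b where ab: "a \<in> C" "b \<in> C" "x \<in> open_segment a b"
    by (auto simp: extreme_point_of_def)
  then obtain t where t: "a \<noteq> b" "0 < t" "t < 1" "x = (1 - t) *\<^sub>R a + t *\<^sub>R b" by (auto simp: in_segment)
  \<comment> \<open>The largest step for which \<open>t - s\<close> and \<open>t + s\<close> both
    stay in \<open>[0, 1]\<close>.\<close>
  define s where "s = min t (1 - t)"
  have s: "s > 0" "s \<le> t" "s \<le> 1 - t" using t by (auto simp: s_def)
  have u: "x - s *\<^sub>R (b - a) = (1 - (t - s)) *\<^sub>R a + (t - s) *\<^sub>R b"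
    and v: "x + s *\<^sub>R (b - a) = (1 - (t + s)) *\<^sub>R a + (t + s) *\<^sub>R b"
    unfolding t(4) by (simp_all add: algebra_simps)
  show thesis
  proof (rule that)
    show "x - s *\<^sub>R (b - a) \<in> C" unfolding u using s t ab C by (intro convexD_alt) auto
    show "x + s *\<^sub>R (b - a) \<in> C" unfolding v using s t ab C by (intro convexD_alt) auto
    show "x - s *\<^sub>R (b - a) \<noteq> x + s *\<^sub>R (b - a)"
    proof
      assume "x - s *\<^sub>R (b - a) = x + s *\<^sub>R (b - a)"
      then have "s *\<^sub>R (b - a) + s *\<^sub>R (b - a) = 0" by (metis add_diff_cancel_left' diff_add_cancel diff_diff_eq2 diff_self)
      then have "(s + s) *\<^sub>R (b - a) = 0" unfolding scaleR_add_left .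
      then show False using s t by simp
    qed
    show "x = (1/2) *\<^sub>R ((x - s *\<^sub>R (b - a)) + (x + s *\<^sub>R (b - a)))"
      by (simp flip: scaleR_2)
  qed
qed

text \<open>A point that is not extreme is the midpoint of two distinct points, which have disjoint
  neighbourhoods. By stability all nearby points are midpoints of pairs taken from these
  neighbourhoods, so they are not extreme either.\<close>

lemma stable_convex_closed_Ext:
  fixes C :: "'a::locally_convex_space set"
  assumes C: "compact C" "stable_convex C"
  shows "closed (Ext C)"
proof -
  have cC: "convex C" using C by (simp add: stable_convex_def)
  have "\<exists>T. open T \<and> x \<in> T \<and> T \<subseteq> - Ext C" if "x \<in> - Ext C" for x
  proof (cases "x \<in> C")
    case False
    then show ?thesis using compact_imp_closed[OF C(1)]
      by (intro exI[of _ "- C"]) (auto simp: Ext_def extreme_point_of_def)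
  next
    case True
    then obtain u v where uv: "u \<in> C" "v \<in> C" "u \<noteq> v" "x = (1/2) *\<^sub>R (u + v)"
      using extreme_point_midpoint[OF cC] \<open>x \<in> - Ext C\<close> by (auto simp: Ext_def)
    then obtain U V where UV: "open U" "open V" "u \<in> U" "v \<in> V" "U \<inter> V = {}"
      using hausdorff[of u v] by blast
    obtain W where W: "open W" "x \<in> W"
      "\<And>y. y \<in> W \<inter> C \<Longrightarrow> \<exists>u'\<in>U \<inter> C. \<exists>v'\<in>V \<inter> C. y = (1/2) *\<^sub>R (u' + v')"
      using stable_convex_midpoint_open[OF C(2) UV(1,2), of u v] UV uv by (metis IntI)
    have "y \<notin> Ext C" if y: "y \<in> W \<inter> C" for y
    proof -
      obtain u' v' where *: "u' \<in> U \<inter> C" "v' \<in> V \<inter> C" "y = (1/2) *\<^sub>R (u' + v')" using W(3)[OF y] by blast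
      then have "u' \<noteq> v'" using UV by auto
      then have "y \<in> open_segment u' v'" unfolding in_segment using *
        by (intro conjI exI[of _ "1/2"]) (auto simp: algebra_simps)
      then show ?thesis using * by (auto simp: Ext_def extreme_point_of_def)
    qed
    then show ?thesis using W by (intro exI[of _ W]) (auto simp: Ext_def extreme_point_of_def)
  qed
  then have "open (- Ext C)" by (subst open_subopen) blast
  then show ?thesis by (simp add: closed_def)
qed

section \<open>Measures on compact sets embedded in Polish spaces\<close>

text \<open>Compactness makes the inverse of \<open>\<theta>\<close> continuous on the image, so
  measurability can be tested after \<open>\<theta>\<close>. This reaches all Borel sets of
  \<open>S\<close> even when the ambient topology is not second countable.\<close>

lemma measurable_into_embedded:
  fixes \<theta> :: "'a::topological_space \<Rightarrow> 'b::t2_space"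
  assumes S: "compact S" "continuous_on S \<theta>" "inj_on \<theta> S"
    and g: "\<And>t. t \<in> space M \<Longrightarrow> g t \<in> S" "(\<lambda>t. \<theta> (g t)) \<in> borel_measurable M"
  shows "g \<in> measurable M (restrict_space borel S)"
proof -
  obtain \<psi> where \<psi>: "homeomorphism S (\<theta> ` S) \<theta> \<psi>"
    using homeomorphism_compact[OF S(1,2) refl S(3)] by blast
  have "(\<lambda>t. \<theta> (g t)) \<in> measurable M (restrict_space borel (\<theta> ` S))"
    using g by (intro measurable_restrict_space2) auto
  moreover have "\<psi> \<in> borel_measurable (restrict_space borel (\<theta> ` S))"
    using \<psi> by (intro borel_measurable_continuous_on_restrict) (simp add: homeomorphism_def)
  ultimately have "(\<lambda>t. \<psi> (\<theta> (g t))) \<in> borel_measurable M"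
    by (rule measurable_compose)
  moreover have "\<psi> (\<theta> (g t)) = g t" if "t \<in> space M" for t
    using \<psi> g(1)[OF that] by (simp add: homeomorphism_def)
  ultimately have "g \<in> borel_measurable M" by (simp cong: measurable_cong)
  then show ?thesis using g(1) by (intro measurable_restrict_space2) auto
qed

text \<open>The image measure lives on a Polish space, where finite Borel measures are inner
  regular; the approximating compact sets are carried back by the continuous inverse of
  \<open>\<theta>\<close>.\<close>

lemma radon_prob_embedded:
  fixes \<theta> :: "'a::t2_space \<Rightarrow> 'b::{second_countable_topology, complete_space}"
  assumes S: "compact S" "continuous_on S \<theta>" "inj_on \<theta> S"
    and M: "prob_space M" "sets M = sets (restrict_space borel S)"
  shows "M \<in> radon_prob S"
proof -
  interpret prob_space M by (rule M)
  obtain \<psi> where \<psi>: "homeomorphism S (\<theta> ` S) \<theta> \<psi>"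
    using homeomorphism_compact[OF S(1,2) refl S(3)] by blast
  have spM: "space M = S" using sets_eq_imp_space_eq[OF M(2)] by (simp add: space_restrict_space)
  have \<theta>M: "\<theta> \<in> borel_measurable M"
    using borel_measurable_continuous_on_restrict[OF S(2)] by (simp add: measurable_cong_sets[OF M(2) refl])
  have closed: "closed (\<theta> ` S)" by (intro compact_imp_closed compact_continuous_image S)
  let ?N = "distr M borel \<theta>"
  have "emeasure M A = (SUP K\<in>{K. compact K \<and> K \<subseteq> A}. emeasure M K)" if A: "A \<in> sets M" for A
  proof (rule antisym)
    have AS: "A \<subseteq> S" using sets.sets_into_space[OF A] spM by simp
    have "\<psi> \<in> measurable (restrict_space borel (\<theta> ` S)) (restrict_space borel S)"
      using \<psi> borel_measurable_continuous_on_restrict[of "\<theta> ` S" \<psi>]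
      by (intro measurable_restrict_space2) (auto simp: homeomorphism_def space_restrict_space)
    then have "\<psi> -` A \<inter> space (restrict_space borel (\<theta> ` S)) \<in> sets (restrict_space borel (\<theta> ` S))"
      using A M(2) by (intro measurable_sets) auto
    moreover have "\<psi> -` A \<inter> space (restrict_space borel (\<theta> ` S)) = \<theta> ` A"
    proof -
      have "\<psi> (\<theta> s) = s" if "s \<in> S" for s using \<psi> that by (simp add: homeomorphism_def)
      then show ?thesis using AS by (auto simp: space_restrict_space subset_eq)
    qed
    ultimately have B: "\<theta> ` A \<in> sets borel"
      using closed by (simp add: sets_restrict_space_iff borel_closed)
    have N: "emeasure ?N (\<theta> ` B) = emeasure M B" if "B \<subseteq> S" "\<theta> ` B \<in> sets borel" for B
    proof -
      have "\<theta> -` (\<theta> ` B) \<inter> space M = B" using that S(3) unfolding spM inj_on_def by blast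
      then show ?thesis using that(2) by (simp add: emeasure_distr[OF \<theta>M])
    qed
    have "emeasure M A = (SUP K\<in>{K. K \<subseteq> \<theta> ` A \<and> compact K}. emeasure ?N K)"
      unfolding N[OF AS B, symmetric] using B prob_space.emeasure_space_1[OF prob_space_distr[OF \<theta>M]]
      by (intro inner_regular) auto
    also have "\<dots> \<le> (SUP K\<in>{K. compact K \<and> K \<subseteq> A}. emeasure M K)"
    proof (rule SUP_least)
      fix K assume K: "K \<in> {K. K \<subseteq> \<theta> ` A \<and> compact K}"
      have "K \<subseteq> \<theta> ` S" using K image_mono[OF AS, of \<theta>] by blast
      then have comp: "compact (\<psi> ` K)"
        using \<psi> K continuous_on_subset[of "\<theta> ` S" \<psi> K]
        by (intro compact_continuous_image) (auto simp: homeomorphism_def)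
      have inv: "\<psi> (\<theta> s) = s" if "s \<in> A" for s using \<psi> AS that by (auto simp: homeomorphism_def)
      then have sub: "\<psi> ` K \<subseteq> A" using K by auto
      have im: "\<theta> ` \<psi> ` K = K"
      proof -
        have "\<theta> (\<psi> y) = y" if "y \<in> K" for y using that K inv by auto
        then show ?thesis by (simp add: image_image cong: image_cong_simp)
      qed
      have "emeasure ?N K = emeasure M (\<psi> ` K)"
        using N[of "\<psi> ` K"] sub AS K im by (auto simp: compact_imp_closed borel_closed)
      then show "emeasure ?N K \<le> (SUP K\<in>{K. compact K \<and> K \<subseteq> A}. emeasure M K)"
        using comp sub by (intro SUP_upper2[of "\<psi> ` K"]) auto
    qed
    finally show "emeasure M A \<le> (SUP K\<in>{K. compact K \<and> K \<subseteq> A}. emeasure M K)" .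
    show "(SUP K\<in>{K. compact K \<and> K \<subseteq> A}. emeasure M K) \<le> emeasure M A"
      using A by (intro SUP_least emeasure_mono) auto
  qed
  then show ?thesis using M by (auto simp: radon_prob_def)
qed

lemma measurable_continuous_on_compose:
  fixes h :: "'a::topological_space \<Rightarrow> 'b::topological_space"
  assumes "continuous_on S h" "g \<in> measurable M (restrict_space borel S)"
  shows "(\<lambda>t. h (g t)) \<in> borel_measurable M"
  using measurable_compose[OF assms(2) borel_measurable_continuous_on_restrict[OF assms(1)]] .

lemma integrable_continuous_on_compact:
  fixes h :: "'a::topological_space \<Rightarrow> real"
  assumes "compact S" "continuous_on S h" "g \<in> measurable M (restrict_space borel S)" "finite_measure M"
  shows "integrable M (\<lambda>t. h (g t))"
proof -
  interpret finite_measure M by (rule assms)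
  have "bounded (h ` S)" using assms by (intro compact_imp_bounded compact_continuous_image)
  then obtain B where "\<And>s. s \<in> S \<Longrightarrow> \<bar>h s\<bar> \<le> B" by (auto simp: bounded_iff)
  then have "AE t in M. norm (h (g t)) \<le> B"
    using measurable_space[OF assms(3)] by (auto simp: space_restrict_space)
  then show ?thesis
    by (rule integrable_const_bound) (rule measurable_continuous_on_compose[OF assms(2,3)])
qed

text \<open>A finite subcover is enumerated by \<open>nat\<close>, with repetitions, and
  \<open>z\<close> is sent to the centre of the first member that contains it. Taking the first one
  makes the finitely many pieces measurable.\<close>

lemma compact_simple_selector:
  fixes S :: "'a::topological_space set"
  assumes S: "compact S" and U: "\<And>s. s \<in> S \<Longrightarrow> open (U s) \<and> s \<in> U s"
  obtains r where "simple_function (restrict_space borel S) r" "\<And>z. z \<in> S \<Longrightarrow> r z \<in> S \<and> z \<in> U (r z)"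
proof (cases "S = {}")
  case True
  then show thesis
    using that[of "\<lambda>z. undefined"] by (auto simp: simple_function_def space_restrict_space)
next
  case False
  obtain I where I: "I \<subseteq> S" "finite I" "S \<subseteq> (\<Union>s\<in>I. U s)"
    using compactE_image[OF S, of S U] U by blast
  then have "I \<noteq> {}" using False by auto
  obtain e :: "nat \<Rightarrow> 'a" where e: "range e = I"
    using \<open>I \<noteq> {}\<close> countable_finite[OF I(2)] range_from_nat_into by metis
  have eS: "e i \<in> S" for i using rangeI[of e i] e I(1) by auto
  define k where "k z = (LEAST i. z \<in> U (e i))" for z
  have ko: "z \<in> U (e (k z))" if z: "z \<in> S" for z
  proof -
    obtain s where "s \<in> I" "z \<in> U s" using z I(3) by blast
    then have "\<exists>i. z \<in> U (e i)" unfolding e[symmetric] by blast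
    then show ?thesis unfolding k_def by (rule LeastI_ex)
  qed
  have km: "k \<in> measurable (restrict_space borel S) (count_space UNIV)"
    unfolding k_def
  proof (rule measurable_Least)
    fix i
    have "open (U (e i))" using U[OF eS] by blast
    then show "(\<lambda>z. z \<in> U (e i)) \<in> measurable (restrict_space borel S) (count_space UNIV)"
      by (intro measurable_restrict_space1) (simp add: pred_def borel_open)
  qed
  have "(\<lambda>z. e (k z)) \<in> measurable (restrict_space borel S) (count_space UNIV)"
    using km by (rule measurable_compose) simp
  moreover have "finite ((\<lambda>z. e (k z)) ` space (restrict_space borel S))"
    by (rule finite_subset[OF _ I(2)]) (use e in auto)
  ultimately have "simple_function (restrict_space borel S) (\<lambda>z. e (k z))"
    unfolding simple_function_def by (auto intro: measurable_sets[of _ _ "count_space UNIV"])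
  then show thesis using ko eS by (intro that[of "\<lambda>z. e (k z)"]) auto
qed

lemma simple_function_measurable_compose:
  assumes r: "simple_function N r" and g: "g \<in> measurable M N"
  shows "simple_function M (\<lambda>t. r (g t))"
  unfolding simple_function_def
proof
  show "finite ((\<lambda>t. r (g t)) ` space M)"
    using r measurable_space[OF g] by (auto simp: simple_function_def intro!: finite_subset[of _ "r ` space N"])
  show "\<forall>v\<in>(\<lambda>t. r (g t)) ` space M. (\<lambda>t. r (g t)) -` {v} \<inter> space M \<in> sets M"
  proof
    fix v assume "v \<in> (\<lambda>t. r (g t)) ` space M"
    then have "v \<in> r ` space N" using measurable_space[OF g] by auto
    then have "r -` {v} \<inter> space N \<in> sets N" using r by (auto simp: simple_function_def)
    then have "g -` (r -` {v} \<inter> space N) \<inter> space M \<in> sets M" by (rule measurable_sets[OF g])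
    moreover have "g -` (r -` {v} \<inter> space N) \<inter> space M = (\<lambda>t. r (g t)) -` {v} \<inter> space M"
      using measurable_space[OF g] by auto
    ultimately show "(\<lambda>t. r (g t)) -` {v} \<inter> space M \<in> sets M" by simp
  qed
qed

lemma (in prob_space) simple_function_barycentre:
  fixes g :: "'a \<Rightarrow> 'b::real_vector"
  assumes g: "simple_function M g"
  shows "(\<Sum>v\<in>g ` space M. prob (g -` {v} \<inter> space M)) = 1"
    and "(\<integral>t. h (g t) \<partial>M) = (\<Sum>v\<in>g ` space M. prob (g -` {v} \<inter> space M) * (h v :: real))"
proof -
  have fin: "finite (g ` space M)" and meas: "\<And>v. v \<in> g ` space M \<Longrightarrow> g -` {v} \<inter> space M \<in> sets M"
    using g by (auto simp: simple_function_def)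
  have int: "(\<integral>t. h (g t) \<partial>M) = (\<Sum>v\<in>g ` space M. prob (g -` {v} \<inter> space M) * h v)" for h :: "'b \<Rightarrow> real"
  proof -
    have "(\<integral>t. h (g t) \<partial>M) = (\<integral>t. (\<Sum>v\<in>g ` space M. indicator (g -` {v} \<inter> space M) t * h v) \<partial>M)"
    proof (rule Bochner_Integration.integral_cong[OF refl])
      fix t assume t: "t \<in> space M"
      have "(\<Sum>v\<in>g ` space M. indicator (g -` {v} \<inter> space M) t * h v) =
          (\<Sum>v\<in>g ` space M. if v = g t then h v else 0)"
        using t by (intro sum.cong) (auto simp: indicator_def)
      then show "h (g t) = (\<Sum>v\<in>g ` space M. indicator (g -` {v} \<inter> space M) t * h v)"
        using fin t by simp
    qed
    also have "\<dots> = (\<Sum>v\<in>g ` space M. \<integral>t. indicator (g -` {v} \<inter> space M) t * h v \<partial>M)"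
      by (intro Bochner_Integration.integral_sum integrable_mult_left) (use meas in \<open>auto simp: less_top[symmetric]\<close>)
    also have "\<dots> = (\<Sum>v\<in>g ` space M. prob (g -` {v} \<inter> space M) * h v)"
      using meas by (intro sum.cong) auto
    finally show ?thesis .
  qed
  show "(\<integral>t. h (g t) \<partial>M) = (\<Sum>v\<in>g ` space M. prob (g -` {v} \<inter> space M) * h v)" by (rule int)
  show "(\<Sum>v\<in>g ` space M. prob (g -` {v} \<inter> space M)) = 1"
    using int[of "\<lambda>_. 1"] by (simp add: prob_space)
qed

text \<open>The barycentre is a finite convex combination of the values. An affine function on
  \<open>C\<close> need not extend linearly, so its mean is found from Jensen's inequality for
  \<open>a\<close> and for \<open>- a\<close>.\<close>

lemma (in prob_space) simple_barycentre_exists: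
  fixes g :: "'a \<Rightarrow> 'b::real_vector"
  assumes g: "simple_function M g" and C: "convex C" "g ` space M \<subseteq> C"
  shows "\<exists>b\<in>C. (\<forall>f. linear f \<longrightarrow> (\<integral>t. f (g t) \<partial>M) = (f b :: real)) \<and>
    (\<forall>a. affine_on C a \<longrightarrow> (\<integral>t. a (g t) \<partial>M) = a b)"
proof -
  let ?P = "\<lambda>v. prob (g -` {v} \<inter> space M)"
  let ?b = "\<Sum>v\<in>g ` space M. ?P v *\<^sub>R v"
  have fin: "finite (g ` space M)" using g by (auto simp: simple_function_def)
  have ne: "g ` space M \<noteq> {}" using not_empty by auto
  note sum1 = simple_function_barycentre(1)[OF g] and int = simple_function_barycentre(2)[OF g]
  show ?thesis
  proof (intro bexI conjI allI impI)
    show "?b \<in> C" using C fin sum1 by (intro convex_sum) auto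
    show "(\<integral>t. f (g t) \<partial>M) = f ?b" if "linear f" for f :: "'b \<Rightarrow> real"
      unfolding int by (simp add: linear_sum[OF that] linear_cmul[OF that])
    show "(\<integral>t. a (g t) \<partial>M) = a ?b" if a: "affine_on C a" for a
    proof (rule antisym)
      have "convex_on C a" using a C(1) unfolding affine_on_def
        by (intro convex_onI) auto
      then show "a ?b \<le> (\<integral>t. a (g t) \<partial>M)" unfolding int
        using C fin sum1 ne by (intro convex_on_sum[where C = C]) auto
      have "convex_on C (\<lambda>x. - a x)" using a C(1) unfolding affine_on_def
        by (intro convex_onI) auto
      then have "- a ?b \<le> (\<Sum>v\<in>g ` space M. ?P v * (- a v))"
        using C fin sum1 ne by (intro convex_on_sum[where C = C]) auto
      then show "(\<integral>t. a (g t) \<partial>M) \<le> a ?b" unfolding int by (simp add: sum_negf)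
    qed
  qed
qed

section \<open>Barycentres of continuous affine functions\<close>

text \<open>On a compact set the weak topology is the given one, expressed here for one function at
  one point: the points where \<open>a\<close> moves by at least \<open>e\<close> form a compact set
  that does not contain \<open>x\<close>, and finitely many functionals detect all of them.\<close>

lemma compact_weak_nhd:
  fixes C :: "'a::locally_convex_space set"
  assumes C: "compact C" "x \<in> C" and a: "continuous_on C a" and e: "(e::real) > 0"
  obtains F \<delta> where "finite F" "F \<subseteq> dual_space" "\<delta> > 0"
    "\<And>y. y \<in> C \<Longrightarrow> (\<And>f. f \<in> F \<Longrightarrow> \<bar>f y - f x\<bar> \<le> \<delta>) \<Longrightarrow> \<bar>a y - a x\<bar> < e"
proof -
  have "closedin (top_of_set C) (C \<inter> (\<lambda>y. \<bar>a y - a x\<bar>) -` {e..})"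
    by (intro continuous_closedin_preimage continuous_intros a)
  then have comp: "compact (C \<inter> (\<lambda>y. \<bar>a y - a x\<bar>) -` {e..})" (is "compact ?K")
    using C(1) closedin_compact by blast
  let ?I = "dual_space \<times> {0<..} :: (('a \<Rightarrow> real) \<times> real) set"
  let ?V = "\<lambda>(f, \<delta>). {y. \<bar>f y - f x\<bar> > \<delta>} :: 'a set"
  obtain J where J: "J \<subseteq> ?I" "finite J" "?K \<subseteq> \<Union>(?V ` J)"
  proof (rule compactE_image[OF comp, of ?I ?V])
    show "open (?V i)" if "i \<in> ?I" for i
      using that by (cases i) (auto intro!: open_Collect_less continuous_intros intro: dual_space_continuous_on)
    show "?K \<subseteq> \<Union>(?V ` ?I)"
    proof
      fix y assume "y \<in> ?K"
      then have "y \<noteq> x" using e by auto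
      then obtain f where f: "f \<in> dual_space" "f y \<noteq> f x" using dual_space_separates_points by blast
      then have "(f, \<bar>f y - f x\<bar> / 2) \<in> ?I" "y \<in> ?V (f, \<bar>f y - f x\<bar> / 2)" by auto
      then show "y \<in> \<Union>(?V ` ?I)" by blast
    qed
  qed blast
  \<comment> \<open>The value 1 is inserted in case \<open>J\<close> is empty.\<close>
  define \<delta> where "\<delta> = Min (insert 1 (snd ` J))"
  have fin: "finite (insert 1 (snd ` J))" using J by simp
  have "\<delta> > 0" unfolding \<delta>_def using fin J by (subst Min_gr_iff) auto
  moreover have le: "\<delta> \<le> snd i" if "i \<in> J" for i unfolding \<delta>_def using fin that by (intro Min_le) auto
  moreover have "\<bar>a y - a x\<bar> < e"
    if y: "y \<in> C" and F: "\<And>f. f \<in> fst ` J \<Longrightarrow> \<bar>f y - f x\<bar> \<le> \<delta>" for y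
  proof (rule ccontr)
    assume "\<not> \<bar>a y - a x\<bar> < e"
    then have "y \<in> ?K" using y by auto
    then obtain i where i: "i \<in> J" "y \<in> ?V i" using J(3) by blast
    then show False using F[of "fst i"] le[of i] by (auto simp: split_def)
  qed
  ultimately show thesis using J by (intro that[of "fst ` J" \<delta>]) auto
qed

text \<open>Barycentres are tested only against \<open>dual_space\<close>, while a continuous affine
  function on \<open>C\<close> need not come from a functional. So \<open>g\<close> is replaced by a
  finitely valued variable close to it for \<open>a\<close> and for finitely many functionals. The
  barycentre \<open>b\<close> of that variable is then weakly close to \<open>x\<close>, and
  \<open>compact_weak_nhd\<close> makes \<open>a b\<close> close to \<open>a x\<close>.\<close>

lemma affine_barycentre:
  fixes C :: "'a::locally_convex_space set"
  assumes C: "compact C" "convex C" "x \<in> C" and E: "compact E" "E \<subseteq> C"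
    and M: "prob_space M" "g \<in> measurable M (restrict_space borel E)"
    and bary: "\<And>f. f \<in> dual_space \<Longrightarrow> (\<integral>t. f (g t) \<partial>M) = f x"
    and a: "continuous_on C a" "affine_on C a"
  shows "(\<integral>t. a (g t) \<partial>M) = a x"
proof -
  interpret prob_space M by (rule M)
  have gE: "g t \<in> E" if "t \<in> space M" for t
    using measurable_space[OF M(2) that] by (simp add: space_restrict_space)
  have aE: "continuous_on E a" using a(1) E(2) continuous_on_subset by blast
  have int: "integrable M (\<lambda>t. h (g t))" if "continuous_on E h" for h :: "'a \<Rightarrow> real"
    by (rule integrable_continuous_on_compact[OF E(1) that M(2)]) unfold_locales
  have "\<bar>(\<integral>t. a (g t) \<partial>M) - a x\<bar> \<le> e" if e: "e > 0" for e
  proof -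
    obtain F \<delta> where F: "finite F" "F \<subseteq> dual_space" "\<delta> > 0"
      "\<And>y. y \<in> C \<Longrightarrow> (\<And>f. f \<in> F \<Longrightarrow> \<bar>f y - f x\<bar> \<le> \<delta>) \<Longrightarrow> \<bar>a y - a x\<bar> < e/2"
      using compact_weak_nhd[OF C(1,3) a(1), of "e/2"] e by auto
    have "\<exists>U. open U \<and> s \<in> U \<and> (\<forall>z\<in>E \<inter> U. \<bar>a z - a s\<bar> < e/2 \<and> (\<forall>f\<in>F. \<bar>f z - f s\<bar> < \<delta>))" if s: "s \<in> E" for s
    proof -
      have "open {z. \<bar>f z - f s\<bar> < \<delta>}" if "f \<in> F" for f
        using that F(2) by (intro open_Collect_less continuous_intros dual_space_continuous_on) auto
      then have o1: "open (\<Inter>f\<in>F. {z. \<bar>f z - f s\<bar> < \<delta>})" using F(1) by (intro open_INT) auto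
      obtain T where T: "open T" "s \<in> T" "\<forall>z\<in>E. z \<in> T \<longrightarrow> a z \<in> ball (a s) (e/2)"
        using aE[unfolded continuous_on_topological, rule_format, of s "ball (a s) (e/2)"] s e by auto
      show ?thesis using o1 T F(3)
        by (intro exI[of _ "T \<inter> (\<Inter>f\<in>F. {z. \<bar>f z - f s\<bar> < \<delta>})"]) (auto simp: dist_real_def abs_minus_commute)
    qed
    then obtain U where U: "\<And>s. s \<in> E \<Longrightarrow> open (U s) \<and> s \<in> U s \<and>
        (\<forall>z\<in>E \<inter> U s. \<bar>a z - a s\<bar> < e/2 \<and> (\<forall>f\<in>F. \<bar>f z - f s\<bar> < \<delta>))" by metis
    obtain r where r: "simple_function (restrict_space borel E) r" "\<And>z. z \<in> E \<Longrightarrow> r z \<in> E \<and> z \<in> U (r z)"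
      using compact_simple_selector[OF E(1), of U] U by metis
    have rs: "simple_function M (\<lambda>t. r (g t))" by (rule simple_function_measurable_compose[OF r(1) M(2)])
    have rE: "r (g t) \<in> E" "g t \<in> E \<inter> U (r (g t))" if "t \<in> space M" for t using r(2) gE[OF that] by auto
    have rC: "(\<lambda>t. r (g t)) ` space M \<subseteq> C" using rE(1) E(2) by blast
    from simple_barycentre_exists[OF rs C(2) rC] obtain b where b: "b \<in> C"
      "\<forall>f. linear f \<longrightarrow> (\<integral>t. f (r (g t)) \<partial>M) = (f b :: real)"
      "\<forall>a. affine_on C a \<longrightarrow> (\<integral>t. a (r (g t)) \<partial>M) = a b"
      by blast
    have close: "\<bar>(\<integral>t. h (r (g t)) \<partial>M) - (\<integral>t. h (g t) \<partial>M)\<bar> \<le> c"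
      if h: "continuous_on E h" and c: "\<And>t. t \<in> space M \<Longrightarrow> \<bar>h (r (g t)) - h (g t)\<bar> \<le> c" for h :: "'a \<Rightarrow> real" and c
    proof -
      have "simple_function M (\<lambda>t. h (r (g t)))" using rs by (rule simple_function_compose1)
      then have i1: "integrable M (\<lambda>t. h (r (g t)))"
        by (intro integrable_simple_function) (auto simp: emeasure_eq_measure)
      have "\<bar>(\<integral>t. h (r (g t)) \<partial>M) - (\<integral>t. h (g t) \<partial>M)\<bar> = \<bar>\<integral>t. h (r (g t)) - h (g t) \<partial>M\<bar>"
        by (simp add: Bochner_Integration.integral_diff[OF i1 int[OF h]])
      also have "\<dots> \<le> (\<integral>t. \<bar>h (r (g t)) - h (g t)\<bar> \<partial>M)" by (rule integral_abs_bound)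
      also have "\<dots> \<le> (\<integral>t. c \<partial>M)"
        using c by (intro integral_mono integrable_abs Bochner_Integration.integrable_diff i1 int[OF h]) auto
      finally show ?thesis by (simp add: prob_space)
    qed
    have "\<bar>a b - a x\<bar> < e/2"
    proof (rule F(4)[OF b(1)])
      fix f assume f: "f \<in> F"
      then have fd: "f \<in> dual_space" using F by auto
      have "\<bar>(\<integral>t. f (r (g t)) \<partial>M) - (\<integral>t. f (g t) \<partial>M)\<bar> \<le> \<delta>"
        using U rE f by (intro close dual_space_continuous_on[OF fd]) (metis abs_minus_commute less_imp_le)
      then show "\<bar>f b - f x\<bar> \<le> \<delta>" using b(2)[rule_format, OF dual_space_linear[OF fd]] bary[OF fd] by simp
    qed
    moreover have "\<bar>(\<integral>t. a (r (g t)) \<partial>M) - (\<integral>t. a (g t) \<partial>M)\<bar> \<le> e/2"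
      using U rE by (intro close aE) (metis abs_minus_commute less_imp_le)
    ultimately show ?thesis using b(3)[rule_format, OF a(2)] by linarith
  qed
  then have "\<bar>(\<integral>t. a (g t) \<partial>M) - a x\<bar> \<le> 0" by (rule dense_ge)
  then show ?thesis by simp
qed

section \<open>Representing measures\<close>

text \<open>A point of the closed convex hull of \<open>F\<close> is split repeatedly along closed covers \<open>A n\<close>, \<open>B n\<close>.
  A state \<open>(a, b, k, F)\<close> assigns the parameter interval \<open>[a, b)\<close> to the point \<open>k\<close> of the closed convex
  hull of \<open>F\<close>; splitting the state cuts the interval in the proportion of the barycentric weights.\<close>

type_synonym 'a state = "real \<times> real \<times> 'a \<times> 'a set"

locale split_tree =
  fixes C E :: "'a::locally_convex_space set" and A B :: "nat \<Rightarrow> 'a set"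
  assumes C: "compact C" "convex C" and EC: "E \<subseteq> C" and E: "compact E"
    and AB: "E \<subseteq> A n \<union> B n" "closed (A n)" "closed (B n)"
begin

definition splits :: "nat \<Rightarrow> 'a \<Rightarrow> 'a set \<Rightarrow> real \<times> 'a \<times> 'a \<Rightarrow> bool" where
  "splits n k F = (\<lambda>(l, k0, k1). 0 \<le> l \<and> l \<le> 1 \<and> k = (1 - l) *\<^sub>R k0 + l *\<^sub>R k1 \<and>
    (l < 1 \<longrightarrow> k0 \<in> cco (F \<inter> A n)) \<and> (l > 0 \<longrightarrow> k1 \<in> cco (F \<inter> B n)))"

definition split :: "nat \<Rightarrow> 'a \<Rightarrow> 'a set \<Rightarrow> real \<times> 'a \<times> 'a" where
  "split n k F = (SOME u. splits n k F u)"

definition cut :: "nat \<Rightarrow> 'a state \<Rightarrow> real" where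
  "cut n = (\<lambda>(a, b, k, F). a + (1 - fst (split n k F)) * (b - a))"

definition weight :: "nat \<Rightarrow> 'a state \<Rightarrow> real" where
  "weight n = (\<lambda>(a, b, k, F). fst (split n k F))"

definition lower :: "nat \<Rightarrow> 'a state \<Rightarrow> 'a state" where
  "lower n = (\<lambda>(a, b, k, F). (a, cut n (a, b, k, F), fst (snd (split n k F)), F \<inter> A n))"

definition upper :: "nat \<Rightarrow> 'a state \<Rightarrow> 'a state" where
  "upper n = (\<lambda>(a, b, k, F). (cut n (a, b, k, F), b, snd (snd (split n k F)), F \<inter> B n))"

definition step :: "real \<Rightarrow> nat \<Rightarrow> 'a state \<Rightarrow> 'a state" where
  "step t n s = (if t < cut n s then lower n s else upper n s)"

primrec path :: "nat \<Rightarrow> nat \<Rightarrow> 'a state \<Rightarrow> real \<Rightarrow> 'a state" where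
  "path 0 n s t = s"
| "path (Suc m) n s t = path m (Suc n) (step t n s) t"

definition good :: "'a state \<Rightarrow> bool" where
  "good = (\<lambda>(a, b, k, F). a \<le> b \<and> k \<in> cco F \<and> F \<subseteq> E \<and> closed F)"

definition pt :: "'a state \<Rightarrow> 'a" where "pt = (\<lambda>(a, b, k, F). k)"
definition st :: "'a state \<Rightarrow> 'a set" where "st = (\<lambda>(a, b, k, F). F)"
definition dom :: "'a state \<Rightarrow> real set" where "dom = (\<lambda>(a, b, k, F). {a..<b})"
definition len :: "'a state \<Rightarrow> real" where "len = (\<lambda>(a, b, k, F). b - a)"

text \<open>The recursion removes the first step, which suits inductions over the two subtrees; this
  form removes the last one and shows how a path is extended by a level.\<close>

lemma path_Suc: "path (Suc m) n s t = step t (n + m) (path m n s t)"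
  by (induction m arbitrary: n s) auto

lemma splits_split:
  assumes "k \<in> cco F" "F \<subseteq> E" shows "splits n k F (split n k F)"
proof -
  have "F \<subseteq> C" "F \<subseteq> A n \<union> B n" using assms EC AB(1)[of n] by auto
  from cco_split[OF C this assms(1)] obtain l k0 k1 where "splits n k F (l, k0, k1)"
    unfolding splits_def by auto
  then show ?thesis unfolding split_def by (rule someI)
qed

text \<open>A child of weight 0 may fail to be \<open>good\<close>, but its interval is empty and no
  parameter ever reaches it; this is why goodness is guarded by \<open>l < 1\<close> and
  \<open>l > 0\<close>.\<close>

lemma good_cases:
  fixes s and n :: nat
  assumes "good s"
  defines "l \<equiv> weight n s"
  shows "0 \<le> l" "l \<le> 1" "pt s = (1 - l) *\<^sub>R pt (lower n s) + l *\<^sub>R pt (upper n s)"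
    "len (lower n s) = (1 - l) * len s" "len (upper n s) = l * len s"
    "l < 1 \<Longrightarrow> good (lower n s)" "l > 0 \<Longrightarrow> good (upper n s)"
    "dom (lower n s) = dom s \<inter> {..<cut n s}" "dom (upper n s) = dom s \<inter> {cut n s..}"
    "l = 1 \<Longrightarrow> dom (lower n s) = {}" "l = 0 \<Longrightarrow> dom (upper n s) = {}"
proof -
  obtain a b k F where s: "s = (a, b, k, F)" by (cases s)
  have g: "a \<le> b" "k \<in> cco F" "F \<subseteq> E" "closed F" using assms by (auto simp: good_def s)
  obtain k0 k1 where sp: "split n k F = (l, k0, k1)"
    unfolding l_def weight_def s by (cases "split n k F") auto
  show l: "0 \<le> l" "l \<le> 1"
    using splits_split[OF g(2,3), of n] by (auto simp: splits_def sp)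
  have k: "k = (1 - l) *\<^sub>R k0 + l *\<^sub>R k1"
    "l < 1 \<Longrightarrow> k0 \<in> cco (F \<inter> A n)" "l > 0 \<Longrightarrow> k1 \<in> cco (F \<inter> B n)"
    using splits_split[OF g(2,3), of n] by (auto simp: splits_def sp)
  have c: "cut n s = a + (1 - l) * (b - a)" by (simp add: cut_def s sp)
  have "0 \<le> (1 - l) * (b - a)" "0 \<le> l * (b - a)" using l g by auto
  then have ac: "a \<le> cut n s" "cut n s \<le> b" unfolding c by (auto simp: algebra_simps)
  have lo: "lower n s = (a, cut n s, k0, F \<inter> A n)" by (simp add: lower_def s sp)
  have up: "upper n s = (cut n s, b, k1, F \<inter> B n)" by (simp add: upper_def s sp)
  show "dom (lower n s) = dom s \<inter> {..<cut n s}" "dom (upper n s) = dom s \<inter> {cut n s..}"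
    using ac unfolding lo up by (auto simp: dom_def s)
  show "l < 1 \<Longrightarrow> good (lower n s)" "l > 0 \<Longrightarrow> good (upper n s)"
    using k g ac AB unfolding lo up by (auto simp: good_def)
  show "l = 1 \<Longrightarrow> dom (lower n s) = {}" "l = 0 \<Longrightarrow> dom (upper n s) = {}"
    unfolding lo up dom_def c by auto
  show "pt s = (1 - l) *\<^sub>R pt (lower n s) + l *\<^sub>R pt (upper n s)"
    using k unfolding lo up by (simp add: pt_def s)
  show "len (lower n s) = (1 - l) * len s" "len (upper n s) = l * len s"
    unfolding lo up len_def c by (simp_all add: s algebra_simps)
qed

lemma good_step:
  assumes "good s" "t \<in> dom s"
  shows "good (step t n s)" "t \<in> dom (step t n s)" "st (step t n s) = st s \<inter> (if t < cut n s then A n else B n)"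
proof -
  note l = good_cases[OF assms(1), of n]
  let ?l = "weight n s"
  show dom: "t \<in> dom (step t n s)" using l(8,9) assms(2) by (auto simp: step_def)
  then have "(if t < cut n s then ?l < 1 else ?l > 0)"
    using l(1,2,10,11) by (auto simp: step_def less_le)
  then show "good (step t n s)" using l(6,7) by (auto simp: step_def split: if_splits)
  show "st (step t n s) = st s \<inter> (if t < cut n s then A n else B n)"
    by (cases s) (auto simp: step_def st_def lower_def upper_def)
qed

lemma good_path:
  assumes "good s" "t \<in> dom s" shows "good (path m n s t) \<and> t \<in> dom (path m n s t)"
  using assms by (induction m arbitrary: n s) (auto simp: good_step)

lemma st_path_Suc:
  assumes "good s" "t \<in> dom s"
  shows "st (path (Suc m) n s t) =
    st (path m n s t) \<inter> (if t < cut (n + m) (path m n s t) then A (n + m) else B (n + m))"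
  using good_step(3)[of "path m n s t" t "n + m"] good_path[OF assms, of m n] by (simp only: path_Suc)

text \<open>The martingale property of the tree: each split preserves the mean of \<open>f\<close>
  weighted by interval length. The induction runs over the two subtrees, and a subtree with empty
  interval contributes 0.\<close>

lemma integral_path:
  assumes f: "linear f" and s: "good s"
  shows "has_bochner_integral lborel (\<lambda>t. indicator (dom s) t * f (pt (path m n s t))) (len s * (f (pt s) :: real))"
  using s
proof (induction m arbitrary: n s)
  case 0
  then obtain a b k F where s: "s = (a, b, k, F)" "a \<le> b" by (cases s) (auto simp: good_def)
  have "has_bochner_integral lborel (\<lambda>t. indicator {a..<b} t * f k) (measure lborel {a..<b} * f k)"
    by (intro has_bochner_integral_mult_left has_bochner_integral_real_indicator) (use s in auto)
  then show ?case using s by (simp add: dom_def len_def pt_def)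
next
  case (Suc m)
  note l = good_cases[OF Suc.prems, of n]
  let ?l = "weight n s"
  have lo: "has_bochner_integral lborel (\<lambda>t. indicator (dom (lower n s)) t * f (pt (path m (Suc n) (lower n s) t)))
      (len (lower n s) * f (pt (lower n s)))"
  proof (cases "?l < 1")
    case True then show ?thesis using l Suc.IH by blast
  next
    case False
    then have "?l = 1" using l by simp
    then show ?thesis using l by (simp add: has_bochner_integral_zero)
  qed
  have up: "has_bochner_integral lborel (\<lambda>t. indicator (dom (upper n s)) t * f (pt (path m (Suc n) (upper n s) t)))
      (len (upper n s) * f (pt (upper n s)))"
  proof (cases "?l > 0")
    case True then show ?thesis using l Suc.IH by blast
  next
    case False
    then have "?l = 0" using l by simp
    then show ?thesis using l by (simp add: has_bochner_integral_zero)
  qed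
  have "indicator (dom s) t * f (pt (path (Suc m) n s t)) =
      indicator (dom (lower n s)) t * f (pt (path m (Suc n) (lower n s) t)) +
      indicator (dom (upper n s)) t * f (pt (path m (Suc n) (upper n s) t))" for t
    unfolding l(8,9) by (auto simp: step_def indicator_def)
  moreover have "len s * f (pt s) = len (lower n s) * f (pt (lower n s)) + len (upper n s) * f (pt (upper n s))"
    unfolding l(3) unfolding l(4,5) linear_add[OF f] linear_cmul[OF f] by (simp add: algebra_simps)
  ultimately show ?case using has_bochner_integral_add[OF lo up] by simp
qed

lemma path_choice_measurable:
  assumes s: "good s"
  shows "{t \<in> dom s. t < cut (n + m) (path m n s t)} \<in> sets borel"
  using s
proof (induction m arbitrary: n s)
  case 0
  have "{t \<in> dom s. t < cut (n + 0) (path 0 n s t)} = dom s \<inter> {..<cut n s}" by auto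
  also have "\<dots> \<in> sets borel" by (cases s) (auto simp: dom_def)
  finally show ?case .
next
  case (Suc m)
  note l = good_cases[OF Suc.prems, of n]
  let ?l = "weight n s"
  let ?S = "\<lambda>s'. {t \<in> dom s'. t < cut (Suc n + m) (path m (Suc n) s' t)}"
  have "?S (lower n s) \<in> sets borel"
  proof (cases "?l < 1")
    case True then show ?thesis using l Suc.IH by blast
  next
    case False
    then have "?l = 1" using l by simp
    then show ?thesis using l by simp
  qed
  moreover have "?S (upper n s) \<in> sets borel"
  proof (cases "?l > 0")
    case True then show ?thesis using l Suc.IH by blast
  next
    case False
    then have "?l = 0" using l by simp
    then show ?thesis using l by simp
  qed
  moreover have "{t \<in> dom s. t < cut (n + Suc m) (path (Suc m) n s t)} = ?S (lower n s) \<union> ?S (upper n s)"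
    unfolding l(8,9) by (auto simp: step_def split: if_splits)
  ultimately show ?case by simp
qed

end

lemma prob_space_unit_interval: "prob_space (restrict_space lborel {0..<1::real})"
  by (intro prob_spaceI) (simp add: emeasure_restrict_space space_restrict_space)

text \<open>The covers are indexed by all pairs of a coordinate of \<open>\<Phi>\<close> and a
  rational threshold. Two distinct points of \<open>E\<close> differ in a coordinate and are
  separated by a threshold, so for each \<open>t\<close> the compact sets \<open>S n t\<close>
  shrink to one point, the value of \<open>\<zeta>\<close>. The points \<open>K n t\<close> lie in
  the hulls of these sets and converge weakly to it, and dominated convergence carries the mean
  \<open>f x\<close> over to the limit.\<close>

theorem representing_variable:
  fixes C E F :: "'a::locally_convex_space set" and \<Phi> :: "'a \<Rightarrow> nat \<Rightarrow> real"
  assumes hC: "compact C" "convex C" and hE: "E \<subseteq> C" "compact E"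
    and \<Phi>: "continuous_on E \<Phi>" "inj_on \<Phi> E" and F: "closed F" "F \<subseteq> E" "x \<in> cco F"
  obtains \<zeta> where "\<zeta> \<in> measurable (restrict_space lborel {0..<1::real}) (restrict_space borel E)"
    "\<And>t. t \<in> {0..<1} \<Longrightarrow> \<zeta> t \<in> F"
    "\<And>f. f \<in> dual_space \<Longrightarrow> (\<integral>t. f (\<zeta> t) \<partial>restrict_space lborel {0..<1}) = f x"
proof -
  define code :: "nat \<Rightarrow> nat \<times> rat" where "code = from_nat"
  have \<Phi>m: "continuous_on E (\<lambda>z. \<Phi> z m)" for m
    using \<Phi>(1) by (rule continuous_on_product_then_coordinatewise)
  define A where "A n = {z \<in> E. \<Phi> z (fst (code n)) \<le> of_rat (snd (code n))}" for n
  define B where "B n = {z \<in> E. of_rat (snd (code n)) \<le> \<Phi> z (fst (code n))}" for n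
  have cE: "closed E" using hE(2) by (rule compact_imp_closed)
  interpret split_tree C E A B
  proof
    fix n
    show "E \<subseteq> A n \<union> B n" by (auto simp: A_def B_def)
    have "A n = E \<inter> (\<lambda>z. \<Phi> z (fst (code n))) -` {..of_rat (snd (code n))}"
      "B n = E \<inter> (\<lambda>z. \<Phi> z (fst (code n))) -` {of_rat (snd (code n))..}" by (auto simp: A_def B_def)
    then show "closed (A n)" "closed (B n)"
      by (simp_all only:) (intro continuous_closed_preimage \<Phi>m cE closed_atMost closed_atLeast)+
  qed (use hC hE in auto)
  define s :: "'a state" where "s = (0, 1, x, F)"
  have s: "good s" "dom s = {0..<1}" "len s = 1" "pt s = x" "st s = F"
    using F by (auto simp: s_def good_def dom_def len_def pt_def st_def)
  define S where "S n t = st (path n 0 s t)" for n t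
  define K where "K n t = pt (path n 0 s t)" for n t
  define Ch where "Ch n t \<longleftrightarrow> t < cut n (path n 0 s t)" for n t
  have S0: "S 0 t = F" for t by (simp add: S_def s)
  have SSuc: "S (Suc n) t = S n t \<inter> (if Ch n t then A n else B n)" if "t \<in> {0..<1}" for n t
    using st_path_Suc[OF s(1), of t n 0] that s(2) by (simp add: S_def Ch_def)
  have dec: "S n t \<subseteq> S m t" if t: "t \<in> {0..<1}" and mn: "m \<le> n" for m n t
    using mn SSuc[OF t] by (induction n rule: dec_induct) auto
  have SK: "K n t \<in> cco (S n t)" "S n t \<subseteq> E" "closed (S n t)" if "t \<in> {0..<1}" for n t
    using good_path[OF s(1), of t n 0] that s(2)
    by (auto simp: good_def K_def S_def st_def pt_def split: prod.splits)
  have Sne: "S n t \<noteq> {}" if "t \<in> {0..<1}" for n t using SK(1)[OF that, of n] by auto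
  have ex: "\<exists>z. \<forall>n. z \<in> S n t" if t: "t \<in> {0..<1}" for t
  proof -
    have "E \<inter> (\<Inter>n\<in>UNIV. S n t) \<noteq> {}"
    proof (rule compact_imp_fip_image[OF hE(2)])
      fix I :: "nat set" assume I: "finite I"
      obtain N where N: "\<And>i. i \<in> I \<Longrightarrow> i \<le> N" using I finite_nat_set_iff_bounded_le[of I] by blast
      have "S N t \<subseteq> E \<inter> (\<Inter>n\<in>I. S n t)" using SK(2)[OF t, of N] dec[OF t] N by blast
      then show "E \<inter> (\<Inter>n\<in>I. S n t) \<noteq> {}" using Sne[OF t, of N] by blast
    qed (rule SK(3)[OF t])
    then show ?thesis by blast
  qed
  define \<zeta> where "\<zeta> t = (SOME z. \<forall>n. z \<in> S n t)" for t
  have \<zeta>S: "\<zeta> t \<in> S n t" if "t \<in> {0..<1}" for n t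
    using someI_ex[OF ex[OF that]] unfolding \<zeta>_def by blast
  have \<zeta>F: "\<zeta> t \<in> F" and \<zeta>E: "\<zeta> t \<in> E" if "t \<in> {0..<1}" for t
    using \<zeta>S[OF that, of 0] F(2) by (auto simp: S0)
  have codes: "\<exists>n. code n = (m, q)" for m q
    unfolding code_def by (rule exI[of _ "to_nat (m, q)"]) simp
  have uniq: "z = w" if t: "t \<in> {0..<1}" and zw: "\<And>n. z \<in> S n t" "\<And>n. w \<in> S n t" for z w t
  proof (rule ccontr)
    assume "z \<noteq> w"
    have *: False if zw: "\<And>n. z \<in> S n t" "\<And>n. w \<in> S n t" and lt: "\<Phi> z m < \<Phi> w m" for z w m
    proof -
      obtain q where q: "\<Phi> z m < of_rat q" "of_rat q < \<Phi> w m" using of_rat_dense[OF lt] by blast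
      obtain n where "code n = (m, q)" using codes by blast
      then show False using zw(1)[of "Suc n"] zw(2)[of "Suc n"] q
        by (auto simp: SSuc[OF t] A_def B_def split: if_splits)
    qed
    have "z \<in> E" "w \<in> E" using zw SK(2)[OF t, of 0] by auto
    then have "\<Phi> z \<noteq> \<Phi> w" using \<Phi>(2) \<open>z \<noteq> w\<close> by (auto simp: inj_on_def)
    then obtain m where "\<Phi> z m \<noteq> \<Phi> w m" by auto
    then show False using *[of z w m] *[of w z m] zw by fastforce
  qed
  have lim: "(\<lambda>n. f (K n t)) \<longlonglongrightarrow> f (\<zeta> t)" if f: "f \<in> dual_space" and t: "t \<in> {0..<1}" for f t
  proof (rule LIMSEQ_I)
    fix e :: real assume e: "e > 0"
    \<comment> \<open>Compactness makes \<open>S n t\<close> miss \<open>?D\<close> from some level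
      on. It then lies in \<open>?V\<close>, which is closed and convex and so contains the hull of
      \<open>S n t\<close> together with \<open>K n t\<close>.\<close>
    let ?D = "{z. e/2 \<le> \<bar>f z - f (\<zeta> t)\<bar>}" and ?V = "{z. \<bar>f z - f (\<zeta> t)\<bar> \<le> e/2}"
    have cD: "closed ?D" "closed ?V"
      by (intro closed_Collect_le continuous_intros dual_space_continuous_on[OF f])+
    have "w \<notin> (\<Inter>n\<in>UNIV. S n t \<inter> ?D)" for w
    proof
      assume w: "w \<in> (\<Inter>n\<in>UNIV. S n t \<inter> ?D)"
      then have "w = \<zeta> t" using \<zeta>S[OF t] by (intro uniq[OF t]) auto
      then show False using w e by auto
    qed
    then have "E \<inter> (\<Inter>n\<in>UNIV. S n t \<inter> ?D) = {}" by blast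
    moreover have "closed (S n t \<inter> ?D)" for n using SK(3)[OF t] cD(1) by (rule closed_Int)
    ultimately obtain I :: "nat set" where I: "finite I" "E \<inter> (\<Inter>n\<in>I. S n t \<inter> ?D) = {}"
      using compact_imp_fip_image[OF hE(2), of UNIV "\<lambda>n. S n t \<inter> ?D"] by (metis subset_UNIV)
    obtain N where N: "\<And>i. i \<in> I \<Longrightarrow> i \<le> N" using I(1) finite_nat_set_iff_bounded_le[of I] by blast
    have convV: "convex ?V"
    proof -
      have "?V = f -` {f (\<zeta> t) - e/2 .. f (\<zeta> t) + e/2}"
        by (rule set_eqI) (simp only: mem_Collect_eq vimage_eq atLeastAtMost_iff abs_diff_le_iff)
      then show ?thesis
        using convex_linear_vimage[OF dual_space_linear[OF f] convex_real_interval(5)] by simp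
    qed
    have "norm (f (K n t) - f (\<zeta> t)) < e" if n: "n \<ge> N" for n
    proof -
      have "S n t \<inter> ?D = {}"
      proof (rule ccontr)
        assume "S n t \<inter> ?D \<noteq> {}"
        then obtain z where z: "z \<in> S n t" "z \<in> ?D" by blast
        have "z \<in> S i t" if "i \<in> I" for i using dec[OF t, of i n] N[OF that] n z by auto
        moreover have "z \<in> E" using z SK(2)[OF t] by blast
        ultimately show False using I(2) z(2) by blast
      qed
      then have "S n t \<subseteq> ?V" by force
      then have "cco (S n t) \<subseteq> ?V" using cD(2) convV by (rule cco_minimal)
      then have "\<bar>f (K n t) - f (\<zeta> t)\<bar> \<le> e/2" using SK(1)[OF t, of n] by blast
      then show ?thesis using e by simp
    qed
    then show "\<exists>N. \<forall>n\<ge>N. norm (f (K n t) - f (\<zeta> t)) < e" by blast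
  qed
  let ?M = "restrict_space lborel {0..<1::real}"
  interpret M: prob_space ?M by (rule prob_space_unit_interval)
  have Chm: "{t \<in> {0..<1}. Ch n t} \<in> sets borel" for n
    using path_choice_measurable[OF s(1), of 0 n] by (simp add: s(2) Ch_def)
  have \<zeta>m: "\<zeta> \<in> measurable ?M (restrict_space borel E)"
  proof (rule measurable_into_embedded[OF hE(2) \<Phi>])
    show "\<zeta> t \<in> E" if "t \<in> space ?M" for t using \<zeta>E that by (simp add: space_restrict_space)
    have "(\<lambda>t. \<Phi> (\<zeta> t) m) \<in> borel_measurable ?M" for m
      unfolding borel_measurable_iff_less
    proof
      fix r :: real
      let ?I = "{n. fst (code n) = m \<and> of_rat (snd (code n)) < r}"
      \<comment> \<open>Taking the lower branch at a threshold below \<open>r\<close> forces the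
        coordinate below \<open>r\<close>. Conversely, a threshold strictly between the coordinate
        and \<open>r\<close> excludes the upper branch.\<close>
      have "{t \<in> space ?M. \<Phi> (\<zeta> t) m < r} = (\<Union>n\<in>?I. {t \<in> {0..<1}. Ch n t})"
      proof (intro antisym subsetI)
        fix t assume "t \<in> {t \<in> space ?M. \<Phi> (\<zeta> t) m < r}"
        then have t: "t \<in> {0..<1}" "\<Phi> (\<zeta> t) m < r" by (auto simp: space_restrict_space)
        obtain q where q: "\<Phi> (\<zeta> t) m < of_rat q" "of_rat q < r" using of_rat_dense[OF t(2)] by blast
        obtain n where n: "code n = (m, q)" using codes by blast
        have "Ch n t" using \<zeta>S[OF t(1), of "Suc n"] q by (auto simp: SSuc[OF t(1)] B_def n split: if_splits)
        then show "t \<in> (\<Union>n\<in>?I. {t \<in> {0..<1}. Ch n t})" using n q t by (intro UN_I[of n]) auto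
      next
        fix t assume "t \<in> (\<Union>n\<in>?I. {t \<in> {0..<1}. Ch n t})"
        then obtain n where n: "fst (code n) = m" "of_rat (snd (code n)) < r" "t \<in> {0..<1}" "Ch n t" by auto
        then have "\<zeta> t \<in> A n" using \<zeta>S[OF n(3), of "Suc n"] by (auto simp: SSuc[OF n(3)])
        then show "t \<in> {t \<in> space ?M. \<Phi> (\<zeta> t) m < r}" using n by (auto simp: A_def space_restrict_space)
      qed
      also have "\<dots> \<in> sets borel" using Chm by (intro sets.countable_UN' image_subsetI) simp_all
      finally show "{t \<in> space ?M. \<Phi> (\<zeta> t) m < r} \<in> sets ?M"
        by (auto simp: sets_restrict_space_iff space_restrict_space)
    qed
    then show "(\<lambda>t. \<Phi> (\<zeta> t)) \<in> borel_measurable ?M"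
      by (rule measurable_coordinatewise_then_product)
  qed
  have "(\<integral>t. f (\<zeta> t) \<partial>?M) = f x" if f: "f \<in> dual_space" for f
  proof -
    have hb: "has_bochner_integral ?M (\<lambda>t. f (K n t)) (f x)" for n
      using integral_path[OF dual_space_linear[OF f] s(1), of n 0]
      by (simp add: s has_bochner_integral_restrict_space K_def)
    have "bounded (f ` C)" using hC(1) by (intro compact_imp_bounded compact_continuous_image dual_space_continuous_on[OF f])
    then obtain Bd where Bd: "\<And>z. z \<in> C \<Longrightarrow> \<bar>f z\<bar> \<le> Bd" by (auto simp: bounded_iff)
    have KC: "K n t \<in> C" if "t \<in> {0..<1}" for n t
    proof -
      have "cco (S n t) \<subseteq> C" using SK(2)[OF that, of n] hE(1) hC by (intro cco_minimal compact_imp_closed) auto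
      then show ?thesis using SK(1)[OF that, of n] by blast
    qed
    have "(\<lambda>n. \<integral>t. f (K n t) \<partial>?M) \<longlonglongrightarrow> (\<integral>t. f (\<zeta> t) \<partial>?M)"
    proof (rule integral_dominated_convergence[where w = "\<lambda>_. Bd"])
      show "(\<lambda>t. f (\<zeta> t)) \<in> borel_measurable ?M"
        using dual_space_continuous_on[OF f] \<zeta>m by (rule measurable_continuous_on_compose)
      show "(\<lambda>t. f (K n t)) \<in> borel_measurable ?M" for n
        using hb by (rule borel_measurable_has_bochner_integral)
      show "AE t in ?M. (\<lambda>n. f (K n t)) \<longlonglongrightarrow> f (\<zeta> t)"
        using lim[OF f] by (intro AE_I2) (auto simp: space_restrict_space)
      show "AE t in ?M. norm (f (K n t)) \<le> Bd" for n
        using Bd KC by (intro AE_I2) (auto simp: space_restrict_space)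
    qed auto
    moreover have "(\<integral>t. f (K n t) \<partial>?M) = f x" for n
      using hb by (rule has_bochner_integral_integral_eq)
    ultimately show ?thesis by (simp add: LIMSEQ_const_iff)
  qed
  then show thesis using \<zeta>m \<zeta>F by (intro that)
qed

section \<open>Couplings and convex roofs\<close>

text \<open>The mixture is a Bernoulli choice between the two measures, so measurability and the
  integral formula come from the monadic bind.\<close>

lemma prob_space_mixture:
  fixes M0 M1 :: "'a measure"
  assumes M: "prob_space M0" "prob_space M1" "sets M0 = sets N" "sets M1 = sets N" and t: "0 \<le> t" "t \<le> 1"
  obtains M where "prob_space M" "sets M = sets N"
    "\<And>h :: 'a \<Rightarrow> real. h \<in> borel_measurable N \<Longrightarrow> (\<exists>B. \<forall>u\<in>space N. \<bar>h u\<bar> \<le> B) \<Longrightarrow>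
      (\<integral>u. h u \<partial>M) = (1 - t) * (\<integral>u. h u \<partial>M0) + t * (\<integral>u. h u \<partial>M1)"
proof -
  let ?P = "measure_pmf (bernoulli_pmf t)" and ?K = "\<lambda>b. if b then M1 else M0"
  have "?K b \<in> space (subprob_algebra N)" for b
    using M prob_space_imp_subprob_space[of M0] prob_space_imp_subprob_space[of M1]
    by (cases b) (simp_all add: space_subprob_algebra)
  then have K: "?K \<in> measurable ?P (subprob_algebra N)"
    unfolding measurable_pmf_measure1 by (rule Pi_I)
  have pK: "prob_space (?K b)" for b using M by auto
  show thesis
  proof (rule that[of "bind ?P ?K"])
    show "prob_space (bind ?P ?K)"
      using pK by (intro prob_space.prob_space_bind[OF _ _ K] measure_pmf.prob_space_axioms) auto
    show "sets (bind ?P ?K) = sets N" using M by (intro sets_bind) auto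
    fix h :: "'a \<Rightarrow> real" assume h: "h \<in> borel_measurable N" "\<exists>B. \<forall>u\<in>space N. \<bar>h u\<bar> \<le> B"
    then obtain B where B: "\<And>u. u \<in> space N \<Longrightarrow> \<bar>h u\<bar> \<le> B" by blast
    have "(\<integral>u. h u \<partial>bind ?P ?K) = (\<integral>b. (\<integral>u. h u \<partial>?K b) \<partial>?P)"
      by (rule integral_bind[OF h(1) _ K, where B' = 1 and B = B])
         (use pK B in \<open>auto simp: prob_space.emeasure_space_1\<close>)
    also have "\<dots> = (1 - t) * (\<integral>u. h u \<partial>M0) + t * (\<integral>u. h u \<partial>M1)"
      using t by (subst integral_measure_pmf_real[of UNIV]) (auto simp: UNIV_bool)
    finally show "(\<integral>u. h u \<partial>bind ?P ?K) = (1 - t) * (\<integral>u. h u \<partial>M0) + t * (\<integral>u. h u \<partial>M1)" .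
  qed
qed

text \<open>Integrates the tangent inequality of \<open>u powr r\<close> at the mean. The tangent is
  justified on the open half-line, so the value \<open>u = 0\<close> and a vanishing mean are
  treated separately.\<close>

lemma (in prob_space) power_mean_le:
  fixes X :: "'a \<Rightarrow> real"
  assumes r: "r \<ge> 1" and X: "\<And>t. t \<in> space M \<Longrightarrow> X t \<ge> 0"
    and int: "integrable M X" "integrable M (\<lambda>t. X t powr r)"
  shows "(\<integral>t. X t \<partial>M) powr r \<le> (\<integral>t. X t powr r \<partial>M)"
proof -
  define m where "m = (\<integral>t. X t \<partial>M)"
  have m0: "m \<ge> 0" unfolding m_def using X by (intro integral_nonneg_AE) auto
  show ?thesis
  proof (cases "m = 0")
    case True
    then show ?thesis unfolding m_def[symmetric] by (auto intro!: integral_nonneg_AE)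
  next
    case False
    then have m: "m > 0" using m0 by simp
    have tangent: "m powr r + r * m powr (r - 1) * (u - m) \<le> u powr r" if u: "u \<ge> 0" for u
    proof (cases "u = 0")
      case True
      have "m powr r = m * m powr (r - 1)" using m powr_mult_base[of m "r - 1"] by simp
      moreover have "1 * m powr r \<le> r * m powr r" using r by (intro mult_right_mono) auto
      ultimately show ?thesis using True r by (simp add: algebra_simps)
    next
      case False
      have "r * m powr (r - 1) * (u - m) \<le> u powr r - m powr r"
      proof (rule convex_on_imp_above_tangent[where A = "{0<..}"])
        show "convex_on {0<..} (\<lambda>x. x powr r)" using r by (rule powr_convex)
        show "connected {0::real<..}" by (rule convex_connected) simp
        show "m \<in> interior {0<..}" "u \<in> {0<..}" using m u False by (auto simp: interior_open)
        show "((\<lambda>x. x powr r) has_field_derivative r * m powr (r - 1)) (at m within {0<..})"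
          using m by (auto intro!: derivative_eq_intros)
      qed
      then show ?thesis by (simp add: algebra_simps)
    qed
    have "m powr r = (\<integral>t. m powr r + r * m powr (r - 1) * (X t - m) \<partial>M)"
      using int by (simp add: m_def prob_space)
    also have "\<dots> \<le> (\<integral>t. X t powr r \<partial>M)"
      using int tangent X by (intro integral_mono) auto
    finally show ?thesis by (simp add: m_def)
  qed
qed

section \<open>The metric on the extreme boundary, and couplings as pairs of variables\<close>

locale stable_roof =
  fixes C :: "'a::locally_convex_space set" and d :: "'a \<Rightarrow> 'a \<Rightarrow> real"
  assumes compact_C: "compact C" and stable_C: "stable_convex C"
    and metric_d: "Metric_space (Ext C) d"
    and continuous_d: "continuous_on (Ext C \<times> Ext C) (\<lambda>(z, w). d z w)"
begin

abbreviation E :: "'a set" where "E \<equiv> Ext C"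

abbreviation R :: "real \<Rightarrow> 'a \<Rightarrow> 'a \<Rightarrow> real" where "R p \<equiv> roof p C d"

interpretation Metric_space E d by (rule metric_d)

lemma convex_C: "convex C" using stable_C by (simp add: stable_convex_def)

lemma Ext_subset: "E \<subseteq> C" by (auto simp: Ext_def extreme_point_of_def)

lemma closed_Ext: "closed E"
  using compact_C stable_C by (rule stable_convex_closed_Ext)

lemma compact_Ext: "compact E"
  using compact_Int_closed[OF compact_C closed_Ext] Ext_subset by (simp add: inf.absorb2)

lemma d_nonneg: "0 \<le> d z w" using nonneg .
lemma d_sym: "d z w = d w z" using commute .
lemma d_refl: "z \<in> E \<Longrightarrow> d z z = 0" using zero by blast

lemma continuous_on_d:
  assumes "continuous_on S f" "continuous_on S g" "f ` S \<subseteq> E" "g ` S \<subseteq> E"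
  shows "continuous_on S (\<lambda>s. d (f s) (g s))"
  using continuous_on_compose2[OF continuous_d continuous_on_Pair[OF assms(1,2)]] assms(3,4) by auto

lemma closed_d_ball: "e \<in> E \<Longrightarrow> closed {z \<in> E. d e z \<le> r}" "e \<in> E \<Longrightarrow> closed {z \<in> E. r \<le> d e z}"
proof -
  assume e: "e \<in> E"
  have c: "continuous_on E (d e)" using e by (intro continuous_on_d continuous_intros) auto
  have "{z \<in> E. d e z \<le> r} = E \<inter> d e -` {..r}" "{z \<in> E. r \<le> d e z} = E \<inter> d e -` {r..}" by auto
  then show "closed {z \<in> E. d e z \<le> r}" "closed {z \<in> E. r \<le> d e z}"
    using continuous_closed_preimage[OF c closed_Ext] by auto
qed

lemma d_nhd:
  assumes e: "e \<in> E" and r: "r > 0"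
  shows "\<exists>U. open U \<and> e \<in> U \<and> (\<forall>z\<in>U \<inter> E. d e z < r)"
proof -
  have "open (- {z \<in> E. r \<le> d e z})" using closed_d_ball(2)[OF e, of r] by (simp add: closed_def)
  then show ?thesis using e r d_refl by (intro exI[of _ "- {z \<in> E. r \<le> d e z}"]) auto
qed

text \<open>Some bound for \<open>d\<close>, not necessarily its diameter, and positive so that one
  can divide by it even if \<open>Ext C\<close> has a single point.\<close>

definition \<Delta> :: real where "\<Delta> = (SOME B. B > 0 \<and> (\<forall>z\<in>E. \<forall>w\<in>E. d z w \<le> B))"

lemma \<Delta>: "\<Delta> > 0" "z \<in> E \<Longrightarrow> w \<in> E \<Longrightarrow> d z w \<le> \<Delta>"
proof -
  have "bounded ((\<lambda>(z, w). d z w) ` (E \<times> E))"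
    by (intro compact_imp_bounded compact_continuous_image compact_Times compact_Ext continuous_d)
  then obtain B where "B > 0" "\<forall>s\<in>(\<lambda>(z, w). d z w) ` (E \<times> E). norm s \<le> B"
    by (auto simp: bounded_pos)
  then have "\<exists>B. B > 0 \<and> (\<forall>z\<in>E. \<forall>w\<in>E. d z w \<le> B)" by (intro exI[of _ B]) force
  from someI_ex[OF this] show "\<Delta> > 0" "z \<in> E \<Longrightarrow> w \<in> E \<Longrightarrow> d z w \<le> \<Delta>"
    unfolding \<Delta>_def by auto
qed

text \<open>The coordinates are \<open>d\<close>-distances to a countable \<open>d\<close>-dense
  subset of \<open>Ext C\<close>, assembled from the finite nets that compactness provides. They are
  continuous since \<open>d\<close> is, and density with the triangle inequality makes them separate
  points.\<close>

lemma ex_embedding: "\<exists>\<Phi> :: 'a \<Rightarrow> nat \<Rightarrow> real. continuous_on E \<Phi> \<and> inj_on \<Phi> E"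
proof (cases "E = {}")
  case False
  have "\<exists>I. finite I \<and> I \<subseteq> E \<and> (\<forall>z\<in>E. \<exists>e\<in>I. d e z < 1 / Suc n)" for n
  proof -
    have "\<forall>e\<in>E. \<exists>U. open U \<and> e \<in> U \<and> (\<forall>z\<in>U \<inter> E. d e z < 1 / Suc n)"
      using d_nhd by simp
    then obtain U where U: "\<And>e. e \<in> E \<Longrightarrow> open (U e) \<and> e \<in> U e \<and> (\<forall>z\<in>U e \<inter> E. d e z < 1 / Suc n)"
      by metis
    have oU: "\<And>e. e \<in> E \<Longrightarrow> open (U e)" and cov: "E \<subseteq> (\<Union>e\<in>E. U e)" using U by blast+
    obtain I where I: "I \<subseteq> E" "finite I" "E \<subseteq> (\<Union>e\<in>I. U e)"
      using compactE_image[OF compact_Ext oU cov] by blast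
    have "\<exists>e\<in>I. d e z < 1 / Suc n" if z: "z \<in> E" for z
    proof -
      obtain e where e: "e \<in> I" "z \<in> U e" using I(3) z by blast
      then have "e \<in> E" using I(1) by blast
      then show ?thesis using U[of e] e z by blast
    qed
    then show ?thesis using I by blast
  qed
  then obtain I where I: "\<And>n. finite (I n) \<and> I n \<subseteq> E \<and> (\<forall>z\<in>E. \<exists>e\<in>I n. d e z < 1 / Suc n)"
    by metis
  let ?J = "\<Union>n. I n"
  have ne: "?J \<noteq> {}" using I[of 0] False by blast
  have "countable (I n)" "I n \<subseteq> E" for n using I[of n] by (auto intro: countable_finite)
  then have J: "?J \<subseteq> E" "countable ?J" by (auto intro: countable_UN)
  define e where "e = from_nat_into ?J"
  have e: "range e = ?J" unfolding e_def by (rule range_from_nat_into[OF ne J(2)])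
  have eE: "e n \<in> E" for n using J(1) rangeI[of e n] unfolding e by blast
  let ?\<Phi> = "\<lambda>z n. d (e n) z"
  have "continuous_on E ?\<Phi>"
    using eE by (intro continuous_on_coordinatewise_then_product continuous_on_d continuous_intros) auto
  moreover have "inj_on ?\<Phi> E"
  proof (rule inj_onI)
    fix z w assume z: "z \<in> E" and w: "w \<in> E" and eq: "?\<Phi> z = ?\<Phi> w"
    have le: "d z w \<le> 2 / Suc n" for n
    proof -
      obtain y where y: "y \<in> I n" "d y z < 1 / Suc n" using I z by blast
      then obtain k where k: "y = e k" using e by blast
      have "d y w = d y z" using fun_cong[OF eq, of k] by (simp add: k)
      moreover have "d z w \<le> d z y + d y w" using z w y I by (intro triangle) auto
      ultimately show ?thesis using y(2) d_sym[of z y] by simp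
    qed
    have "(\<lambda>n. 2 / real (Suc n)) \<longlonglongrightarrow> 0" by real_asymp
    then have "d z w \<le> 0" using le by (intro LIMSEQ_le_const) auto
    then show "z = w" using d_nonneg[of z w] zero[OF z w] by simp
  qed
  ultimately show ?thesis by blast
qed (auto intro: exI[of _ "\<lambda>_ _. 0"])

text \<open>The target carries the Borel sets of the product topology, which componentwise
  measurability does not reach in general. The embedding moves the question to a second countable
  space, where it does.\<close>

lemma measurable_pair_Ext:
  assumes "\<zeta> \<in> measurable M (restrict_space borel E)" "\<xi> \<in> measurable M (restrict_space borel E)"
  shows "(\<lambda>t. (\<zeta> t, \<xi> t)) \<in> measurable M (restrict_space borel (E \<times> E))"
proof -
  obtain \<Phi> :: "'a \<Rightarrow> nat \<Rightarrow> real" where \<Phi>: "continuous_on E \<Phi>" "inj_on \<Phi> E"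
    using ex_embedding by blast
  show ?thesis
  proof (rule measurable_into_embedded)
    show "compact (E \<times> E)" by (intro compact_Times compact_Ext)
    show "continuous_on (E \<times> E) (map_prod \<Phi> \<Phi>)"
      unfolding map_prod_def split_def
      by (intro continuous_on_Pair continuous_on_compose2[OF \<Phi>(1)] continuous_intros) auto
    show "inj_on (map_prod \<Phi> \<Phi>) (E \<times> E)" using \<Phi>(2) by (simp add: map_prod_inj_on)
    show "(\<zeta> t, \<xi> t) \<in> E \<times> E" if "t \<in> space M" for t
      using that assms[THEN measurable_space] by (simp add: space_restrict_space)
    show "(\<lambda>t. map_prod \<Phi> \<Phi> (\<zeta> t, \<xi> t)) \<in> borel_measurable M"
      using assms[THEN measurable_continuous_on_compose[OF \<Phi>(1)]] by (simp add: borel_measurable_Pair)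
  qed
qed

lemma radon_prob_Ext_Times:
  assumes "prob_space M" "sets M = sets (restrict_space borel (E \<times> E))"
  shows "M \<in> radon_prob (E \<times> E)"
proof -
  obtain \<Phi> :: "'a \<Rightarrow> nat \<Rightarrow> real" where \<Phi>: "continuous_on E \<Phi>" "inj_on \<Phi> E"
    using ex_embedding by blast
  show ?thesis
  proof (rule radon_prob_embedded[OF _ _ _ assms])
    show "compact (E \<times> E)" by (intro compact_Times compact_Ext)
    show "continuous_on (E \<times> E) (map_prod \<Phi> \<Phi>)"
      unfolding map_prod_def split_def
      by (intro continuous_on_Pair continuous_on_compose2[OF \<Phi>(1)] continuous_intros) auto
    show "inj_on (map_prod \<Phi> \<Phi>) (E \<times> E)" using \<Phi>(2) by (simp add: map_prod_inj_on)
  qed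
qed

text \<open>The law of \<open>\<zeta>\<close> has barycentre \<open>x\<close>. The underlying space
  is left free so that a coupling can itself serve as one, with \<open>fst\<close> and
  \<open>snd\<close> as variables; couplings are then modified by changing variables on it.\<close>

definition represents :: "'b measure \<Rightarrow> ('b \<Rightarrow> 'a) \<Rightarrow> 'a \<Rightarrow> bool" where
  "represents M \<zeta> x \<longleftrightarrow> \<zeta> \<in> measurable M (restrict_space borel E) \<and>
     (\<forall>f\<in>dual_space. (\<integral>t. f (\<zeta> t) \<partial>M) = f x)"

lemma represents_Ext: "represents M \<zeta> x \<Longrightarrow> t \<in> space M \<Longrightarrow> \<zeta> t \<in> E"
  by (auto simp: represents_def space_restrict_space dest: measurable_space)

lemma couplingI:
  assumes M: "prob_space M" and \<zeta>: "represents M \<zeta> x" and \<xi>: "represents M \<xi> y"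
  shows "distr M (restrict_space borel (E \<times> E)) (\<lambda>t. (\<zeta> t, \<xi> t)) \<in> couplings C x y"
proof -
  let ?N = "restrict_space borel (E \<times> E) :: ('a \<times> 'a) measure" and ?g = "\<lambda>t. (\<zeta> t, \<xi> t)"
  have g: "?g \<in> measurable M ?N"
    using \<zeta> \<xi> by (intro measurable_pair_Ext) (auto simp: represents_def)
  have "distr M ?N ?g \<in> radon_prob (E \<times> E)"
    using prob_space.prob_space_distr[OF M g] by (intro radon_prob_Ext_Times) auto
  moreover have "(\<integral>u. f (fst u) \<partial>distr M ?N ?g) = f x \<and> (\<integral>u. f (snd u) \<partial>distr M ?N ?g) = f y"
    if f: "f \<in> dual_space" for f
  proof -
    have "(\<lambda>u. f (fst u)) \<in> borel_measurable ?N" "(\<lambda>u. f (snd u)) \<in> borel_measurable ?N"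
      by (intro borel_measurable_continuous_on_restrict
          continuous_on_compose2[OF dual_space_continuous_on[OF f, of UNIV]] continuous_intros; simp)+
    then show ?thesis using \<zeta> \<xi> f by (simp add: integral_distr[OF g] represents_def)
  qed
  ultimately show ?thesis by (auto simp: couplings_def)
qed

lemma couplingD:
  assumes "\<pi> \<in> couplings C x y"
  shows "prob_space \<pi>" "sets \<pi> = sets (restrict_space borel (E \<times> E))" "space \<pi> = E \<times> E"
    "represents \<pi> fst x" "represents \<pi> snd y"
proof -
  show 1: "prob_space \<pi>" and 2: "sets \<pi> = sets (restrict_space borel (E \<times> E))"
    using assms by (auto simp: couplings_def radon_prob_def)
  show 3: "space \<pi> = E \<times> E"
    using sets_eq_imp_space_eq[OF 2] by (simp add: space_restrict_space)
  have "g \<in> measurable \<pi> (restrict_space borel E)"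
    if "continuous_on (E \<times> E) g" "g ` (E \<times> E) \<subseteq> E" for g
  proof (rule measurable_restrict_space2)
    show "g \<in> borel_measurable \<pi>"
      using borel_measurable_continuous_on_restrict[OF that(1)] by (simp add: measurable_cong_sets[OF 2 refl])
    show "g \<in> space \<pi> \<rightarrow> E" using that(2) 3 by auto
  qed
  from this[of fst] this[of snd]
  have "fst \<in> measurable \<pi> (restrict_space borel E)" "snd \<in> measurable \<pi> (restrict_space borel E)"
    using continuous_on_fst[OF continuous_on_id] continuous_on_snd[OF continuous_on_id] by auto
  then show "represents \<pi> fst x" "represents \<pi> snd y"
    using assms by (auto simp: represents_def couplings_def)
qed

lemma integrable_cost:
  assumes M: "prob_space M" and \<zeta>: "represents M \<zeta> x" and \<xi>: "represents M \<xi> y" and p: "p > 0"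
  shows "integrable M (\<lambda>t. d (\<zeta> t) (\<xi> t) powr p)"
proof -
  interpret prob_space M by (rule M)
  have "continuous_on (E \<times> E) (\<lambda>u. (case u of (z, w) \<Rightarrow> d z w) powr p)"
    using d_nonneg p by (intro continuous_on_powr' continuous_d continuous_intros) auto
  then have "integrable M (\<lambda>t. (case (\<zeta> t, \<xi> t) of (z, w) \<Rightarrow> d z w) powr p)"
    by (rule integrable_continuous_on_compact[OF compact_Times[OF compact_Ext compact_Ext]])
       (use \<zeta> \<xi> in \<open>auto intro!: measurable_pair_Ext simp: represents_def\<close>, unfold_locales)
  then show ?thesis by simp
qed

lemma integrable_d:
  assumes "prob_space M" "represents M \<zeta> x" "represents M \<xi> y"
  shows "integrable M (\<lambda>t. d (\<zeta> t) (\<xi> t))"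
  using integrable_cost[OF assms, of 1] d_nonneg by simp

lemma cost_nonneg: "0 \<le> (\<integral>t. d (\<zeta> t) (\<xi> t) powr p \<partial>M)"
  by (intro integral_nonneg_AE) auto

section \<open>Elementary estimates for the roof\<close>

abbreviation cost :: "real \<Rightarrow> ('a \<times> 'a) measure \<Rightarrow> real" where
  "cost p \<pi> \<equiv> \<integral>u. d (fst u) (snd u) powr p \<partial>\<pi>"

lemma roof_le:
  assumes M: "prob_space M" and \<zeta>: "represents M \<zeta> x" and \<xi>: "represents M \<xi> y" and p: "p > 0"
  shows "R p x y \<le> (\<integral>t. d (\<zeta> t) (\<xi> t) powr p \<partial>M) powr (1 / p)"
proof -
  let ?N = "restrict_space borel (E \<times> E) :: ('a \<times> 'a) measure" and ?g = "\<lambda>t. (\<zeta> t, \<xi> t)"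
  let ?c = "\<lambda>\<pi>. \<integral>u. d (fst u) (snd u) powr p \<partial>\<pi>"
  have g: "?g \<in> measurable M ?N"
    using \<zeta> \<xi> by (intro measurable_pair_Ext) (auto simp: represents_def)
  have "continuous_on (E \<times> E) (\<lambda>u. (case u of (z, w) \<Rightarrow> d z w) powr p)"
    using d_nonneg p by (intro continuous_on_powr' continuous_d continuous_intros) auto
  then have m: "(\<lambda>u. d (fst u) (snd u) powr p) \<in> borel_measurable ?N"
    by (intro borel_measurable_continuous_on_restrict) (simp add: split_def)
  have bdd: "bdd_below (?c ` couplings C x y)" by (intro bdd_belowI2[of _ 0] cost_nonneg)
  have "(INF \<pi>\<in>couplings C x y. ?c \<pi>) \<le> ?c (distr M ?N ?g)"
    by (rule cINF_lower[OF bdd couplingI[OF M \<zeta> \<xi>]])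
  also have "\<dots> = (\<integral>t. d (\<zeta> t) (\<xi> t) powr p \<partial>M)" by (simp add: integral_distr[OF g m])
  finally have le: "(INF \<pi>\<in>couplings C x y. ?c \<pi>) \<le> (\<integral>t. d (\<zeta> t) (\<xi> t) powr p \<partial>M)" .
  have "0 \<le> (INF \<pi>\<in>couplings C x y. ?c \<pi>)"
    using couplingI[OF M \<zeta> \<xi>] by (intro cINF_greatest cost_nonneg) auto
  then show ?thesis unfolding roof_def using le p by (intro powr_mono2) auto
qed

lemma roof_nonneg: "0 \<le> R p x y"
  by (simp add: roof_def)

abbreviation U01 :: "real measure" where "U01 \<equiv> restrict_space lborel {0..<1}"

text \<open>The values stay in \<open>F\<close>, and this turns membership in the hull of a small
  set into a bound on the cost.\<close>

lemma represents_in_cco: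
  assumes "closed F" "F \<subseteq> E" "x \<in> cco F"
  obtains \<zeta> where "represents U01 \<zeta> x" "\<And>t. t \<in> {0..<1} \<Longrightarrow> \<zeta> t \<in> F"
proof -
  obtain \<Phi> :: "'a \<Rightarrow> nat \<Rightarrow> real" where \<Phi>: "continuous_on E \<Phi>" "inj_on \<Phi> E"
    using ex_embedding by blast
  obtain \<zeta> where "\<zeta> \<in> measurable U01 (restrict_space borel E)" "\<And>t. t \<in> {0..<1} \<Longrightarrow> \<zeta> t \<in> F"
    "\<And>f. f \<in> dual_space \<Longrightarrow> (\<integral>t. f (\<zeta> t) \<partial>U01) = f x"
    using representing_variable[OF compact_C convex_C Ext_subset compact_Ext \<Phi> assms] by metis
  then show thesis by (intro that) (auto simp: represents_def)
qed

lemma C_eq_cco: "C = cco E"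
  using compact_C convex_C by (rule Krein_Milman)

lemma represents_exists:
  assumes "x \<in> C" obtains \<zeta> where "represents U01 \<zeta> x"
  using represents_in_cco[OF closed_Ext subset_refl] assms C_eq_cco by metis

lemma represents_const: "e \<in> E \<Longrightarrow> prob_space M \<Longrightarrow> represents M (\<lambda>_. e) e"
  unfolding represents_def
  by (auto simp: prob_space.prob_space space_restrict_space intro!: measurable_const)

lemma couplings_nonempty:
  assumes "x \<in> C" "y \<in> C" shows "couplings C x y \<noteq> {}"
proof -
  obtain \<zeta> where "represents U01 \<zeta> x" using represents_exists[OF assms(1)] .
  moreover obtain \<xi> where "represents U01 \<xi> y" using represents_exists[OF assms(2)] .
  ultimately show ?thesis using couplingI[OF prob_space_unit_interval] by blast
qed

text \<open>Near-optimal couplings take the place of minimisers. The error stands outside the root,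
  the form in which it adds up along chains.\<close>

lemma roof_approx:
  assumes xy: "x \<in> C" "y \<in> C" and p: "p > 0" and e: "e > 0"
  obtains \<pi> where "\<pi> \<in> couplings C x y"
    "cost p \<pi> powr (1 / p) < R p x y + e"
proof -
  let ?c = "\<lambda>\<pi>. \<integral>u. d (fst u) (snd u) powr p \<partial>\<pi>"
  let ?I = "INF \<pi>\<in>couplings C x y. ?c \<pi>"
  have bdd: "bdd_below (?c ` couplings C x y)" by (intro bdd_belowI2[of _ 0] cost_nonneg)
  have I0: "0 \<le> ?I" using couplings_nonempty[OF xy] by (intro cINF_greatest cost_nonneg)
  have "?I = (?I powr (1 / p)) powr p" using I0 p by (simp add: powr_powr)
  also have "\<dots> < (R p x y + e) powr p"
    using e p by (intro powr_less_mono2) (auto simp: roof_def)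
  finally obtain \<pi> where \<pi>: "\<pi> \<in> couplings C x y" "?c \<pi> < (R p x y + e) powr p"
    using cINF_less_iff[OF couplings_nonempty[OF xy] bdd] by blast
  have "?c \<pi> powr (1 / p) < ((R p x y + e) powr p) powr (1 / p)"
    using \<pi>(2) p cost_nonneg by (intro powr_less_mono2) auto
  also have "\<dots> = R p x y + e" using p e roof_nonneg[of p x y] by (simp add: powr_powr)
  finally show thesis using \<pi>(1) that by blast
qed

lemma roof_le_d:
  assumes "z \<in> E" "w \<in> E" "p > 0" shows "R p z w \<le> d z w"
proof -
  interpret prob_space U01 by (rule prob_space_unit_interval)
  have "R p z w \<le> (\<integral>t. d z w powr p \<partial>U01) powr (1 / p)"
    using assms by (intro roof_le represents_const prob_space_axioms)
  also have "(\<integral>t. d z w powr p \<partial>U01) = d z w powr p"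
    using prob_space by (simp add: space_restrict_space)
  also have "(d z w powr p) powr (1 / p) = d z w" using assms d_nonneg[of z w] by (simp add: powr_powr)
  finally show ?thesis .
qed

lemma roof_sym:
  assumes xy: "x \<in> C" "y \<in> C" and p: "p > 0"
  shows "R p x y = R p y x"
proof -
  have "R p x y \<le> R p y x" if xy: "x \<in> C" "y \<in> C" for x y
  proof (rule field_le_epsilon)
    fix e :: real assume e: "e > 0"
    obtain \<pi> where \<pi>: "\<pi> \<in> couplings C y x"
      "cost p \<pi> powr (1 / p) < R p y x + e"
      using roof_approx[OF xy(2,1) p e] .
    have "R p x y \<le> (\<integral>u. d (snd u) (fst u) powr p \<partial>\<pi>) powr (1 / p)"
      using couplingD[OF \<pi>(1)] p by (intro roof_le)
    then show "R p x y \<le> R p y x + e" using \<pi>(2) by (simp add: d_sym)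
  qed
  then show ?thesis using xy by (intro antisym) auto
qed

lemma roof_refl:
  assumes "x \<in> C" "p > 0" shows "R p x x = 0"
proof -
  obtain \<zeta> where \<zeta>: "represents U01 \<zeta> x" using represents_exists[OF assms(1)] .
  have "R p x x \<le> (\<integral>t. d (\<zeta> t) (\<zeta> t) powr p \<partial>U01) powr (1 / p)"
    using \<zeta> assms by (intro roof_le prob_space_unit_interval)
  also have "(\<integral>t. d (\<zeta> t) (\<zeta> t) powr p \<partial>U01) = (\<integral>t. 0 \<partial>U01)"
    using represents_Ext[OF \<zeta>] assms by (intro Bochner_Integration.integral_cong) (auto simp: d_refl)
  finally show ?thesis using roof_nonneg[of p x x] by simp
qed

text \<open>The power mean inequality with exponent \<open>q / p\<close>, applied to
  \<open>d powr p\<close> on a coupling that is near-optimal for \<open>q\<close>.\<close>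

lemma roof_mono_exponent:
  assumes xy: "x \<in> C" "y \<in> C" and pq: "0 < p" "p \<le> q"
  shows "R p x y \<le> R q x y"
proof (rule field_le_epsilon)
  fix e :: real assume e: "e > 0"
  have q: "q > 0" using pq by simp
  obtain \<pi> where \<pi>: "\<pi> \<in> couplings C x y"
    "(\<integral>u. d (fst u) (snd u) powr q \<partial>\<pi>) powr (1 / q) < R q x y + e"
    using roof_approx[OF xy q e] .
  note D = couplingD[OF \<pi>(1)]
  interpret prob_space \<pi> by (rule D)
  have "cost p \<pi> powr (q / p) \<le> (\<integral>u. (d (fst u) (snd u) powr p) powr (q / p) \<partial>\<pi>)"
    using integrable_cost[OF D(1,4,5) pq(1)] integrable_cost[OF D(1,4,5) q] pq
    by (intro power_mean_le) (auto simp: powr_powr)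
  then have le: "cost p \<pi> powr (q / p) \<le> (\<integral>u. d (fst u) (snd u) powr q \<partial>\<pi>)"
    using pq by (simp add: powr_powr)
  have "R p x y \<le> cost p \<pi> powr (1 / p)"
    using D pq by (intro roof_le)
  also have "\<dots> = (cost p \<pi> powr (q / p)) powr (1 / q)"
    using pq by (simp add: powr_powr)
  also have "\<dots> \<le> (\<integral>u. d (fst u) (snd u) powr q \<partial>\<pi>) powr (1 / q)"
    using le q by (intro powr_mono2) auto
  finally show "R p x y \<le> R q x y + e" using \<pi>(2) by simp
qed

text \<open>Follows from \<open>d powr p \<le> \<Delta> powr (p - 1) * d\<close> on a near-optimal
  coupling for exponent 1. It reduces smallness of the roof for every exponent to exponent
  1.\<close>

lemma roof_le_roof_1:
  assumes xy: "x \<in> C" "y \<in> C" and p: "p \<ge> 1" and r: "R 1 x y < r"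
  shows "R p x y \<le> (\<Delta> powr (p - 1) * r) powr (1 / p)"
proof -
  obtain \<pi> where \<pi>: "\<pi> \<in> couplings C x y"
    "(\<integral>u. d (fst u) (snd u) powr 1 \<partial>\<pi>) powr (1 / 1) < R 1 x y + (r - R 1 x y)"
    using roof_approx[OF xy, of 1 "r - R 1 x y"] r by auto
  note D = couplingD[OF \<pi>(1)]
  have int0: "(\<integral>u. d (fst u) (snd u) \<partial>\<pi>) \<ge> 0" using d_nonneg by (intro integral_nonneg_AE) auto
  then have lt: "(\<integral>u. d (fst u) (snd u) \<partial>\<pi>) < r" using \<pi>(2) d_nonneg by simp
  have "d z w powr p \<le> \<Delta> powr (p - 1) * d z w" if "z \<in> E" "w \<in> E" for z w
  proof (cases "d z w = 0")
    case False
    then have "d z w powr p = d z w powr (p - 1) * d z w"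
      using d_nonneg[of z w] powr_mult_base[of "d z w" "p - 1"] by (simp add: mult.commute)
    also have "\<dots> \<le> \<Delta> powr (p - 1) * d z w"
      using p \<Delta>(2)[OF that] d_nonneg by (intro mult_right_mono powr_mono2) auto
    finally show ?thesis .
  qed simp
  then have "cost p \<pi> \<le> (\<integral>u. \<Delta> powr (p - 1) * d (fst u) (snd u) \<partial>\<pi>)"
    using D p by (intro integral_mono integrable_cost[OF D(1,4,5)] integrable_mult_right integrable_d[OF D(1,4,5)]) auto
  also have "\<dots> \<le> \<Delta> powr (p - 1) * r" using lt by (simp add: mult_left_mono)
  finally have "cost p \<pi> powr (1 / p) \<le> (\<Delta> powr (p - 1) * r) powr (1 / p)"
    using p cost_nonneg by (intro powr_mono2) auto
  moreover have "R p x y \<le> cost p \<pi> powr (1 / p)"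
    using D p by (intro roof_le) auto
  ultimately show ?thesis by simp
qed

lemma roof_1_le:
  assumes "prob_space M" "represents M \<zeta> x" "represents M \<xi> y"
  shows "R 1 x y \<le> (\<integral>t. d (\<zeta> t) (\<xi> t) \<partial>M)"
proof -
  have "0 \<le> (\<integral>t. d (\<zeta> t) (\<xi> t) \<partial>M)" using d_nonneg by (intro integral_nonneg_AE) auto
  then show ?thesis using roof_le[OF assms, of 1] d_nonneg by simp
qed

lemma roof_1_approx:
  assumes "x \<in> C" "y \<in> C" "e > 0"
  obtains \<pi> where "\<pi> \<in> couplings C x y" "(\<integral>u. d (fst u) (snd u) \<partial>\<pi>) < R 1 x y + e"
proof -
  obtain \<pi> where \<pi>: "\<pi> \<in> couplings C x y"
    "(\<integral>u. d (fst u) (snd u) powr 1 \<partial>\<pi>) powr (1 / 1) < R 1 x y + e"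
    using roof_approx[OF assms(1,2) _ assms(3), of 1] by auto
  have "0 \<le> (\<integral>u. d (fst u) (snd u) \<partial>\<pi>)" using d_nonneg by (intro integral_nonneg_AE) auto
  then show thesis using \<pi> d_nonneg by (intro that[of \<pi>]) auto
qed

text \<open>A mixture of near-optimal couplings of the two pairs couples the two combinations, and
  its cost is the mixture of the costs. With exponent 1 no root intervenes between cost and
  roof.\<close>

lemma roof_1_convex:
  assumes C: "x \<in> C" "y \<in> C" "x' \<in> C" "y' \<in> C" and t: "0 \<le> t" "t \<le> 1"
  shows "R 1 ((1 - t) *\<^sub>R x + t *\<^sub>R x') ((1 - t) *\<^sub>R y + t *\<^sub>R y')
    \<le> (1 - t) * R 1 x y + t * R 1 x' y'"
proof (rule field_le_epsilon)
  fix e :: real assume e: "e > 0"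
  obtain \<pi> where \<pi>: "\<pi> \<in> couplings C x y" "(\<integral>u. d (fst u) (snd u) \<partial>\<pi>) < R 1 x y + e"
    using roof_1_approx[OF C(1,2) e] .
  obtain \<pi>' where \<pi>': "\<pi>' \<in> couplings C x' y'" "(\<integral>u. d (fst u) (snd u) \<partial>\<pi>') < R 1 x' y' + e"
    using roof_1_approx[OF C(3,4) e] .
  note D = couplingD[OF \<pi>(1)] and D' = couplingD[OF \<pi>'(1)]
  let ?N = "restrict_space borel (E \<times> E) :: ('a \<times> 'a) measure"
  obtain M where M: "prob_space M" "sets M = sets ?N"
    "\<And>h :: 'a \<times> 'a \<Rightarrow> real. h \<in> borel_measurable ?N \<Longrightarrow> (\<exists>B. \<forall>u\<in>space ?N. \<bar>h u\<bar> \<le> B) \<Longrightarrow>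
      (\<integral>u. h u \<partial>M) = (1 - t) * (\<integral>u. h u \<partial>\<pi>) + t * (\<integral>u. h u \<partial>\<pi>')"
    using prob_space_mixture[OF D(1) D'(1) D(2) D'(2) t] by metis
  have Mc: "(\<integral>u. h u \<partial>M) = (1 - t) * (\<integral>u. h u \<partial>\<pi>) + t * (\<integral>u. h u \<partial>\<pi>')"
    if h: "continuous_on (E \<times> E) h" for h :: "'a \<times> 'a \<Rightarrow> real"
  proof (rule M(3))
    show "h \<in> borel_measurable ?N" using h by (rule borel_measurable_continuous_on_restrict)
    have "bounded (h ` (E \<times> E))"
      by (intro compact_imp_bounded compact_continuous_image compact_Times compact_Ext h)
    then show "\<exists>B. \<forall>u\<in>space ?N. \<bar>h u\<bar> \<le> B" by (auto simp: bounded_iff space_restrict_space)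
  qed
  have meas: "g \<in> measurable M (restrict_space borel E)"
    if "g \<in> measurable \<pi> (restrict_space borel E)" for g :: "'a \<times> 'a \<Rightarrow> 'a"
    using that by (simp add: measurable_cong_sets[OF M(2) refl] measurable_cong_sets[OF D(2) refl])
  have fs: "continuous_on (E \<times> E) (\<lambda>u. f (fst u))" "continuous_on (E \<times> E) (\<lambda>u. f (snd u))"
    if "f \<in> dual_space" for f
    by (intro continuous_on_compose2[OF dual_space_continuous_on[OF that, of UNIV]] continuous_intros; simp)+
  have "represents M fst ((1 - t) *\<^sub>R x + t *\<^sub>R x')"
    using D(4) D'(4) by (auto simp: represents_def meas Mc[OF fs(1)] linear_add[OF dual_space_linear] linear_cmul[OF dual_space_linear])
  moreover have "represents M snd ((1 - t) *\<^sub>R y + t *\<^sub>R y')"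
    using D(5) D'(5) by (auto simp: represents_def meas Mc[OF fs(2)] linear_add[OF dual_space_linear] linear_cmul[OF dual_space_linear])
  ultimately have "R 1 ((1 - t) *\<^sub>R x + t *\<^sub>R x') ((1 - t) *\<^sub>R y + t *\<^sub>R y') \<le> (\<integral>u. d (fst u) (snd u) \<partial>M)"
    by (rule roof_1_le[OF M(1)])
  also have "\<dots> = (1 - t) * (\<integral>u. d (fst u) (snd u) \<partial>\<pi>) + t * (\<integral>u. d (fst u) (snd u) \<partial>\<pi>')"
    by (rule Mc) (intro continuous_on_d continuous_intros; auto)
  also have "\<dots> \<le> (1 - t) * (R 1 x y + e) + t * (R 1 x' y' + e)"
    using \<pi>(2) \<pi>'(2) t by (intro add_mono mult_left_mono) auto
  finally show "R 1 ((1 - t) *\<^sub>R x + t *\<^sub>R x') ((1 - t) *\<^sub>R y + t *\<^sub>R y')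
      \<le> (1 - t) * R 1 x y + t * R 1 x' y' + e" by (simp add: algebra_simps)
qed

text \<open>The easy half of Kantorovich duality: the Lipschitz bound is integrated against a
  coupling, and \<open>affine_barycentre\<close> evaluates the integrals of \<open>a\<close> at the
  marginals.\<close>

lemma Lipschitz_le_roof_1:
  assumes xy: "x \<in> C" "y \<in> C" and a: "a \<in> A_Lip d C"
  shows "\<bar>a x - a y\<bar> \<le> R 1 x y"
proof (rule field_le_epsilon)
  fix e :: real assume e: "e > 0"
  have ca: "continuous_on C a" and af: "affine_on C a"
    and lip: "\<And>z w. z \<in> E \<Longrightarrow> w \<in> E \<Longrightarrow> \<bar>a z - a w\<bar> \<le> d z w"
    using a by (auto simp: A_Lip_def)
  obtain \<pi> where \<pi>: "\<pi> \<in> couplings C x y" "(\<integral>u. d (fst u) (snd u) \<partial>\<pi>) < R 1 x y + e"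
    using roof_1_approx[OF xy e] .
  note D = couplingD[OF \<pi>(1)]
  interpret prob_space \<pi> by (rule D)
  have bary: "(\<integral>u. a (g u) \<partial>\<pi>) = a v" if "represents \<pi> g v" "v \<in> C" for g v
    using that by (intro affine_barycentre[OF compact_C convex_C _ compact_Ext Ext_subset D(1) _ _ ca af])
      (auto simp: represents_def)
  have int: "integrable \<pi> (\<lambda>u. a (g u))" if "represents \<pi> g v" for g v
    using that continuous_on_subset[OF ca Ext_subset]
    by (intro integrable_continuous_on_compact[OF compact_Ext]) (auto simp: represents_def finite_measure_axioms)
  have "\<bar>a x - a y\<bar> = \<bar>\<integral>u. a (fst u) - a (snd u) \<partial>\<pi>\<bar>"
    using bary[OF D(4) xy(1)] bary[OF D(5) xy(2)] int[OF D(4)] int[OF D(5)] by simp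
  also have "\<dots> \<le> (\<integral>u. \<bar>a (fst u) - a (snd u)\<bar> \<partial>\<pi>)" by (rule integral_abs_bound)
  also have "\<dots> \<le> (\<integral>u. d (fst u) (snd u) \<partial>\<pi>)"
    using int[OF D(4)] int[OF D(5)] lip D(3)
    by (intro integral_mono integrable_abs Bochner_Integration.integrable_diff integrable_d[OF D(1,4,5)]) auto
  finally show "\<bar>a x - a y\<bar> \<le> R 1 x y + e" using \<pi>(2) by simp
qed

end

section \<open>Continuity of the roof\<close>

context stable_roof
begin

lemma convex_combination_mem: "x \<in> C \<Longrightarrow> y \<in> C \<Longrightarrow> 0 \<le> t \<Longrightarrow> t \<le> 1 \<Longrightarrow> (1 - t) *\<^sub>R x + t *\<^sub>R y \<in> C"
  using convexD_alt[OF convex_C] .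

lemma cco_subset_C: "F \<subseteq> E \<Longrightarrow> cco F \<subseteq> C"
  using cco_mono[of F "E"] C_eq_cco by simp

lemma roof_1_le_sup:
  assumes "prob_space M" "represents M \<zeta> x" "represents M \<xi> y"
    and B: "\<And>t. t \<in> space M \<Longrightarrow> d (\<zeta> t) (\<xi> t) \<le> B"
  shows "R 1 x y \<le> B"
proof -
  interpret prob_space M by (rule assms)
  have "R 1 x y \<le> (\<integral>t. d (\<zeta> t) (\<xi> t) \<partial>M)" by (rule roof_1_le[OF assms(1-3)])
  also have "\<dots> \<le> (\<integral>t. B \<partial>M)" using B by (intro integral_mono integrable_d[OF assms(1-3)]) auto
  finally show ?thesis by (simp add: prob_space)
qed

lemma roof_1_le_\<Delta>:
  assumes "x \<in> C" "y \<in> C" shows "R 1 x y \<le> \<Delta>"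
proof -
  obtain \<pi> where \<pi>: "\<pi> \<in> couplings C x y" using couplings_nonempty[OF assms] by blast
  note D = couplingD[OF this]
  show ?thesis using \<Delta>(2) D(3) by (intro roof_1_le_sup[OF D(1,4,5)]) auto
qed

text \<open>\<open>Ext C\<close> is cut into a part \<open>F0\<close> near \<open>e\<close> and a
  part \<open>F1\<close> away from \<open>e\<close>. The points of \<open>C\<close> that put mass at
  least \<open>\<eta>\<close> on the far hull form the compact set \<open>?J\<close>. If
  \<open>e\<close> were in it, extremality would place \<open>e\<close> in \<open>cco F1\<close>,
  hence in \<open>F1\<close> by Milman's theorem. Off \<open>?J\<close> the near mass costs at most
  \<open>\<rho>\<close>, and the far mass, being less than \<open>\<eta>\<close>, costs at most
  \<open>\<eta> * \<Delta>\<close>.\<close>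

lemma roof_1_nhd_extreme:
  assumes e: "e \<in> E" and \<delta>: "\<delta> > 0"
  shows "\<exists>U. open U \<and> e \<in> U \<and> (\<forall>y\<in>U \<inter> C. R 1 e y < \<delta>)"
proof -
  define \<rho> where "\<rho> = \<delta> / 3"
  have \<rho>: "\<rho> > 0" "\<delta> = 3 * \<rho>" using \<delta> by (auto simp: \<rho>_def)
  define F0 where "F0 = {z \<in> E. d e z \<le> \<rho>}"
  define F1 where "F1 = {z \<in> E. \<rho> \<le> d e z}"
  have F: "closed F0" "closed F1" "F0 \<subseteq> E" "F1 \<subseteq> E" "E \<subseteq> F0 \<union> F1"
    unfolding F0_def F1_def using closed_d_ball[OF e] by auto
  \<comment> \<open>The quotient makes the far mass cost at most \<open>\<rho>\<close>; the cap 1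
    ensures that the full weight \<open>l = 1\<close> belongs to the range in
    \<open>?J\<close>.\<close>
  define \<eta> where "\<eta> = min 1 (\<rho> / \<Delta>)"
  have "\<eta> \<le> \<rho> / \<Delta>" by (simp add: \<eta>_def)
  moreover have "\<eta> > 0" "\<eta> \<le> 1" using \<rho> \<Delta>(1) by (auto simp: \<eta>_def)
  ultimately have \<eta>: "\<eta> > 0" "\<eta> \<le> 1" "\<eta> * \<Delta> \<le> \<rho>"
    using \<Delta>(1) by (auto simp: pos_le_divide_eq)
  have comp: "compact (cco G)" if "G \<subseteq> E" for G
    using compact_Int_closed[OF compact_C closed_cco[of G]] cco_subset_C[OF that] by (simp add: inf.absorb2)
  let ?g = "\<lambda>(u::real, a, b). (1 - u) *\<^sub>R a + u *\<^sub>R (b::'a)"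
  let ?J = "?g ` ({\<eta>..1} \<times> cco F0 \<times> cco F1)"
  have "compact ?J"
    using F by (intro compact_continuous_image compact_Times comp)
       (auto simp: split_def intro!: continuous_intros)
  then have oJ: "open (- ?J)" using compact_imp_closed by (auto simp: closed_def)
  have e0: "e \<in> cco F0" using cco_superset[of F0] e \<rho>(1) by (auto simp: F0_def d_refl)
  have eJ: "e \<notin> ?J"
  proof
    assume "e \<in> ?J"
    then obtain u a b where u: "\<eta> \<le> u" "u \<le> 1" "a \<in> cco F0" "b \<in> cco F1" "e = (1 - u) *\<^sub>R a + u *\<^sub>R b" by auto
    have "a \<in> C" "b \<in> C" using u F cco_subset_C by blast+
    then have "e \<notin> open_segment a b" using e by (auto simp: Ext_def extreme_point_of_def)
    then have "\<not> (a \<noteq> b \<and> 0 < u \<and> u < 1)" using u(5) unfolding in_segment by blast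
    then have "u = 1 \<or> a = b" using u \<eta> by linarith
    then have "e = b" using u(5) by (auto simp: algebra_simps)
    then have "e \<in> F1"
      using e u(4) F Ext_subset by (intro Milman_converse[OF compact_C convex_C _ F(2)]) (auto simp: Ext_def)
    then show False using e \<rho>(1) by (auto simp: F1_def d_refl)
  qed
  have "R 1 e y < \<delta>" if y: "y \<in> - ?J \<inter> C" for y
  proof -
    have "y \<in> cco E" using y C_eq_cco by simp
    from cco_split[OF compact_C convex_C Ext_subset F(5) this]
    obtain l k0 k1 where l: "0 \<le> l" "l \<le> 1" "k0 \<in> C" "k1 \<in> C" "y = (1 - l) *\<^sub>R k0 + l *\<^sub>R k1"
      "l < 1 \<longrightarrow> k0 \<in> cco (E \<inter> F0)" "l > 0 \<longrightarrow> k1 \<in> cco (E \<inter> F1)" by blast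
    have EF: "E \<inter> F0 = F0" "E \<inter> F1 = F1" using F by auto
    have "l < \<eta>"
    proof (rule ccontr)
      assume "\<not> l < \<eta>"
      then have l\<eta>: "\<eta> \<le> l" by simp
      show False
      proof (cases "l < 1")
        case True
        then have "(l, k0, k1) \<in> {\<eta>..1} \<times> cco F0 \<times> cco F1" using l l\<eta> \<eta> by (auto simp: EF)
        then have "?g (l, k0, k1) \<in> ?J" by (rule imageI)
        then show False using y l(5) by simp
      next
        case False
        \<comment> \<open>With weight 1 nothing is known about \<open>k0\<close>; the point
          \<open>e\<close> of \<open>cco F0\<close> replaces it without changing the
          combination.\<close>
        then have "(l, e, k1) \<in> {\<eta>..1} \<times> cco F0 \<times> cco F1" and "l = 1" using l l\<eta> \<eta> e0 by (auto simp: EF)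
        then have "?g (l, e, k1) \<in> ?J" by (intro imageI)
        then show False using y l(5) \<open>l = 1\<close> by simp
      qed
    qed
    then have k0: "k0 \<in> cco F0" using l \<eta> by (auto simp: EF)
    obtain \<zeta> where \<zeta>: "represents U01 \<zeta> k0" "\<And>t. t \<in> {0..<1} \<Longrightarrow> \<zeta> t \<in> F0"
      using represents_in_cco[OF F(1,3) k0] by blast
    have r0: "R 1 e k0 \<le> \<rho>"
      by (rule roof_1_le_sup[OF prob_space_unit_interval represents_const[OF e prob_space_unit_interval] \<zeta>(1)])
         (use \<zeta>(2) in \<open>auto simp: space_restrict_space F0_def\<close>)
    have eC: "e \<in> C" using e Ext_subset by blast
    have "R 1 ((1 - l) *\<^sub>R e + l *\<^sub>R e) ((1 - l) *\<^sub>R k0 + l *\<^sub>R k1)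
        \<le> (1 - l) * R 1 e k0 + l * R 1 e k1"
      using l eC by (intro roof_1_convex)
    also have "(1 - l) * R 1 e k0 \<le> R 1 e k0"
      using l roof_nonneg[of 1 e k0] by (simp add: mult_left_le_one_le)
    also have "l * R 1 e k1 \<le> \<eta> * \<Delta>"
      using \<open>l < \<eta>\<close> l roof_1_le_\<Delta>[OF eC l(4)] roof_nonneg by (intro mult_mono) auto
    finally have "R 1 ((1 - l) *\<^sub>R e + l *\<^sub>R e) y \<le> \<rho> + \<rho>" using r0 \<eta>(3) l(5) by simp
    then have "R 1 e y \<le> \<rho> + \<rho>" by (simp flip: scaleR_add_left)
    then show ?thesis using \<rho> by simp
  qed
  then show ?thesis using oJ eJ by blast
qed

text \<open>The limes superior of \<open>R 1 w\<close> at \<open>x\<close> is at most \<open>\<delta>\<close>.\<close>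

definition near :: "real \<Rightarrow> 'a \<Rightarrow> 'a \<Rightarrow> bool" where
  "near \<delta> w x \<longleftrightarrow> w \<in> C \<and> x \<in> C \<and>
     (\<forall>\<delta>'>\<delta>. \<exists>U. open U \<and> x \<in> U \<and> (\<forall>y\<in>U \<inter> C. R 1 w y < \<delta>'))"

text \<open>By stability, each point near the midpoint of \<open>x0\<close> and \<open>x1\<close> is
  a midpoint of points near \<open>x0\<close> and \<open>x1\<close>; \<open>roof_1_convex\<close>
  then averages the two bounds.\<close>

lemma near_midpoint:
  assumes "near \<delta>0 w0 x0" "near \<delta>1 w1 x1"
  shows "near ((\<delta>0 + \<delta>1) / 2) ((1/2) *\<^sub>R (w0 + w1)) ((1/2) *\<^sub>R (x0 + x1))"
  unfolding near_def
proof (intro conjI allI impI)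
  have mem: "w0 \<in> C" "w1 \<in> C" "x0 \<in> C" "x1 \<in> C" using assms by (auto simp: near_def)
  have mid: "(1/2) *\<^sub>R (a + b) = (1 - 1/2) *\<^sub>R a + (1/2) *\<^sub>R (b::'a)" for a b by (simp add: scaleR_add_right)
  show "(1/2) *\<^sub>R (w0 + w1) \<in> C" "(1/2) *\<^sub>R (x0 + x1) \<in> C"
    unfolding mid by (rule convex_combination_mem; use mem in simp)+
  fix \<delta>' assume \<delta>': "(\<delta>0 + \<delta>1) / 2 < \<delta>'"
  define \<epsilon> where "\<epsilon> = \<delta>' - (\<delta>0 + \<delta>1) / 2"
  have \<epsilon>: "\<epsilon> > 0" using \<delta>' by (simp add: \<epsilon>_def)
  obtain U where U: "open U" "x0 \<in> U" "\<And>y. y \<in> U \<inter> C \<Longrightarrow> R 1 w0 y < \<delta>0 + \<epsilon>"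
    using assms(1) \<epsilon> unfolding near_def by (meson less_add_same_cancel1)
  obtain V where V: "open V" "x1 \<in> V" "\<And>y. y \<in> V \<inter> C \<Longrightarrow> R 1 w1 y < \<delta>1 + \<epsilon>"
    using assms(2) \<epsilon> unfolding near_def by (meson less_add_same_cancel1)
  obtain W where W: "open W" "(1/2) *\<^sub>R (x0 + x1) \<in> W"
    "\<And>y. y \<in> W \<inter> C \<Longrightarrow> \<exists>u'\<in>U \<inter> C. \<exists>v'\<in>V \<inter> C. y = (1/2) *\<^sub>R (u' + v')"
    using stable_convex_midpoint_open[OF stable_C U(1) V(1)] U(2) V(2) mem by (metis IntI)
  have "R 1 ((1/2) *\<^sub>R (w0 + w1)) y < \<delta>'" if y: "y \<in> W \<inter> C" for y
  proof -
    obtain u v where uv: "u \<in> U \<inter> C" "v \<in> V \<inter> C" "y = (1/2) *\<^sub>R (u + v)" using W(3)[OF y] by blast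
    have "R 1 ((1 - 1/2) *\<^sub>R w0 + (1/2) *\<^sub>R w1) ((1 - 1/2) *\<^sub>R u + (1/2) *\<^sub>R v)
        \<le> (1 - 1/2) * R 1 w0 u + (1/2) * R 1 w1 v"
      using uv mem by (intro roof_1_convex) auto
    moreover have "(1 - 1/2) * R 1 w0 u + (1/2) * R 1 w1 v < \<delta>'"
      using U(3)[OF uv(1)] V(3)[OF uv(2)] unfolding \<epsilon>_def by (simp add: field_simps)
    ultimately show ?thesis unfolding mid uv(3) by linarith
  qed
  then show "\<exists>U. open U \<and> (1/2) *\<^sub>R (x0 + x1) \<in> U \<and> (\<forall>y\<in>U \<inter> C. R 1 ((1/2) *\<^sub>R (w0 + w1)) y < \<delta>')"
    using W(1,2) by blast
qed

text \<open>One step of the binary expansion of the weight: a digit 0 leaves the weight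
  \<open>2 * l\<close>, and a digit 1, treated in \<open>halving_right\<close>, leaves
  \<open>2 * l - 1\<close>.\<close>

lemma halving_left: "(1/2) *\<^sub>R (x + ((1 - 2 * l) *\<^sub>R x + (2 * l) *\<^sub>R y)) = (1 - l) *\<^sub>R x + l *\<^sub>R (y::'a)"
proof -
  have "x + ((1 - 2 * l) *\<^sub>R x + (2 * l) *\<^sub>R y) = 2 *\<^sub>R ((1 - l) *\<^sub>R x + l *\<^sub>R y)"
    by (simp add: algebra_simps scaleR_2)
  then show ?thesis by simp
qed

lemma halving_right: "(1/2) *\<^sub>R (y + ((1 - (2 * l - 1)) *\<^sub>R x + (2 * l - 1) *\<^sub>R y)) = (1 - l) *\<^sub>R x + l *\<^sub>R (y::'a)"
proof -
  have "y + ((1 - (2 * l - 1)) *\<^sub>R x + (2 * l - 1) *\<^sub>R y) = 2 *\<^sub>R ((1 - l) *\<^sub>R x + l *\<^sub>R y)"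
    by (simp add: algebra_simps scaleR_2)
  then show ?thesis by simp
qed

text \<open>Stability only concerns midpoints. Along the binary expansion of \<open>l\<close>, a convex combination with
  weight \<open>l\<close> is an iterated midpoint up to a remainder of weight \<open>2 ^ - m\<close>.\<close>

lemma near_convex_combination:
  assumes near: "near \<delta> w0 x0" "near \<delta> w1 x1" and \<delta>: "0 \<le> \<delta>" and l: "0 \<le> l" "l \<le> 1"
  shows "near \<delta> ((1 - l) *\<^sub>R w0 + l *\<^sub>R w1) ((1 - l) *\<^sub>R x0 + l *\<^sub>R x1)"
proof -
  let ?w = "\<lambda>l. (1 - l) *\<^sub>R w0 + l *\<^sub>R w1" and ?x = "\<lambda>l. (1 - l) *\<^sub>R x0 + l *\<^sub>R x1"
  have mem: "?w l \<in> C" "?x l \<in> C" if "0 \<le> l" "l \<le> 1" for l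
    using near that by (auto simp: near_def intro!: convex_combination_mem)
  have approx: "near (\<delta> + \<Delta> / 2 ^ m) (?w l) (?x l)" if "0 \<le> l" "l \<le> 1" for l m
    using that
  proof (induction m arbitrary: l)
    \<comment> \<open>At depth 0 the remainder carries the whole weight, and the uniform bound
      \<open>\<Delta>\<close> of the roof pays for it.\<close>
    case 0
    have "R 1 (?w l) y < \<delta>'" if "\<delta> + \<Delta> / 2 ^ 0 < \<delta>'" "y \<in> C" for \<delta>' y
      using roof_1_le_\<Delta>[OF mem(1)[OF 0] that(2)] that(1) \<delta> by simp
    then show ?case unfolding near_def using mem[OF 0] by (intro conjI allI impI exI[of _ UNIV]) auto
  next
    case (Suc m)
    have half: "(\<delta> + (\<delta> + \<Delta> / 2 ^ m)) / 2 = \<delta> + \<Delta> / 2 ^ Suc m" by simp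
    show ?case
    proof (cases "l \<le> 1/2")
      case True
      have "near ((\<delta> + (\<delta> + \<Delta> / 2 ^ m)) / 2) ((1/2) *\<^sub>R (w0 + ?w (2 * l))) ((1/2) *\<^sub>R (x0 + ?x (2 * l)))"
        using Suc True by (intro near_midpoint near(1)) auto
      moreover have "(1/2) *\<^sub>R (w0 + ?w (2 * l)) = ?w l" "(1/2) *\<^sub>R (x0 + ?x (2 * l)) = ?x l"
        by (rule halving_left)+
      ultimately show ?thesis unfolding half by simp
    next
      case False
      have "near ((\<delta> + (\<delta> + \<Delta> / 2 ^ m)) / 2) ((1/2) *\<^sub>R (w1 + ?w (2 * l - 1))) ((1/2) *\<^sub>R (x1 + ?x (2 * l - 1)))"
        by (intro near_midpoint near(2) Suc.IH) (use Suc.prems False in auto)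
      moreover have "(1/2) *\<^sub>R (w1 + ?w (2 * l - 1)) = ?w l" "(1/2) *\<^sub>R (x1 + ?x (2 * l - 1)) = ?x l"
        by (rule halving_right)+
      ultimately show ?thesis unfolding half by simp
    qed
  qed
  show ?thesis
    unfolding near_def
  proof (intro conjI allI impI mem l)
    fix \<delta>' assume "\<delta> < \<delta>'"
    have "(\<lambda>m. \<delta> + \<Delta> / 2 ^ m) \<longlonglongrightarrow> \<delta>"
      using tendsto_add[OF tendsto_const[of \<delta>] LIMSEQ_divide_realpow_zero[of 2 \<Delta>]] by simp
    then have "eventually (\<lambda>m. \<delta> + \<Delta> / 2 ^ m < \<delta>') sequentially" using \<open>\<delta> < \<delta>'\<close> by (rule order_tendstoD)
    then obtain m where "\<delta> + \<Delta> / 2 ^ m < \<delta>'" by (auto simp: eventually_sequentially)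
    then show "\<exists>U. open U \<and> ?x l \<in> U \<and> (\<forall>y\<in>U \<inter> C. R 1 (?w l) y < \<delta>')"
      using approx[OF l, of m] unfolding near_def by blast
  qed
qed

text \<open>Around each extreme point \<open>e\<close> a closed convex set \<open>K e\<close> is
  chosen on which \<open>R 1 e\<close> is below \<open>\<delta>\<close>. Splitting \<open>x\<close>
  along a finite cover gives pieces that remain in the sets \<open>K e\<close>, because these are
  closed and convex. The same weights applied to the points \<open>e\<close> give
  \<open>w\<close>.\<close>

lemma near_exists:
  assumes x: "x \<in> C" and \<delta>: "\<delta> > 0" shows "\<exists>w. near \<delta> w x"
proof -
  have "\<exists>G K. open G \<and> e \<in> G \<and> G \<subseteq> K \<and> closed K \<and> convex K \<and> (\<forall>k\<in>K \<inter> C. near \<delta> e k)" if e: "e \<in> E" for e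
  proof -
    obtain U where U: "open U" "e \<in> U" "\<And>y. y \<in> U \<inter> C \<Longrightarrow> R 1 e y < \<delta>"
      using roof_1_nhd_extreme[OF e \<delta>] by blast
    obtain G K where GK: "open G" "e \<in> G" "G \<subseteq> K" "K \<subseteq> U" "closed K" "convex K"
      using closed_convex_nhd_lcs[OF U(1,2)] by metis
    have "near \<delta> e k" if "k \<in> K \<inter> C" for k
      unfolding near_def using that U GK(4) e Ext_subset by (intro conjI allI impI exI[of _ U]) force+
    then show ?thesis using GK by blast
  qed
  then obtain G K where GK: "\<And>e. e \<in> E \<Longrightarrow> open (G e) \<and> e \<in> G e \<and> G e \<subseteq> K e \<and> closed (K e) \<and>
      convex (K e) \<and> (\<forall>k\<in>K e \<inter> C. near \<delta> e k)" by metis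
  have "open (G e)" if "e \<in> E" for e using GK[OF that] by blast
  moreover have "E \<subseteq> (\<Union>e\<in>E. G e)" using GK by blast
  ultimately obtain I where I: "I \<subseteq> E" "finite I" "E \<subseteq> (\<Union>e\<in>I. G e)"
    using compactE_image[OF compact_Ext] by metis
  have "\<exists>w. near \<delta> w x" if "finite I" "I \<subseteq> E" "F \<subseteq> E" "F \<subseteq> (\<Union>e\<in>I. K e)" "x \<in> cco F" for I F x
    using that
  proof (induction I arbitrary: F x)
    case empty
    then show ?case by simp
  next
    case (insert i I)
    have FC: "F \<subseteq> C" "F \<subseteq> K i \<union> (\<Union>e\<in>I. K e)" using insert.prems Ext_subset by auto
    from cco_split[OF compact_C convex_C FC insert.prems(4)]
    obtain l k0 k1 where l: "0 \<le> l" "l \<le> 1" "k0 \<in> C" "k1 \<in> C" "x = (1 - l) *\<^sub>R k0 + l *\<^sub>R k1"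
      "l < 1 \<longrightarrow> k0 \<in> cco (F \<inter> K i)" "l > 0 \<longrightarrow> k1 \<in> cco (F \<inter> (\<Union>e\<in>I. K e))" by blast
    have n0: "near \<delta> i k0" if "l < 1"
    proof -
      have i: "i \<in> E" using insert.prems by blast
      have "cco (F \<inter> K i) \<subseteq> K i" using GK[OF i] by (intro cco_minimal) auto
      then show ?thesis using l(3,6) that GK[OF i] by blast
    qed
    have n1: "\<exists>w. near \<delta> w k1" if "l > 0"
      using insert.prems l(7) that by (intro insert.IH[of "F \<inter> (\<Union>e\<in>I. K e)"]) auto
    consider "l = 0" | "l = 1" | "0 < l" "l < 1" using l(1,2) by linarith
    then show ?case
    proof cases
      case 1 then show ?thesis using n0 l(5) by auto
    next
      case 2 then show ?thesis using n1 l(5) by auto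
    next
      case 3
      obtain w where "near \<delta> w k1" using n1 3 by blast
      then show ?thesis using near_convex_combination[OF n0 _ _ l(1,2)] 3 \<delta> l(5) by (auto intro: less_imp_le)
    qed
  qed
  moreover have "E \<subseteq> (\<Union>e\<in>I. K e)" using I GK by blast
  moreover have "x \<in> cco E" using x by (subst C_eq_cco[symmetric])
  ultimately show ?thesis using I(1,2) by blast
qed

text \<open>The bound on \<open>R 1 w\<close> holds on a whole neighbourhood of \<open>x\<close>, in
  particular at \<open>x\<close>, so \<open>x\<close> and \<open>y\<close> are both close to
  \<open>w\<close>. The detour through \<open>w\<close> stays in the statement and becomes a
  two-link chain in the envelope.\<close>

lemma roof_nhd:
  assumes x: "x \<in> C" and p: "p \<ge> 1" and \<epsilon>: "\<epsilon> > 0"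
  shows "\<exists>U. open U \<and> x \<in> U \<and> (\<forall>y\<in>U \<inter> C. \<exists>w\<in>C. R p x w \<le> \<epsilon> \<and> R p w y \<le> \<epsilon>)"
proof -
  \<comment> \<open>Solved from the bound of \<open>roof_le_roof_1\<close>, which becomes exactly
    \<open>\<epsilon>\<close>.\<close>
  define r where "r = \<epsilon> powr p / \<Delta> powr (p - 1)"
  have r: "r > 0" using \<epsilon> \<Delta>(1) by (simp add: r_def)
  have le: "R p u v \<le> \<epsilon>" if "u \<in> C" "v \<in> C" "R 1 u v < r" for u v
  proof -
    have "R p u v \<le> (\<Delta> powr (p - 1) * r) powr (1 / p)" using that p by (intro roof_le_roof_1)
    also have "\<dots> = \<epsilon>" using \<epsilon> p \<Delta>(1) by (simp add: r_def powr_powr)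
    finally show ?thesis .
  qed
  obtain w where w: "near (r / 2) w x" using near_exists[OF x, of "r / 2"] r by auto
  then obtain U where U: "open U" "x \<in> U" "\<And>y. y \<in> U \<inter> C \<Longrightarrow> R 1 w y < r"
    unfolding near_def using r by (metis field_sum_of_halves less_add_same_cancel1 half_gt_zero)
  have wC: "w \<in> C" using w by (simp add: near_def)
  have "R p x w \<le> \<epsilon> \<and> R p w y \<le> \<epsilon>" if "y \<in> U \<inter> C" for y
    using U(2,3) that x wC roof_sym[of x w 1] by (auto intro!: le)
  then show ?thesis using U(1,2) wC by blast
qed

section \<open>The metric envelope\<close>

text \<open>The chains of \<open>sub_roof\<close> together with their lengths, in inductive form, so
  that concatenation, reversal and length estimates go by rule induction;
  \<open>sub_roof_eq_Inf\<close> relates them to the indexed sums.\<close>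

inductive chain :: "real \<Rightarrow> 'a \<Rightarrow> 'a \<Rightarrow> real \<Rightarrow> bool" for p where
  single: "x \<in> C \<Longrightarrow> y \<in> C \<Longrightarrow> chain p x y (R p x y)"
| link: "x \<in> C \<Longrightarrow> y \<in> C \<Longrightarrow> chain p y z s \<Longrightarrow> chain p x z (R p x y + s)"

lemma sum_head_Suc: "(\<Sum>j=1..Suc N. f j) = f 1 + (\<Sum>j=1..N. f (j + 1) :: real)"
proof -
  have "(\<Sum>j=1..Suc N. f j) = f 1 + (\<Sum>j=Suc 1..Suc N. f j)" by (rule sum.atLeast_Suc_atMost) simp
  also have "(\<Sum>j=Suc 1..Suc N. f j) = (\<Sum>j=1..N. f (Suc j))" by (rule sum.shift_bounds_cl_Suc_ivl)
  finally show ?thesis by simp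
qed

lemma chain_points:
  assumes "chain p x y s"
  shows "\<exists>N z. N \<ge> 1 \<and> z 1 = x \<and> z (N + 1) = y \<and> (\<forall>j\<in>{1..N + 1}. z j \<in> C) \<and>
    s = (\<Sum>j=1..N::nat. R p (z j) (z (j + 1)))"
  using assms
proof induction
  case (single x y)
  then show ?case by (intro exI[of _ 1] exI[of _ "\<lambda>j. if j = 1 then x else y"]) auto
next
  case (link x y z s)
  then obtain N u where u: "N \<ge> 1" "u 1 = y" "u (N + 1) = z" "\<forall>j\<in>{1..N + 1}. u j \<in> C"
    "s = (\<Sum>j=1..N::nat. R p (u j) (u (j + 1)))" by blast
  \<comment> \<open>Indices start at 1, so the new point takes index 1 and the old points move up by
    one.\<close>
  let ?v = "\<lambda>j. if j = 1 then x else u (j - 1)"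
  have "(\<Sum>j=1..Suc N. R p (?v j) (?v (j + 1))) =
      R p x y + (\<Sum>j=1..N. R p (?v (j + 1)) (?v (j + 1 + 1)))"
    unfolding sum_head_Suc using u(2) by simp
  also have "(\<Sum>j=1..N. R p (?v (j + 1)) (?v (j + 1 + 1))) = s"
    unfolding u(5) by (intro sum.cong) auto
  finally have "R p x y + s = (\<Sum>j=1..Suc N. R p (?v j) (?v (j + 1)))" by simp
  moreover have "?v j \<in> C" if "j \<in> {1..Suc N + 1}" for j
  proof (cases "j = 1")
    case False
    then have "j - 1 \<in> {1..N + 1}" using that unfolding atLeastAtMost_iff by arith
    then show ?thesis using u(4) False by simp
  qed (use link(1) in simp)
  ultimately show ?case using u(1,3)
    by (intro exI[of _ "Suc N"] exI[of _ ?v]) auto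
qed

lemma points_chain:
  assumes "N \<ge> 1" "\<forall>j\<in>{1..N + 1}. z j \<in> C"
  shows "chain p (z 1) (z (N + 1)) (\<Sum>j=1..N::nat. R p (z j) (z (j + 1)))"
  using assms
proof (induction N arbitrary: z rule: nat_induct_at_least)
  case base
  then show ?case by (auto intro!: single)
next
  case (Suc N)
  have "chain p (z (1 + 1)) (z (N + 1 + 1)) (\<Sum>j=1..N. R p (z (j + 1)) (z (j + 1 + 1)))"
    using Suc.prems by (intro Suc.IH[of "\<lambda>j. z (j + 1)"]) auto
  then have "chain p (z 1) (z (N + 1 + 1)) (R p (z 1) (z (1 + 1)) + (\<Sum>j=1..N. R p (z (j + 1)) (z (j + 1 + 1))))"
    using Suc.prems by (intro link) auto
  also have "R p (z 1) (z (1 + 1)) + (\<Sum>j=1..N. R p (z (j + 1)) (z (j + 1 + 1))) =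
      (\<Sum>j=1..Suc N. R p (z j) (z (j + 1)))"
    using sum_head_Suc[of "\<lambda>j. R p (z j) (z (j + 1))" N] by simp
  finally show ?case by simp
qed

lemma chain_mem: "chain p x y s \<Longrightarrow> x \<in> C \<and> y \<in> C"
  by (induction rule: chain.induct) auto

lemma chain_nonneg: "chain p x y s \<Longrightarrow> 0 \<le> s"
  by (induction rule: chain.induct) (auto simp: roof_nonneg)

lemma chain_append: "chain p x y s \<Longrightarrow> chain p y z t \<Longrightarrow> chain p x z (s + t)"
proof (induction rule: chain.induct)
  case (link x y w s)
  then show ?case using chain.link[of x y p z "s + t"] by (simp add: add.assoc)
qed (auto intro: link)

lemma chain_reverse:
  assumes "chain p x y s" "p > 0" shows "chain p y x s"
  using assms(1)
proof (induction rule: chain.induct)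
  case (single x y)
  then show ?case using chain.single[of y x p] roof_sym[of x y p] assms(2) by simp
next
  case (link x y z s)
  have "chain p y x (R p x y)" using chain.single[of y x p] link roof_sym[of x y p] assms(2) by simp
  from chain_append[OF link.IH this] show ?case by (simp add: add.commute)
qed

lemma sub_roof_eq_Inf:
  assumes "x \<in> C" "y \<in> C" shows "sub_roof p C d x y = Inf {s. chain p x y s}"
proof -
  have "{\<Sum>j=1..N. R p (z j) (z (j + 1)) | (N::nat) (z::nat \<Rightarrow> 'a).
      N \<ge> 1 \<and> z 1 = x \<and> z (N + 1) = y \<and> (\<forall>j\<in>{1..N + 1}. z j \<in> C)} = {s. chain p x y s}"
    (is "?L = ?R")
  proof (intro antisym subsetI)
    fix s assume "s \<in> ?L"
    then obtain N :: nat and z where "s = (\<Sum>j=1..N. R p (z j) (z (j + 1)))" "N \<ge> 1" "z 1 = x"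
      "z (N + 1) = y" "\<forall>j\<in>{1..N + 1}. z j \<in> C" by blast
    then show "s \<in> ?R" using points_chain[of N z p] by simp
  next
    fix s assume "s \<in> ?R"
    then have "chain p x y s" by simp
    from chain_points[OF this] show "s \<in> ?L" by blast
  qed
  then show ?thesis using assms by (simp add: sub_roof_def)
qed

abbreviation D :: "real \<Rightarrow> 'a \<Rightarrow> 'a \<Rightarrow> real" where "D p \<equiv> sub_roof p C d"

lemma bdd_below_chain: "bdd_below {s. chain p x y s}"
  using chain_nonneg by (intro bdd_belowI[of _ 0]) auto

lemma D_le: "chain p x y s \<Longrightarrow> D p x y \<le> s"
  using chain_mem[of p x y s] cInf_lower[OF _ bdd_below_chain, of s p x y] by (simp add: sub_roof_eq_Inf)

lemma D_ge:
  assumes "x \<in> C" "y \<in> C" "\<And>s. chain p x y s \<Longrightarrow> c \<le> s" shows "c \<le> D p x y"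
  unfolding sub_roof_eq_Inf[OF assms(1,2)] using assms single[OF assms(1,2)]
  by (intro cInf_greatest) auto

lemma D_approx:
  assumes "x \<in> C" "y \<in> C" "e > 0" obtains s where "chain p x y s" "s < D p x y + e"
proof -
  have "{s. chain p x y s} \<noteq> {}" using single[OF assms(1,2)] by blast
  then show thesis
    using cInf_less_iff[OF _ bdd_below_chain, of p x y "D p x y + e"] assms that
    by (auto simp: sub_roof_eq_Inf)
qed

lemma D_le_roof: "x \<in> C \<Longrightarrow> y \<in> C \<Longrightarrow> D p x y \<le> R p x y"
  by (intro D_le single)

lemma D_nonneg: "0 \<le> D p x y"
proof (cases "x \<in> C \<and> y \<in> C")
  case True
  then show ?thesis using chain_nonneg by (intro D_ge) auto
next
  case False
  then show ?thesis by (auto simp: sub_roof_def)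
qed

lemma D_sym: assumes "p > 0" shows "D p x y = D p y x"
proof (cases "x \<in> C \<and> y \<in> C")
  case True
  then show ?thesis using assms by (intro antisym D_ge) (auto intro!: D_le chain_reverse)
next
  case False
  then show ?thesis by (auto simp: sub_roof_def)
qed

lemma D_triangle:
  assumes "x \<in> C" "y \<in> C" "z \<in> C" shows "D p x z \<le> D p x y + D p y z"
proof (rule field_le_epsilon)
  fix e :: real assume e: "e > 0"
  obtain s where s: "chain p x y s" "s < D p x y + e/2" using D_approx[OF assms(1,2), of "e/2"] e by auto
  obtain t where t: "chain p y z t" "t < D p y z + e/2" using D_approx[OF assms(2,3), of "e/2"] e by auto
  show "D p x z \<le> D p x y + D p y z + e" using D_le[OF chain_append[OF s(1) t(1)]] s(2) t(2) by simp
qed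

lemma D_refl: "x \<in> C \<Longrightarrow> p > 0 \<Longrightarrow> D p x x = 0"
  using D_le_roof[of x x p] roof_refl[of x p] D_nonneg[of p x x] by simp

lemma D_mono_exponent:
  assumes "0 < p" "p \<le> q" "x \<in> C" "y \<in> C" shows "D p x y \<le> D q x y"
proof (rule D_ge[OF assms(3,4)])
  have "\<exists>t\<le>s. chain p x y t" if "chain q x y s" for x y s
    using that
  proof (induction rule: chain.induct)
    case (single x y)
    then show ?case using roof_mono_exponent[OF single assms(1,2)] chain.single by blast
  next
    case (link x y z s)
    then obtain t where t: "t \<le> s" "chain p y z t" by blast
    show ?case
      using chain.link[OF link(1,2) t(2)] roof_mono_exponent[OF link(1,2) assms(1,2)] t(1)
      by (intro exI[of _ "R p x y + t"]) auto
  qed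
  then show "D p x y \<le> s" if "chain q x y s" for s using that D_le by (meson order_trans)
qed

text \<open>A Lipschitz bound for the roof telescopes along chains and so passes to the
  envelope.\<close>

lemma D_1_ge_difference:
  assumes f: "\<And>u v. u \<in> C \<Longrightarrow> v \<in> C \<Longrightarrow> \<bar>f u - f v\<bar> \<le> R 1 u v" and xy: "x \<in> C" "y \<in> C"
  shows "\<bar>f x - f y\<bar> \<le> D 1 x y"
proof (rule D_ge[OF xy])
  show "\<bar>f x - f y\<bar> \<le> s" if "chain 1 x y s" for s
    using that
  proof (induction rule: chain.induct)
    case (link x y z s)
    then show ?case using f[of x y] by linarith
  qed (rule f)
qed

lemma D_nhd:
  assumes "x \<in> C" "p \<ge> 1" "\<epsilon> > 0"
  shows "\<exists>U. open U \<and> x \<in> U \<and> (\<forall>y\<in>U \<inter> C. D p x y < \<epsilon>)"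
proof -
  \<comment> \<open>Thirds leave room for a strict inequality after adding the two weak
    ones.\<close>
  obtain U where U: "open U" "x \<in> U"
    "\<And>y. y \<in> U \<inter> C \<Longrightarrow> \<exists>w\<in>C. R p x w \<le> \<epsilon>/3 \<and> R p w y \<le> \<epsilon>/3"
    using roof_nhd[OF assms(1,2), of "\<epsilon>/3"] assms(3) by auto
  have "D p x y < \<epsilon>" if y: "y \<in> U \<inter> C" for y
  proof -
    obtain w where w: "w \<in> C" "R p x w \<le> \<epsilon>/3" "R p w y \<le> \<epsilon>/3" using U(3)[OF y] by blast
    have "D p x y \<le> D p x w + D p w y" using assms(1) w(1) y by (intro D_triangle) auto
    also have "\<dots> \<le> \<epsilon>/3 + \<epsilon>/3"
      using w y assms(1) D_le_roof[of x w p] D_le_roof[of w y p] by auto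
    finally show ?thesis using assms(3) by simp
  qed
  then show ?thesis using U(1,2) by blast
qed

lemma continuous_on_D:
  assumes "p \<ge> 1" shows "continuous_on (C \<times> C) (\<lambda>(x, y). D p x y)"
proof (rule real_continuous_onI_nhd)
  fix u and e :: real assume u: "u \<in> C \<times> C" and e: "e > 0"
  obtain x y where xy: "u = (x, y)" "x \<in> C" "y \<in> C" using u by auto
  obtain U where U: "open U" "x \<in> U" "\<And>z. z \<in> U \<inter> C \<Longrightarrow> D p x z < e/2"
    using D_nhd[OF xy(2) assms, of "e/2"] e by auto
  obtain V where V: "open V" "y \<in> V" "\<And>z. z \<in> V \<inter> C \<Longrightarrow> D p y z < e/2"
    using D_nhd[OF xy(3) assms, of "e/2"] e by auto
  have "\<bar>D p x' y' - D p x y\<bar> \<le> e" if m: "x' \<in> C" "x' \<in> U" "y' \<in> C" "y' \<in> V" for x' y'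
    using D_triangle[of x' x y' p] D_triangle[of x y y' p] D_triangle[of x x' y p] D_triangle[of x' y' y p]
      U(3)[of x'] V(3)[of y'] D_sym[of p x x'] D_sym[of p y y'] m xy assms by auto
  then show "\<exists>T. open T \<and> u \<in> T \<and> (\<forall>v\<in>C \<times> C \<inter> T. \<bar>(case v of (x, y) \<Rightarrow> D p x y) - (case u of (x, y) \<Rightarrow> D p x y)\<bar> \<le> e)"
    using U V xy by (intro exI[of _ "U \<times> V"]) (auto simp: open_Times)
qed

end

section \<open>Definiteness and topology of the envelope\<close>

locale separated_stable_roof = stable_roof +
  assumes separated: "\<forall>x\<in>C. \<forall>y\<in>C. x \<noteq> y \<longrightarrow> (\<exists>a\<in>A_Lip d C. a x \<noteq> a y)"
begin

text \<open>Separation enters through definiteness: a member of \<open>A_Lip\<close> that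
  distinguishes \<open>x\<close> and \<open>y\<close> bounds \<open>D 1 x y\<close> away from 0, and
  \<open>D 1 \<le> D p\<close>.\<close>

lemma Metric_space_D:
  assumes p: "p \<ge> 1" shows "Metric_space C (D p)"
proof
  show "0 \<le> D p x y" for x y by (rule D_nonneg)
  show "D p x y = D p y x" for x y using p by (intro D_sym) auto
  show "D p x z \<le> D p x y + D p y z" if "x \<in> C" "y \<in> C" "z \<in> C" for x y z using that by (rule D_triangle)
  show "D p x y = 0 \<longleftrightarrow> x = y" if xy: "x \<in> C" "y \<in> C" for x y
  proof
    assume 0: "D p x y = 0"
    show "x = y"
    proof (rule ccontr)
      assume "x \<noteq> y"
      then obtain a where a: "a \<in> A_Lip d C" "a x \<noteq> a y" using separated xy by blast
      have "\<bar>a x - a y\<bar> \<le> D 1 x y" using xy Lipschitz_le_roof_1[OF _ _ a(1)] by (intro D_1_ge_difference)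
      also have "\<dots> \<le> D p x y" using p xy by (intro D_mono_exponent) auto
      finally show False using 0 a(2) by simp
    qed
  qed (use D_refl p xy in auto)
qed

lemma mtopology_D:
  assumes p: "p \<ge> 1" shows "Metric_space.mtopology C (D p) = top_of_set C"
proof -
  interpret M: Metric_space C "D p" using p by (rule Metric_space_D)
  have op: "openin (top_of_set C) S" if oS: "openin M.mtopology S" for S
  proof (subst openin_subopen, intro ballI)
    fix x assume x: "x \<in> S"
    have SC: "S \<subseteq> C" using openin_subset[OF oS] by simp
    obtain r where r: "r > 0" "M.mball x r \<subseteq> S"
      using oS x unfolding M.openin_mtopology by blast
    have xC: "x \<in> C" using x SC by blast
    obtain U where U: "open U" "x \<in> U" "\<And>y. y \<in> U \<inter> C \<Longrightarrow> D p x y < r"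
      using D_nhd[OF xC p r(1)] by blast
    have "C \<inter> U \<subseteq> M.mball x r" using U(3) xC by auto
    then show "\<exists>T. openin (top_of_set C) T \<and> x \<in> T \<and> T \<subseteq> S"
      using U(1,2) xC r(2) openin_open_Int[OF U(1), of C] by (intro exI[of _ "C \<inter> U"]) auto
  qed
  have cm: "continuous_map (top_of_set C) M.mtopology id"
    unfolding continuous_map_def
  proof (intro conjI allI impI)
    fix S assume S: "openin M.mtopology S"
    have "{x \<in> topspace (top_of_set C). id x \<in> S} = S" using openin_subset[OF S] by auto
    then show "openin (top_of_set C) {x \<in> topspace (top_of_set C). id x \<in> S}" using op[OF S] by simp
  qed auto
  have "openin M.mtopology S" if S: "openin (top_of_set C) S" for S
  proof -
    have SC: "S \<subseteq> C" using openin_subset[OF S] by simp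
    have "closedin (top_of_set C) (C - S)" using S by (simp add: closedin_def SC double_diff)
    then have "compactin (top_of_set C) (C - S)"
      using compact_C by (intro closedin_compact_space) (auto simp: compact_space_subtopology)
    \<comment> \<open>A relatively closed part of \<open>C\<close> is compact, so its image under
      the continuous identity is compact and therefore closed in the Hausdorff topology of
      \<open>D p\<close>.\<close>
    from image_compactin[OF this cm] have "compactin M.mtopology (C - S)" by simp
    then have "closedin M.mtopology (C - S)" by (intro compactin_imp_closedin M.Hausdorff_space_mtopology)
    then show ?thesis using SC by (simp add: closedin_def double_diff)
  qed
  then show ?thesis using op by (intro topology_eq[THEN iffD2]) blast
qed

end

section \<open>Geodesics\<close>

text \<open>A share \<open>x / (a + b)\<close> lies in \<open>[0, 1]\<close> and does not grow under
  the power \<open>p\<close>. The inequality serves to take an error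
  \<open>\<epsilon> powr p\<close> out of a p-th root as \<open>\<epsilon>\<close>.\<close>

lemma add_powr_le:
  assumes "0 \<le> a" "0 \<le> b" "(1::real) \<le> p" shows "a powr p + b powr p \<le> (a + b) powr p"
proof (cases "a + b = 0")
  case True
  then show ?thesis using assms by (simp add: add_nonneg_eq_0_iff)
next
  case False
  then have c: "a + b > 0" using assms by simp
  have le: "x powr p \<le> (x / (a + b)) * (a + b) powr p" if "0 \<le> x" "x \<le> a + b" for x
  proof -
    have "x powr p = (x / (a + b)) powr p * (a + b) powr p"
      using that c by (simp add: powr_divide)
    also have "(x / (a + b)) powr p \<le> (x / (a + b)) powr 1"
      using that c assms by (intro powr_mono') auto
    finally show ?thesis using that c by (simp add: mult_right_mono)
  qed
  have "a powr p + b powr p \<le> (a / (a + b) + b / (a + b)) * (a + b) powr p"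
    using le[of a] le[of b] assms by (simp add: distrib_right)
  also have "a / (a + b) + b / (a + b) = 1" using c by (simp flip: add_divide_distrib)
  finally show ?thesis by simp
qed

text \<open>Uniform continuity of the power on a compact interval, lengthened by 1 to make room for
  \<open>u + \<delta>\<close>. The error has the form \<open>\<epsilon> powr p\<close> to fit
  \<open>add_powr_le\<close>.\<close>

lemma powr_shift:
  assumes "(0::real) \<le> B" "0 < \<epsilon>" "1 \<le> p"
  shows "\<exists>\<delta>>0. \<forall>u\<in>{0..B}. (u + \<delta>) powr p \<le> u powr p + \<epsilon> powr p"
proof -
  have "continuous_on {0..B + 1} (\<lambda>u::real. u powr p)"
    using assms by (intro continuous_on_powr' continuous_intros) auto
  then have "uniformly_continuous_on {0..B + 1} (\<lambda>u::real. u powr p)"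
    by (rule compact_uniformly_continuous) simp
  moreover have "\<epsilon> powr p > 0" using assms by simp
  ultimately obtain \<delta> where \<delta>: "\<delta> > 0"
    "\<And>u v. u \<in> {0..B + 1} \<Longrightarrow> v \<in> {0..B + 1} \<Longrightarrow> dist v u < \<delta> \<Longrightarrow> dist (v powr p) (u powr p) < \<epsilon> powr p"
    unfolding uniformly_continuous_on_def by metis
  define \<delta>' where "\<delta>' = min 1 (\<delta> / 2)"
  have \<delta>': "\<delta>' > 0" "\<delta>' \<le> 1" "\<delta>' < \<delta>" using \<delta>(1) by (auto simp: \<delta>'_def)
  have "(u + \<delta>') powr p \<le> u powr p + \<epsilon> powr p" if "u \<in> {0..B}" for u
    using \<delta>(2)[of u "u + \<delta>'"] that \<delta>' by (auto simp: dist_real_def)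
  then show ?thesis using \<delta>'(1) by blast
qed

context stable_roof
begin

text \<open>The point dividing the straight segment in the ratio \<open>a : b\<close> works, since
  joint convexity of \<open>R 1\<close> can be applied with one argument held fixed. If
  \<open>a + b = 0\<close>, the point \<open>x\<close> itself works.\<close>

lemma link_interpolation_roof_1:
  assumes xy: "x \<in> C" "y \<in> C" and ab: "0 \<le> a" "0 \<le> b" "a + b = R 1 x y"
  shows "\<exists>m\<in>C. R 1 x m \<le> a \<and> R 1 m y \<le> b"
proof (cases "a + b = 0")
  case True
  then have "a = 0" "b = 0" using ab by linarith+
  then show ?thesis using roof_refl[OF xy(1), of 1] xy ab by (intro bexI[of _ x]) auto
next
  case False
  then have pos: "a + b > 0" using ab by simp
  define t where "t = a / (a + b)"
  have t: "0 \<le> t" "t \<le> 1" "t * (a + b) = a" "(1 - t) * (a + b) = b"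
    using ab(1,2) pos by (auto simp: t_def field_simps)
  let ?m = "(1 - t) *\<^sub>R x + t *\<^sub>R y"
  have "R 1 ((1 - t) *\<^sub>R x + t *\<^sub>R x) ?m \<le> (1 - t) * R 1 x x + t * R 1 x y"
    using xy t by (intro roof_1_convex)
  then have "R 1 x ?m \<le> a"
    using t(3) roof_refl[OF xy(1), of 1] ab(3) by (simp flip: scaleR_add_left)
  moreover have "R 1 ?m ((1 - t) *\<^sub>R y + t *\<^sub>R y) \<le> (1 - t) * R 1 x y + t * R 1 y y"
    using xy t by (intro roof_1_convex)
  then have "R 1 ?m y \<le> b"
    using t(4) roof_refl[OF xy(2), of 1] ab(3) by (simp flip: scaleR_add_left)
  ultimately show ?thesis using convex_combination_mem[OF xy t(1,2)] by blast
qed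

text \<open>A Minkowski inequality with a constant error: the shift by \<open>\<delta>\<close> under
  the power costs \<open>\<epsilon> powr p\<close>, which \<open>add_powr_le\<close> takes out of
  the root. The bound \<open>c \<le> 1\<close> keeps \<open>c * d z w\<close> in the interval where
  \<open>\<delta>\<close> is admissible.\<close>

lemma roof_le_perturbed:
  assumes \<pi>: "\<pi> \<in> couplings C x y" and \<zeta>: "represents \<pi> \<zeta> x'" and \<xi>: "represents \<pi> \<xi> y'" and p: "p \<ge> 1"
    and c: "0 \<le> c" "c \<le> 1" and \<epsilon>: "\<epsilon> > 0"
    and \<delta>: "\<And>u. u \<in> {0..\<Delta>} \<Longrightarrow> (u + \<delta>) powr p \<le> u powr p + \<epsilon> powr p"
    and le: "\<And>z w. z \<in> E \<Longrightarrow> w \<in> E \<Longrightarrow> d (\<zeta> (z, w)) (\<xi> (z, w)) \<le> c * d z w + \<delta>"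
  shows "R p x' y' \<le> c * cost p \<pi> powr (1 / p) + \<epsilon>"
proof -
  note D = couplingD[OF \<pi>]
  interpret prob_space \<pi> by (rule D)
  let ?I = "cost p \<pi>"
  have p0: "p > 0" using p by simp
  have I0: "?I \<ge> 0" by (rule cost_nonneg)
  have "d (\<zeta> (z, w)) (\<xi> (z, w)) powr p \<le> c powr p * d z w powr p + \<epsilon> powr p"
    if zw: "z \<in> E" "w \<in> E" for z w
  proof -
    have "c * d z w \<le> 1 * d z w" using c d_nonneg by (intro mult_right_mono) auto
    then have cd: "c * d z w \<in> {0..\<Delta>}" using c d_nonneg[of z w] \<Delta>(2)[OF zw] by simp
    have "d (\<zeta> (z, w)) (\<xi> (z, w)) powr p \<le> (c * d z w + \<delta>) powr p"
      using le[OF zw] d_nonneg p by (intro powr_mono2) auto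
    also have "\<dots> \<le> (c * d z w) powr p + \<epsilon> powr p" using \<delta>[OF cd] .
    finally show ?thesis using c d_nonneg by (simp add: powr_mult)
  qed
  then have "(\<integral>u. d (\<zeta> u) (\<xi> u) powr p \<partial>\<pi>) \<le> (\<integral>u. c powr p * d (fst u) (snd u) powr p + \<epsilon> powr p \<partial>\<pi>)"
    using D(3) by (intro integral_mono integrable_cost[OF D(1) \<zeta> \<xi> p0] Bochner_Integration.integrable_add
        integrable_mult_right integrable_cost[OF D(1,4,5) p0]) auto
  also have "\<dots> = c powr p * ?I + \<epsilon> powr p"
    using integrable_cost[OF D(1,4,5) p0] by (simp add: prob_space)
  also have "\<dots> = (c * ?I powr (1 / p)) powr p + \<epsilon> powr p"
    using I0 c p by (simp add: powr_mult powr_powr)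
  also have "\<dots> \<le> (c * ?I powr (1 / p) + \<epsilon>) powr p"
    using c \<epsilon> p by (intro add_powr_le) auto
  finally have "(\<integral>u. d (\<zeta> u) (\<xi> u) powr p \<partial>\<pi>) powr (1 / p) \<le> ((c * ?I powr (1 / p) + \<epsilon>) powr p) powr (1 / p)"
    using p cost_nonneg by (intro powr_mono2) auto
  also have "\<dots> = c * ?I powr (1 / p) + \<epsilon>" using p c \<epsilon> by (simp add: powr_powr)
  finally show ?thesis using roof_le[OF D(1) \<zeta> \<xi> p0] by simp
qed

lemma selector_near:
  assumes \<delta>: "\<delta> > 0"
  obtains r where "simple_function (restrict_space borel (E \<times> E)) r"
    "\<And>z w. z \<in> E \<Longrightarrow> w \<in> E \<Longrightarrow>
      fst (r (z, w)) \<in> E \<and> snd (r (z, w)) \<in> E \<and> d (fst (r (z, w))) z < \<delta> \<and> d (snd (r (z, w))) w < \<delta>"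
proof -
  have "\<forall>e\<in>E. \<exists>U. open U \<and> e \<in> U \<and> (\<forall>z\<in>U \<inter> E. d e z < \<delta>)" using d_nhd \<delta> by blast
  then obtain U where U: "\<And>e. e \<in> E \<Longrightarrow> open (U e) \<and> e \<in> U e \<and> (\<forall>z\<in>U e \<inter> E. d e z < \<delta>)"
    by metis
  have "open (U (fst s) \<times> U (snd s)) \<and> s \<in> U (fst s) \<times> U (snd s)" if "s \<in> E \<times> E" for s
    using U[of "fst s"] U[of "snd s"] that by (cases s) (auto intro: open_Times)
  then obtain r where r: "simple_function (restrict_space borel (E \<times> E)) r"
    "\<And>s. s \<in> E \<times> E \<Longrightarrow> r s \<in> E \<times> E \<and> s \<in> U (fst (r s)) \<times> U (snd (r s))"
    using compact_simple_selector[OF compact_Times[OF compact_Ext compact_Ext], of "\<lambda>s. U (fst s) \<times> U (snd s)"]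
    by metis
  show thesis
  proof (rule that[OF r(1)])
    fix z w assume "z \<in> E" "w \<in> E"
    then have "r (z, w) \<in> E \<times> E" "(z, w) \<in> U (fst (r (z, w))) \<times> U (snd (r (z, w)))"
      using r(2)[of "(z, w)"] by auto
    then show "fst (r (z, w)) \<in> E \<and> snd (r (z, w)) \<in> E \<and> d (fst (r (z, w))) z < \<delta> \<and> d (snd (r (z, w))) w < \<delta>"
      using U \<open>z \<in> E\<close> \<open>w \<in> E\<close> by (auto simp: mem_Times_iff)
  qed
qed

text \<open>A measurable selection of geodesics is avoided: pairs of extreme points are first moved to finitely
  many pairs, at the price of the additive errors.\<close>

lemma link_interpolation_roof:
  assumes geo: "geodesic_space E d" and xy: "x \<in> C" "y \<in> C" and p: "p \<ge> 1"
    and ab: "0 \<le> a" "0 \<le> b" "a + b = R p x y" and \<epsilon>: "\<epsilon> > 0"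
  shows "\<exists>m\<in>C. R p x m \<le> a + \<epsilon> \<and> R p m y \<le> b + \<epsilon>"
proof -
  interpret Metric_space "E" d by (rule metric_d)
  have p0: "p > 0" using p by simp
  define t where "t = (if a + b = 0 then 0 else a / (a + b))"
  have t: "0 \<le> t" "t \<le> 1" "t * (a + b) = a" "(1 - t) * (a + b) = b"
    using ab(1,2) by (auto simp: t_def field_simps add_nonneg_eq_0_iff)
  obtain \<delta> where \<delta>: "\<delta> > 0" "\<And>u. u \<in> {0..\<Delta>} \<Longrightarrow> (u + \<delta>) powr p \<le> u powr p + (\<epsilon>/2) powr p"
    using powr_shift[of \<Delta> "\<epsilon>/2" p] \<Delta>(1) \<epsilon> p by auto
  obtain r where r: "simple_function (restrict_space borel (E \<times> E)) r"
    and rE: "\<And>z w. z \<in> E \<Longrightarrow> w \<in> E \<Longrightarrow>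
      fst (r (z, w)) \<in> E \<and> snd (r (z, w)) \<in> E \<and> d (fst (r (z, w))) z < \<delta>/3 \<and> d (snd (r (z, w))) w < \<delta>/3"
    using selector_near[of "\<delta>/3"] \<delta>(1) by auto
  have "\<forall>z\<in>E. \<forall>w\<in>E. \<exists>g. g \<in> E \<and> d z g = t * d z w \<and> d g w = (1 - t) * d z w"
  proof (intro ballI)
    fix z w assume "z \<in> E" "w \<in> E"
    then obtain \<gamma> :: "real \<Rightarrow> 'a" where \<gamma>: "\<gamma> 0 = z" "\<gamma> 1 = w" "\<forall>t\<in>{0..1}. \<gamma> t \<in> E"
      "\<forall>s\<in>{0..1}. \<forall>t\<in>{0..1}. d (\<gamma> s) (\<gamma> t) = \<bar>t - s\<bar> * d (\<gamma> 0) (\<gamma> 1)"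
      using geo unfolding geodesic_space_def by blast
    then show "\<exists>g. g \<in> E \<and> d z g = t * d z w \<and> d g w = (1 - t) * d z w"
      using t(1,2) bspec[OF bspec[OF \<gamma>(4), of 0], of t] bspec[OF bspec[OF \<gamma>(4), of t], of 1]
      by (intro exI[of _ "\<gamma> t"]) auto
  qed
  then obtain g where g: "\<And>z w. z \<in> E \<Longrightarrow> w \<in> E \<Longrightarrow>
      g z w \<in> E \<and> d z (g z w) = t * d z w \<and> d (g z w) w = (1 - t) * d z w" by metis
  \<comment> \<open>The point at time \<open>t\<close> on a geodesic between the selected pair. Only
    finitely many values occur, so measurability is automatic and the barycentre \<open>m\<close> is
    a finite combination of points of \<open>Ext C\<close>.\<close>
  define \<mu> where "\<mu> u = g (fst (r u)) (snd (r u))" for u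
  have \<mu>E: "\<mu> (z, w) \<in> E" if "z \<in> E" "w \<in> E" for z w
    using rE[OF that] g by (auto simp: \<mu>_def)
  have \<mu>d: "d z (\<mu> (z, w)) \<le> t * d z w + \<delta>" "d (\<mu> (z, w)) w \<le> (1 - t) * d z w + \<delta>"
    if zw: "z \<in> E" "w \<in> E" for z w
  proof -
    let ?a = "fst (r (z, w))" and ?b = "snd (r (z, w))"
    have ab: "?a \<in> E" "?b \<in> E" "d ?a z < \<delta>/3" "d ?b w < \<delta>/3" using rE[OF zw] by auto
    have gab: "d ?a (\<mu> (z, w)) = t * d ?a ?b" "d (\<mu> (z, w)) ?b = (1 - t) * d ?a ?b"
      using g[OF ab(1,2)] by (auto simp: \<mu>_def)
    have "d ?a ?b \<le> d ?a z + (d z w + d w ?b)"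
      using triangle[OF ab(1) zw(1) ab(2)] triangle[OF zw ab(2)] by linarith
    \<comment> \<open>Moving both ends of the pair costs two thirds of \<open>\<delta>\<close>;
      returning from the selected end to \<open>z\<close> or to \<open>w\<close> costs the last
      third.\<close>
    then have dab: "d ?a ?b \<le> d z w + 2 * \<delta>/3" using ab d_sym[of w ?b] by linarith
    have "t * d ?a ?b \<le> t * (d z w + 2 * \<delta>/3)" "(1 - t) * d ?a ?b \<le> (1 - t) * (d z w + 2 * \<delta>/3)"
      using dab t by (intro mult_left_mono; simp)+
    moreover have "t * (2 * \<delta>/3) \<le> 2 * \<delta>/3" "(1 - t) * (2 * \<delta>/3) \<le> 2 * \<delta>/3"
      using t \<delta>(1) by (auto intro!: mult_left_le_one_le)
    ultimately have "t * d ?a ?b \<le> t * d z w + 2 * \<delta>/3" "(1 - t) * d ?a ?b \<le> (1 - t) * d z w + 2 * \<delta>/3"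
      unfolding distrib_left by linarith+
    moreover have "d z (\<mu> (z, w)) \<le> d z ?a + d ?a (\<mu> (z, w))" "d (\<mu> (z, w)) w \<le> d (\<mu> (z, w)) ?b + d ?b w"
      using triangle zw ab \<mu>E[OF zw] by auto
    ultimately show "d z (\<mu> (z, w)) \<le> t * d z w + \<delta>" "d (\<mu> (z, w)) w \<le> (1 - t) * d z w + \<delta>"
      using gab ab(3,4) d_sym[of z ?a] by linarith+
  qed
  obtain \<pi> where \<pi>: "\<pi> \<in> couplings C x y"
    "cost p \<pi> powr (1 / p) < R p x y + \<epsilon>/2"
    using roof_approx[OF xy p0, of "\<epsilon>/2"] \<epsilon> by auto
  note D = couplingD[OF \<pi>(1)]
  interpret P: prob_space \<pi> by (rule D)
  let ?I = "cost p \<pi> powr (1 / p)"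
  have r\<pi>: "simple_function \<pi> r"
    using r sets_eq_imp_space_eq[OF D(2)] by (simp add: simple_function_def D(2))
  then have s\<mu>: "simple_function \<pi> \<mu>" unfolding \<mu>_def by (rule simple_function_compose1)
  have \<mu>E': "\<mu> ` space \<pi> \<subseteq> E" using \<mu>E unfolding D(3) by auto
  obtain m where m: "m \<in> C" "\<And>f. linear f \<Longrightarrow> (\<integral>u. f (\<mu> u) \<partial>\<pi>) = (f m :: real)"
    using P.simple_barycentre_exists[OF s\<mu> convex_C] \<mu>E' Ext_subset by blast
  have "\<mu> \<in> measurable \<pi> borel"
    using measurable_compose[OF measurable_simple_function[OF s\<mu>], of "\<lambda>v. v" borel] by simp
  then have "\<mu> \<in> measurable \<pi> (restrict_space borel E)"
    using \<mu>E' by (intro measurable_restrict_space2) auto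
  then have rep: "represents \<pi> \<mu> m" using m(2) dual_space_linear by (auto simp: represents_def)
  have "R p x m \<le> t * ?I + \<epsilon>/2"
    using \<mu>d(1) \<epsilon> by (intro roof_le_perturbed[OF \<pi>(1) D(4) rep p t(1,2) _ \<delta>(2)]) auto
  moreover have "R p m y \<le> (1 - t) * ?I + \<epsilon>/2"
    using \<mu>d(2) \<epsilon> t by (intro roof_le_perturbed[OF \<pi>(1) rep D(5) p _ _ _ \<delta>(2)]) auto
  moreover have "t * ?I \<le> t * (a + b + \<epsilon>/2)" "(1 - t) * ?I \<le> (1 - t) * (a + b + \<epsilon>/2)"
    using \<pi>(2) t ab(3) by (intro mult_left_mono; simp)+
  moreover have "t * (\<epsilon>/2) \<le> \<epsilon>/2" "(1 - t) * (\<epsilon>/2) \<le> \<epsilon>/2"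
    using t \<epsilon> by (auto intro!: mult_left_le_one_le)
  ultimately have "R p x m \<le> a + \<epsilon>" "R p m y \<le> b + \<epsilon>"
    using t(3,4) unfolding distrib_left by linarith+
  then show ?thesis using m(1) by blast
qed

text \<open>Everything that the construction of geodesics uses about single links. The additive
  error is allowed because for \<open>p > 1\<close> the links are interpolated only
  approximately.\<close>

definition interpolating :: "real \<Rightarrow> bool" where
  "interpolating p \<longleftrightarrow> (\<forall>x\<in>C. \<forall>y\<in>C. \<forall>a\<ge>0. \<forall>b\<ge>0. \<forall>\<epsilon>>0. a + b = R p x y \<longrightarrow>
     (\<exists>m\<in>C. R p x m \<le> a + \<epsilon> \<and> R p m y \<le> b + \<epsilon>))"

lemma interpolatingD:
  "\<lbrakk>interpolating p; x \<in> C; y \<in> C; 0 \<le> a; 0 \<le> b; 0 < \<epsilon>; a + b = R p x y\<rbrakk> \<Longrightarrow>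
    \<exists>m\<in>C. R p x m \<le> a + \<epsilon> \<and> R p m y \<le> b + \<epsilon>"
  unfolding interpolating_def by blast

text \<open>The chain is followed until the length \<open>a\<close> is used up, and only the link
  where this happens is interpolated. So \<open>\<epsilon>\<close> is paid once, whatever the number
  of links.\<close>

lemma chain_interpolation:
  assumes link: "interpolating p"
    and "chain p x y s" "0 \<le> a" "0 \<le> b" "a + b = s" "0 < \<epsilon>"
  shows "\<exists>m\<in>C. D p x m \<le> a + \<epsilon> \<and> D p m y \<le> b + \<epsilon>"
  using assms(2-)
proof (induction arbitrary: a b rule: chain.induct)
  case (single x y)
  obtain m where "m \<in> C" "R p x m \<le> a + \<epsilon>" "R p m y \<le> b + \<epsilon>"
    using interpolatingD[OF assms(1) single.hyps single.prems(1,2,4,3)] by blast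
  then show ?case using D_le_roof[of x m p] D_le_roof[of m y p] single by (intro bexI[of _ m]) auto
next
  case (link x y z s)
  have zC: "z \<in> C" using chain_mem[OF link.hyps(3)] by simp
  show ?case
  proof (cases "a \<le> R p x y")
    case True
    obtain m where m: "m \<in> C" "R p x m \<le> a + \<epsilon>" "R p m y \<le> R p x y - a + \<epsilon>"
      using interpolatingD[OF assms(1) link.hyps(1,2), of a "R p x y - a" \<epsilon>] link.prems True by auto
    have "D p m z \<le> D p m y + D p y z" using m(1) link.hyps(2) zC by (intro D_triangle)
    also have "\<dots> \<le> (R p x y - a + \<epsilon>) + s"
      using D_le[OF link.hyps(3)] D_le_roof[OF m(1) link.hyps(2), of p] m(3) by linarith
    finally have "D p m z \<le> b + \<epsilon>" using link.prems by simp
    then show ?thesis using m D_le_roof[OF link.hyps(1) m(1), of p] by (intro bexI[of _ m]) auto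
  next
    case False
    obtain m where m: "m \<in> C" "D p y m \<le> a - R p x y + \<epsilon>" "D p m z \<le> b + \<epsilon>"
      using link.IH[of "a - R p x y" b] link.prems False by auto
    have "D p x m \<le> D p x y + D p y m" using m(1) link.hyps by (intro D_triangle)
    also have "\<dots> \<le> R p x y + (a - R p x y + \<epsilon>)"
      using m(2) D_le_roof[OF link.hyps(1,2), of p] by linarith
    finally show ?thesis using m by (intro bexI[of _ m]) auto
  qed
qed

lemma continuous_on_D_left:
  assumes "p \<ge> 1" "x \<in> C" shows "continuous_on C (D p x)" "continuous_on C (\<lambda>y. D p y x)"
proof -
  have "continuous_on C (\<lambda>y. (x, y))" "continuous_on C (\<lambda>y. (y, x))" by (intro continuous_intros)+
  then show "continuous_on C (D p x)" "continuous_on C (\<lambda>y. D p y x)"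
    using continuous_on_compose2[OF continuous_on_D[OF assms(1)], of C "\<lambda>y. (x, y)"]
      continuous_on_compose2[OF continuous_on_D[OF assms(1)], of C "\<lambda>y. (y, x)"] assms(2) by auto
qed

text \<open>The approximate solutions form nonempty closed subsets of \<open>C\<close> that shrink
  with \<open>\<epsilon>\<close>; by compactness they have a common point, which solves the problem
  without error.\<close>

lemma D_interpolation:
  assumes link: "interpolating p"
    and p: "p \<ge> 1" and xy: "x \<in> C" "y \<in> C" and ab: "0 \<le> a" "0 \<le> b" "a + b = D p x y"
  shows "\<exists>m\<in>C. D p x m \<le> a \<and> D p m y \<le> b"
proof -
  have approx: "\<exists>m\<in>C. D p x m \<le> a + \<epsilon> \<and> D p m y \<le> b + \<epsilon>" if \<epsilon>: "\<epsilon> > 0" for \<epsilon>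
  proof -
    obtain s where s: "chain p x y s" "s < D p x y + \<epsilon>/2" using D_approx[OF xy, of "\<epsilon>/2"] \<epsilon> by auto
    have Ds: "D p x y \<le> s" using s(1) by (rule D_le)
    \<comment> \<open>The excess of the chain length over the distance is charged to the first
      part.\<close>
    obtain m where m: "m \<in> C" "D p x m \<le> a + (s - D p x y) + \<epsilon>/2" "D p m y \<le> b + \<epsilon>/2"
      using chain_interpolation[OF link s(1), of "a + (s - D p x y)" b "\<epsilon>/2"] ab Ds \<epsilon> by auto
    then show ?thesis using s(2) \<epsilon> by (intro bexI[of _ m]) auto
  qed
  let ?S = "\<lambda>\<epsilon>. {m \<in> C. D p x m \<le> a + \<epsilon>} \<inter> {m \<in> C. D p m y \<le> b + \<epsilon>}"
  have "C \<inter> (\<Inter>\<epsilon>\<in>{0<..}. ?S \<epsilon>) \<noteq> {}"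
  proof (rule compact_imp_fip_image[OF compact_C])
    fix \<epsilon> :: real
    have "{m \<in> C. D p x m \<le> a + \<epsilon>} = C \<inter> D p x -` {..a + \<epsilon>}"
      "{m \<in> C. D p m y \<le> b + \<epsilon>} = C \<inter> (\<lambda>m. D p m y) -` {..b + \<epsilon>}" by auto
    then show "closed (?S \<epsilon>)"
      using continuous_closed_preimage[OF continuous_on_D_left(1)[OF p xy(1)] compact_imp_closed[OF compact_C], of "{..a + \<epsilon>}"]
        continuous_closed_preimage[OF continuous_on_D_left(2)[OF p xy(2)] compact_imp_closed[OF compact_C], of "{..b + \<epsilon>}"]
      by auto
  next
    fix I :: "real set" assume I: "finite I" "I \<subseteq> {0<..}"
    \<comment> \<open>The inserted 1 covers an empty \<open>I\<close>; the sets increase with the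
      error, so the smallest error serves the whole family.\<close>
    define \<epsilon> where "\<epsilon> = Min (insert 1 I)"
    have "\<epsilon> > 0" unfolding \<epsilon>_def using I by (subst Min_gr_iff) auto
    moreover have "\<epsilon> \<le> i" if "i \<in> I" for i unfolding \<epsilon>_def using I that by (intro Min_le) auto
    ultimately show "C \<inter> (\<Inter>\<epsilon>\<in>I. ?S \<epsilon>) \<noteq> {}" using approx[of \<epsilon>] by fastforce
  qed
  then obtain m where m: "m \<in> C" "\<And>\<epsilon>. \<epsilon> > 0 \<Longrightarrow> D p x m \<le> a + \<epsilon> \<and> D p m y \<le> b + \<epsilon>" by auto
  have "D p x m \<le> a" "D p m y \<le> b" using m(2) by (auto intro: field_le_epsilon)
  then show ?thesis using m(1) by blast
qed

text \<open>A new time is placed between its two neighbours among the times already treated, and its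
  point interpolates theirs; the triangle inequality through the nearer neighbour on each side gives
  the bounds to all other times. The function \<open>\<gamma>\<close> is total, but controlled only
  at the listed times.\<close>

lemma finite_geodesic:
  assumes link: "interpolating p" and p: "p \<ge> 1" and xy: "x \<in> C" "y \<in> C" and T: "finite T" "T \<subseteq> {0..1}"
  shows "\<exists>\<gamma>. (\<forall>t. \<gamma> t \<in> C) \<and> \<gamma> 0 = x \<and> \<gamma> 1 = y \<and>
    (\<forall>s\<in>T \<union> {0, 1}. \<forall>t\<in>T \<union> {0, 1}. D p (\<gamma> s) (\<gamma> t) \<le> \<bar>t - s\<bar> * D p x y)"
  using T
proof (induction T rule: finite_induct)
  case empty
  let ?\<gamma> = "\<lambda>t::real. if t = 0 then x else y"
  show ?case
    using xy p D_refl[of x p] D_refl[of y p] D_sym[of p y x] by (intro exI[of _ ?\<gamma>]) auto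
next
  case (insert t T)
  let ?T = "T \<union> {0, 1}" and ?L = "D p x y"
  have p0: "p > 0" using p by simp
  have "T \<subseteq> {0..1}" using insert.prems by simp
  from insert.IH[OF this] obtain \<gamma> where ex: "\<forall>t. \<gamma> t \<in> C" "\<gamma> 0 = x" "\<gamma> 1 = y"
    "\<forall>s\<in>?T. \<forall>t\<in>?T. D p (\<gamma> s) (\<gamma> t) \<le> \<bar>t - s\<bar> * ?L" by blast
  then have \<gamma>: "\<And>t. \<gamma> t \<in> C" "\<gamma> 0 = x" "\<gamma> 1 = y"
    "\<And>s t. s \<in> ?T \<Longrightarrow> t \<in> ?T \<Longrightarrow> D p (\<gamma> s) (\<gamma> t) \<le> \<bar>t - s\<bar> * ?L" by blast+
  show ?case
  proof (cases "t \<in> ?T")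
    case True
    then have "insert t T \<union> {0, 1} = ?T" by blast
    then show ?thesis using ex by (simp only:) blast
  next
    case False
    have t01: "0 < t" "t < 1" using False insert.prems by (auto simp: less_le)
    define l where "l = Max {s \<in> ?T. s < t}"
    define r where "r = Min {s \<in> ?T. t < s}"
    have fl: "finite {s \<in> ?T. s < t}" "{s \<in> ?T. s < t} \<noteq> {}" and fr: "finite {s \<in> ?T. t < s}" "{s \<in> ?T. t < s} \<noteq> {}"
      using insert.hyps(1) t01 by auto
    have l: "l \<in> ?T" "l < t" "\<And>s. s \<in> ?T \<Longrightarrow> s < t \<Longrightarrow> s \<le> l"
      using Max_in[OF fl] Max_ge[OF fl(1)] unfolding l_def by blast+
    have r: "r \<in> ?T" "t < r" "\<And>s. s \<in> ?T \<Longrightarrow> t < s \<Longrightarrow> r \<le> s"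
      using Min_in[OF fr] Min_le[OF fr(1)] unfolding r_def by blast+
    \<comment> \<open>The distance \<open>h\<close> may be smaller than the time gap times
      \<open>?L\<close>, as only upper bounds are carried along; it is therefore \<open>h\<close>
      that is divided in the ratio of the time gaps.\<close>
    define h where "h = D p (\<gamma> l) (\<gamma> r)"
    define a where "a = h * ((t - l) / (r - l))"
    define b where "b = h * ((r - t) / (r - l))"
    have h: "0 \<le> h" "h \<le> (r - l) * ?L" using \<gamma>(4)[OF l(1) r(1)] l(2) r(2) D_nonneg by (auto simp: h_def)
    have ab: "0 \<le> a" "0 \<le> b" using h(1) l(2) r(2) by (auto simp: a_def b_def)
    have "a + b = h * (((t - l) + (r - t)) / (r - l))"
      unfolding a_def b_def by (simp only: distrib_left add_divide_distrib)
    then have sum: "a + b = h" using l(2) r(2) by simp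
    obtain m where m: "m \<in> C" "D p (\<gamma> l) m \<le> a" "D p m (\<gamma> r) \<le> b"
      using D_interpolation[OF link p \<gamma>(1) \<gamma>(1) ab sum[unfolded h_def]] by blast
    have "a \<le> ((r - l) * ?L) * ((t - l) / (r - l))" "b \<le> ((r - l) * ?L) * ((r - t) / (r - l))"
      unfolding a_def b_def using h l(2) r(2) by (intro mult_right_mono; simp)+
    then have ab': "a \<le> (t - l) * ?L" "b \<le> (r - t) * ?L" using l(2) r(2) by (auto simp: mult.commute)
    have key: "D p (\<gamma> s) m \<le> \<bar>t - s\<bar> * ?L" if s: "s \<in> ?T" for s
    proof (cases "s < t")
      case True
      have "D p (\<gamma> s) m \<le> D p (\<gamma> s) (\<gamma> l) + D p (\<gamma> l) m" using \<gamma>(1) m(1) by (intro D_triangle)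
      also have "\<dots> \<le> (l - s) * ?L + (t - l) * ?L"
        using \<gamma>(4)[OF s l(1)] l(3)[OF s True] m(2) ab'(1) by simp
      also have "\<dots> = \<bar>t - s\<bar> * ?L" using True by (simp add: algebra_simps)
      finally show ?thesis .
    next
      case False
      then have st: "t < s" using s \<open>t \<notin> ?T\<close> by (metis linorder_neqE_linordered_idom)
      have "D p (\<gamma> s) m \<le> D p (\<gamma> s) (\<gamma> r) + D p (\<gamma> r) m" using \<gamma>(1) m(1) by (intro D_triangle)
      also have "\<dots> \<le> (s - r) * ?L + (r - t) * ?L"
        using \<gamma>(4)[OF s r(1)] r(3)[OF s st] m(3) ab'(2) D_sym[OF p0, of "\<gamma> r" m] by simp
      also have "\<dots> = \<bar>t - s\<bar> * ?L" using st by (simp add: algebra_simps)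
      finally show ?thesis .
    qed
    let ?\<gamma> = "\<gamma>(t := m)"
    have "D p (?\<gamma> u) (?\<gamma> v) \<le> \<bar>v - u\<bar> * ?L" if "u \<in> insert t T \<union> {0, 1}" "v \<in> insert t T \<union> {0, 1}" for u v
    proof -
      have uv: "u = t \<or> u \<in> ?T" "v = t \<or> v \<in> ?T" using that by auto
      show ?thesis
        using uv key[of u] key[of v] \<gamma>(4)[of u v] D_refl[OF m(1) p0] D_sym[OF p0, of m "\<gamma> v"] False
        by (auto simp: abs_minus_commute)
    qed
    then show ?thesis using \<gamma> m(1) t01 by (intro exI[of _ ?\<gamma>]) auto
  qed
qed

text \<open>In the product topology, the condition for each pair of times is closed, because
  evaluations and \<open>D p\<close> are continuous, and finitely many conditions hold together by
  \<open>finite_geodesic\<close>. Compactness of the product yields one curve for all pairs.\<close>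

lemma geodesic_space_D:
  assumes link: "interpolating p"
    and p: "p \<ge> 1"
  shows "geodesic_space C (D p)"
  unfolding geodesic_space_def
proof (intro ballI)
  fix x y assume xy: "x \<in> C" "y \<in> C"
  let ?L = "D p x y"
  let ?P = "PiE UNIV (\<lambda>_. C) :: (real \<Rightarrow> 'a) set"
  have P: "compact ?P"
    using compactin_PiE[of "\<lambda>_. euclidean :: 'a topology" "UNIV :: real set" "\<lambda>_. C"] compact_C
    by (simp add: euclidean_product_topology)
  have ev: "continuous_on S (\<lambda>\<gamma>. \<gamma> t)" for S :: "(real \<Rightarrow> 'a) set" and t
    by (rule continuous_on_product_then_coordinatewise) (rule continuous_on_id)
  let ?Z = "\<lambda>(s, t). {\<gamma> \<in> ?P. \<gamma> 0 = x \<and> \<gamma> 1 = y \<and> D p (\<gamma> s) (\<gamma> t) \<le> \<bar>t - s\<bar> * ?L}"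
  have "?P \<inter> (\<Inter>i\<in>{0..1} \<times> {0..1}. ?Z i) \<noteq> {}"
  proof (rule compact_imp_fip_image[OF P])
    fix i :: "real \<times> real"
    obtain s t where i: "i = (s, t)" by (cases i)
    have "closed (\<Inter>t. (\<lambda>\<gamma>. \<gamma> t) -` C :: (real \<Rightarrow> 'a) set)"
      using ev[of UNIV] by (intro closed_INT ballI closed_vimage compact_imp_closed[OF compact_C])
    moreover have "?P = (\<Inter>t. (\<lambda>\<gamma>. \<gamma> t) -` C)" by auto
    ultimately have c: "closed ?P" by simp
    have "continuous_on ?P (\<lambda>\<gamma>. case (\<gamma> s, \<gamma> t) of (x, y) \<Rightarrow> D p x y)"
      by (rule continuous_on_compose2[OF continuous_on_D[OF p]]) (auto intro!: continuous_on_Pair ev)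
    then have "closed (?P \<inter> (\<lambda>\<gamma>. D p (\<gamma> s) (\<gamma> t)) -` {..\<bar>t - s\<bar> * ?L})"
      by (intro continuous_closed_preimage c) auto
    moreover have "closed (?P \<inter> (\<lambda>\<gamma>. \<gamma> 0) -` {x})" "closed (?P \<inter> (\<lambda>\<gamma>. \<gamma> 1) -` {y})"
      by (intro continuous_closed_preimage c ev; simp)+
    moreover have "?Z i = (?P \<inter> (\<lambda>\<gamma>. D p (\<gamma> s) (\<gamma> t)) -` {..\<bar>t - s\<bar> * ?L}) \<inter>
        ((?P \<inter> (\<lambda>\<gamma>. \<gamma> 0) -` {x}) \<inter> (?P \<inter> (\<lambda>\<gamma>. \<gamma> 1) -` {y}))" by (auto simp: i)
    ultimately show "closed (?Z i)" by (simp only: closed_Int)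
  next
    fix I :: "(real \<times> real) set" assume I: "finite I" "I \<subseteq> {0..1} \<times> {0..1}"
    let ?T = "fst ` I \<union> snd ` I"
    have "finite ?T" "?T \<subseteq> {0..1}" using I by auto
    from finite_geodesic[OF link p xy this]
    obtain \<gamma> where \<gamma>: "\<forall>t. \<gamma> t \<in> C" "\<gamma> 0 = x" "\<gamma> 1 = y"
      "\<forall>s\<in>?T \<union> {0, 1}. \<forall>t\<in>?T \<union> {0, 1}. D p (\<gamma> s) (\<gamma> t) \<le> \<bar>t - s\<bar> * ?L" by blast
    have \<gamma>P: "\<gamma> \<in> ?P" using \<gamma>(1) by auto
    have "\<gamma> \<in> ?Z i" if "i \<in> I" for i
    proof -
      have "fst i \<in> ?T \<union> {0, 1}" "snd i \<in> ?T \<union> {0, 1}" using that by blast+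
      then have "D p (\<gamma> (fst i)) (\<gamma> (snd i)) \<le> \<bar>snd i - fst i\<bar> * ?L" using \<gamma>(4) by blast
      then show ?thesis using \<gamma>P \<gamma>(2,3) by (simp add: split_def)
    qed
    then show "?P \<inter> (\<Inter>i\<in>I. ?Z i) \<noteq> {}" using \<gamma>P by blast
  qed
  then have "\<exists>\<gamma>. \<gamma> \<in> ?P \<inter> (\<Inter>i\<in>{0..1} \<times> {0..1}. ?Z i)" by (simp only: ex_in_conv not_False_eq_True)
  then obtain \<gamma> where \<gamma>: "\<gamma> \<in> ?P \<inter> (\<Inter>i\<in>{0..1} \<times> {0..1}. ?Z i)" by (rule exE)
  have \<gamma>P: "\<gamma> \<in> ?P" using \<gamma> by (rule IntD1)
  have \<gamma>Z: "\<gamma> \<in> ?Z i" if "i \<in> {0..1} \<times> {0..1}" for i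
    using IntD2[OF \<gamma>] that by (rule INT_D)
  have \<gamma>0: "\<gamma> 0 = x" "\<gamma> 1 = y" using \<gamma>Z[of "(0, 0)"] by auto
  have \<gamma>C: "\<gamma> t \<in> C" for t using \<gamma>P by auto
  have le: "D p (\<gamma> s) (\<gamma> t) \<le> \<bar>t - s\<bar> * ?L" if "s \<in> {0..1}" "t \<in> {0..1}" for s t
    using \<gamma>Z[of "(s, t)"] that by auto
  have eq: "D p (\<gamma> s) (\<gamma> t) = \<bar>t - s\<bar> * ?L" if st: "s \<in> {0..1}" "t \<in> {0..1}" "s \<le> t" for s t
  proof (rule antisym[OF le[OF st(1,2)]])
    \<comment> \<open>The upper bounds for the three pieces add up to exactly \<open>?L\<close>, so
      each of them is attained.\<close>
    have "?L \<le> D p x (\<gamma> s) + (D p (\<gamma> s) (\<gamma> t) + D p (\<gamma> t) y)"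
      using D_triangle[OF xy(1) \<gamma>C xy(2), of p s] D_triangle[OF \<gamma>C \<gamma>C xy(2), of p s t] by linarith
    moreover have "D p x (\<gamma> s) \<le> s * ?L" "D p (\<gamma> t) y \<le> (1 - t) * ?L"
      using le[of 0 s] le[of t 1] st \<gamma>0 by auto
    ultimately show "\<bar>t - s\<bar> * ?L \<le> D p (\<gamma> s) (\<gamma> t)" using st by (simp add: algebra_simps)
  qed
  have "D p (\<gamma> s) (\<gamma> t) = \<bar>t - s\<bar> * D p (\<gamma> 0) (\<gamma> 1)" if "s \<in> {0..1}" "t \<in> {0..1}" for s t
    using eq[of s t] eq[of t s] that D_sym[of p "\<gamma> s" "\<gamma> t"] p \<gamma>0 by (cases "s \<le> t") (auto simp: abs_minus_commute)
  then show "\<exists>\<gamma>. \<gamma> 0 = x \<and> \<gamma> 1 = y \<and> (\<forall>t\<in>{0..1}. \<gamma> t \<in> C) \<and>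
      (\<forall>s\<in>{0..1}. \<forall>t\<in>{0..1}. D p (\<gamma> s) (\<gamma> t) = \<bar>t - s\<bar> * D p (\<gamma> 0) (\<gamma> 1))"
    using \<gamma>0 \<gamma>C by (intro exI[of _ \<gamma>]) simp
qed

lemma geodesic_space_D_1: "geodesic_space C (D 1)"
proof (rule geodesic_space_D)
  show "interpolating 1"
    unfolding interpolating_def
  proof (intro ballI allI impI)
    fix x y a b and \<epsilon> :: real
    assume *: "x \<in> C" "y \<in> C" "0 \<le> a" "0 \<le> b" "0 < \<epsilon>" "a + b = R 1 x y"
    obtain m where "m \<in> C" "R 1 x m \<le> a" "R 1 m y \<le> b"
      using link_interpolation_roof_1[OF *(1-4,6)] by blast
    then show "\<exists>m\<in>C. R 1 x m \<le> a + \<epsilon> \<and> R 1 m y \<le> b + \<epsilon>"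
      using *(5) by (intro bexI[of _ m]) auto
  qed
qed simp

lemma geodesic_space_D_geodesic:
  assumes "geodesic_space E d" "p \<ge> 1" shows "geodesic_space C (D p)"
  using link_interpolation_roof[OF assms(1) _ _ assms(2)] assms(2)
  by (intro geodesic_space_D) (simp_all add: interpolating_def)

text \<open>Hahn-Banach for the sublinear functional \<open>N\<close> gives a norming functional of
  \<open>z - w\<close>, whose restriction lies in \<open>A_Lip\<close> and separates
  \<open>z\<close> and \<open>w\<close> by exactly \<open>d z w\<close>. It is continuous because
  \<open>N\<close> induces the given topology, which makes the unit ball of \<open>N\<close> an open
  neighbourhood of 0.\<close>

lemma D_norm_ge:
  assumes N: "banach_norm N" and dN: "\<forall>z\<in>E. \<forall>w\<in>E. d z w = N (z - w)" and p: "p \<ge> 1"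
    and zw: "z \<in> E" "w \<in> E"
  shows "d z w \<le> D p z w"
proof -
  have norm: "0 \<le> N x" "N x = 0 \<longleftrightarrow> x = 0" "N (c *\<^sub>R x) = \<bar>c\<bar> * N x" "N (x + y) \<le> N x + N y" for c x y
    using N by (auto simp: banach_norm_def)
  have minus: "N (- x) = N x" for x using norm(3)[of "-1" x] by simp
  interpret M: Metric_space UNIV "\<lambda>x y. N (x - y)"
  proof
    show "N (x - y) = N (y - x)" for x y using minus[of "x - y"] by simp
    show "N (x - z) \<le> N (x - y) + N (y - z)" for x y z using norm(4)[of "x - y" "y - z"] by simp
  qed (simp_all add: norm)
  have "M.mtopology = euclidean" using N by (simp add: banach_norm_def)
  then have "open (M.mball 0 1)" using M.openin_mball[of 0 1] by (simp only: open_openin)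
  moreover have "M.mball 0 1 = {v. N v < 1}" using minus by (auto simp: M.mball_def)
  ultimately have oB: "open {v. N v < 1}" by simp
  have "sublinear N" unfolding sublinear_def using norm by auto
  then obtain f where f: "linear f" "\<And>x. f x \<le> N x" "f (z - w) = N (z - w)"
    using Hahn_Banach_sublinear[of N "z - w"] by blast
  have fd: "f \<in> dual_space"
  proof (rule linear_bounded_nhd_in_dual_space[OF f(1) oB])
    show "0 \<in> {v. N v < 1}" using norm(2)[of 0] by simp
    show "f v \<le> 1" if "v \<in> {v. N v < 1}" for v using f(2)[of v] that by simp
  qed
  have "f \<in> A_Lip d C"
    unfolding A_Lip_def
  proof (intro CollectI conjI ballI)
    show "continuous_on C f" using fd by (rule dual_space_continuous_on)
    show "affine_on C f" by (simp add: affine_on_def linear_add[OF f(1)] linear_cmul[OF f(1)])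
    fix u v assume "u \<in> E" "v \<in> E"
    then have "d u v = N (u - v)" using dN by blast
    moreover have "\<bar>f (u - v)\<bar> \<le> N (u - v)"
      using f(2)[of "u - v"] f(2)[of "- (u - v)"] minus[of "u - v"] linear_neg[OF f(1), of "u - v"] by simp
    ultimately show "\<bar>f u - f v\<bar> \<le> d u v" by (simp add: linear_diff[OF f(1)])
  qed
  then have "\<bar>f z - f w\<bar> \<le> D 1 z w"
    using zw Ext_subset by (intro D_1_ge_difference Lipschitz_le_roof_1) auto
  moreover have "D 1 z w \<le> D p z w" using p zw Ext_subset by (intro D_mono_exponent) auto
  moreover have "f z - f w = d z w" using f(3) dN zw by (simp add: linear_diff[OF f(1)])
  ultimately show ?thesis by simp
qed

end

theorem theorem1p7:
  fixes C :: "'a::locally_convex_space set"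
    and d :: "'a \<Rightarrow> 'a \<Rightarrow> real"
  assumes "compact C" and "convex C" and "stable_convex C"
    and "Metric_space (Ext C) d"
    and "continuous_on (Ext C \<times> Ext C) (\<lambda>(z, w). d z w)"
    and "\<forall>x\<in>C. \<forall>y\<in>C. x \<noteq> y \<longrightarrow> (\<exists>a\<in>A_Lip d C. a x \<noteq> a y)"
  shows
    "((\<forall>p\<ge>1. Metric_space C (sub_roof p C d) \<and>
         Metric_space.mtopology C (sub_roof p C d) = top_of_set C \<and>
         compact_space (Metric_space.mtopology C (sub_roof p C d))) \<and>
      (\<forall>p q. 1 \<le> p \<longrightarrow> p \<le> q \<longrightarrow>
         (\<forall>x\<in>C. \<forall>y\<in>C. sub_roof p C d x y \<le> sub_roof q C d x y))) \<and>
     (geodesic_space C (sub_roof 1 C d) \<and>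
      (geodesic_space (Ext C) d \<longrightarrow> (\<forall>p>1. geodesic_space C (sub_roof p C d)))) \<and>
     ((\<forall>p\<ge>1. \<forall>z\<in>Ext C. \<forall>w\<in>Ext C. sub_roof p C d z w \<le> d z w) \<and>
      (\<forall>N. banach_norm N \<longrightarrow> (\<forall>z\<in>Ext C. \<forall>w\<in>Ext C. d z w = N (z - w)) \<longrightarrow>
         (\<forall>p\<ge>1. \<forall>z\<in>Ext C. \<forall>w\<in>Ext C. sub_roof p C d z w = d z w)))"
proof -
  interpret separated_stable_roof C d
    by (intro separated_stable_roof.intro stable_roof.intro separated_stable_roof_axioms.intro assms)
  have upper: "sub_roof p C d z w \<le> d z w" if "p \<ge> 1" "z \<in> Ext C" "w \<in> Ext C" for p z w
  proof -
    have "z \<in> C" "w \<in> C" using that Ext_subset by auto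
    then show ?thesis using D_le_roof[of z w p] roof_le_d[of z w p] that by simp
  qed
  have "compact_space (Metric_space.mtopology C (sub_roof p C d))" if "p \<ge> 1" for p
    using mtopology_D[OF that] compact_C by (simp add: compact_space_subtopology)
  moreover have "sub_roof p C d z w = d z w"
    if "banach_norm N" "\<forall>z\<in>Ext C. \<forall>w\<in>Ext C. d z w = N (z - w)" "p \<ge> 1" "z \<in> Ext C" "w \<in> Ext C" for N p z w
    using D_norm_ge[OF that] upper[OF that(3-5)] by simp
  ultimately show ?thesis
    using Metric_space_D mtopology_D D_mono_exponent geodesic_space_D_1 geodesic_space_D_geodesic upper
    by (intro conjI allI impI ballI) auto
qed

end
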